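(* Let $\Gamma=(V,E)$ be a finite connected simple undirected graph, let $B\subsetneq V$ be a set of at least $2$ vertices, no two of which are adjacent, and let $u:B\to\mathbb{R}$ be injective. Let $\widehat{\Gamma}$ be the graph obtained from $\Gamma$ by adding an edge between each pair of elements of $B$. For generic $\varepsilon\in\mathbb{C}^E$ (that is, for all $\varepsilon$ outside some proper algebraic subset of $\mathbb{C}^E$), the number of $\varepsilon$-harmonic functions on $(\Gamma,u)$ is $$\frac{\beta(\widehat{\Gamma})}{(|B|-2)!}.$$
   Context: Write $V^\circ=V\setminus B$. For a graph $\Delta$ with chromatic polynomial $\chi_\Delta$, the beta invariant is $\beta(\Delta)=|\chi_\Delta'(1)|$, where $\chi_\Delta'$ is the derivative. For $c\in\mathbb{C}^E$ let $L(c)$ be the weighted Laplacian matrix of $\Gamma$ (diagonal entries $\sum_{v\sim i}c_{iv}$, entries $-c_{ij}$ for $i\sim j$, and $0$ otherwise), and let $K(c)$ be its principal submatrix indexed by $V^\circ$. Call $c$ generic if $K(c)$ is nonsingular. For generic $c$ there is a unique harmonic function $h(c):V\to\mathbb{C}$ on $(\Gamma,u,c)$, i.e. a function extending $u$ with $\sum_{j\sim i}c_{ij}(h(c)_i-h(c)_j)=0$ for all $i\in V^\circ$. For $\varepsilon\in\mathbb{C}^E$, the $\varepsilon$-harmonic functions on $(\Gamma,u)$ are the functions $h(c)$ as $c$ ranges over all generic $c\in\mathbb{C}^E$ satisfying $c_{ij}(h(c)_i-h(c)_j)^2=\varepsilon_{ij}$ for all $ij\in E$. *)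

theory Defs
  imports "HOL-Analysis.Analysis" "HOL-Library.Poly_Mapping"
    "HOL-Computational_Algebra.Polynomial"
begin

section \<open>Graphs and the beta invariant\<close>

definition simple_graph :: "'v set \<Rightarrow> 'v set set \<Rightarrow> bool" where
  "simple_graph V E \<longleftrightarrow> finite V \<and> (\<forall>e\<in>E. e \<subseteq> V \<and> card e = 2)"

definition connected_graph :: "'v set \<Rightarrow> 'v set set \<Rightarrow> bool" where
  "connected_graph V E \<longleftrightarrow> V \<noteq> {} \<and> (\<forall>x\<in>V. \<forall>y\<in>V. (x, y) \<in> {(a, b). {a, b} \<in> E}\<^sup>*)"

definition colourings :: "'v set \<Rightarrow> 'v set set \<Rightarrow> nat \<Rightarrow> ('v \<Rightarrow> nat) set" where
  "colourings V E k = {f \<in> V \<rightarrow>\<^sub>E {..<k}. \<forall>x y. {x, y} \<in> E \<longrightarrow> f x \<noteq> f y}"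

definition chromatic_poly :: "'v set \<Rightarrow> 'v set set \<Rightarrow> int poly" where
  "chromatic_poly V E = (THE p. \<forall>k. poly p (int k) = int (card (colourings V E k)))"

definition beta_invariant :: "'v set \<Rightarrow> 'v set set \<Rightarrow> int" where
  "beta_invariant V E = \<bar>poly (pderiv (chromatic_poly V E)) 1\<bar>"

definition complete_on :: "'v set \<Rightarrow> 'v set set" where
  "complete_on B = {{x, y} | x y. x \<in> B \<and> y \<in> B \<and> x \<noteq> y}"

text \<open>
  The description of \<^const>\<open>chromatic_poly\<close> determines a unique polynomial. Existence is proved by
  deletion-contraction for arbitrary binary relations, so that contraction needs no bookkeeping of
  loops and parallel edges.
\<close>

lemma ex_relation_chromatic_poly:
  fixes V :: "'v set" and R :: "('v \<times> 'v) set"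
  assumes "finite V" "finite R" "R \<subseteq> V \<times> V"
  shows "\<exists>p :: int poly. \<forall>k.
    poly p (int k) = int (card {f \<in> V \<rightarrow>\<^sub>E {..<k}. \<forall>(x, y)\<in>R. f x \<noteq> f y})"
  using assms
proof (induction "card R" arbitrary: V R rule: less_induct)
  case less
  define C where "C = (\<lambda>W S k. {f \<in> W \<rightarrow>\<^sub>E {..<k::nat}. \<forall>(x::'v, y)\<in>S. f x \<noteq> f y})"
  have IH: "\<exists>p :: int poly. \<forall>k. poly p (int k) = int (card (C W S k))"
    if "card S < card R" "finite W" "finite S" "S \<subseteq> W \<times> W" for W S
    using less.hyps that unfolding C_def by blast
  have "\<exists>p :: int poly. \<forall>k. poly p (int k) = int (card (C V R k))"
  proof (cases "R = {}")
    case True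
    then have "\<forall>k. poly (monom 1 (card V) :: int poly) (int k) = int (card (C V R k))"
      using less.prems by (simp add: C_def poly_monom card_funcsetE)
    then show ?thesis by blast
  next
    case False
    then obtain a b where abR: "(a, b) \<in> R" by auto
    define R' where "R' = R - {(a, b)}"
    have R: "R = insert (a, b) R'" "card R' < card R" "finite R'" "R' \<subseteq> V \<times> V"
      using abR less.prems psubset_card_mono[of R R'] by (auto simp: R'_def)
    have ab: "a \<in> V" "b \<in> V" using abR less.prems by auto
    show ?thesis
    proof (cases "a = b")
      case True
      then have "\<forall>k. poly (0 :: int poly) (int k) = int (card (C V R k))"
        using R by (simp add: C_def)
      then show ?thesis by blast
    next
      case False
      define g where "g = (\<lambda>x. if x = b then a else x)"
      define S where "S = (\<lambda>(x, y). (g x, g y)) ` R'"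
      have S: "finite S" "S \<subseteq> (V - {b}) \<times> (V - {b})"
        using R ab False by (auto simp: S_def g_def split: if_splits)
      have "card S \<le> card R'" unfolding S_def using R(3) by (rule card_image_le)
      then have cS: "card S < card R" using R(2) by simp
      obtain p :: "int poly" where p: "\<And>k. poly p (int k) = int (card (C V R' k))"
        using IH[OF R(2) less.prems(1) R(3,4)] by metis
      obtain q :: "int poly" where q: "\<And>k. poly q (int k) = int (card (C (V - {b}) S k))"
        using IH[OF cS _ S] less.prems(1) finite_Diff by metis
      have "poly (p - q) (int k) = int (card (C V R k))" for k
      proof -
        let ?D = "{f \<in> C V R' k. f a = f b}"
        have "bij_betw (\<lambda>f. restrict f (V - {b})) ?D (C (V - {b}) S k)"
        proof (rule bij_betw_byWitness[where f' = "\<lambda>f. f(b := f a)"])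
          show "\<forall>f\<in>?D. (restrict f (V - {b}))(b := restrict f (V - {b}) a) = f"
            using ab False
            by (auto simp: C_def fun_eq_iff restrict_def PiE_def extensional_def)
          show "\<forall>f\<in>C (V - {b}) S k. restrict (f(b := f a)) (V - {b}) = f"
            using ab False
            by (auto simp: C_def fun_eq_iff restrict_def PiE_def extensional_def)
          show "(\<lambda>f. restrict f (V - {b})) ` ?D \<subseteq> C (V - {b}) S k"
          proof safe
            fix f assume f: "f \<in> C V R' k" "f a = f b"
            have g: "g x \<in> V - {b}" "f (g x) = f x" if "x \<in> V" for x
              using that ab False f(2) by (auto simp: g_def)
            have "restrict f (V - {b}) (g x) \<noteq> restrict f (V - {b}) (g y)"
              if "(x, y) \<in> R'" for x y
            proof -
              have "x \<in> V" "y \<in> V" using that R(4) by auto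
              then show ?thesis using that f(1) g by (auto simp: C_def)
            qed
            moreover have "restrict f (V - {b}) \<in> (V - {b}) \<rightarrow>\<^sub>E {..<k}"
              using f(1) by (auto simp: C_def)
            ultimately show "restrict f (V - {b}) \<in> C (V - {b}) S k"
              unfolding C_def S_def mem_Collect_eq by (auto simp del: restrict_apply)
          qed
          show "(\<lambda>f. f(b := f a)) ` C (V - {b}) S k \<subseteq> ?D"
          proof safe
            fix f assume f: "f \<in> C (V - {b}) S k"
            have fg: "(f(b := f a)) x = f (g x)" for x by (simp add: g_def)
            have m: "f(b := f a) \<in> V \<rightarrow>\<^sub>E {..<k}"
              using f ab False by (auto simp: C_def PiE_def extensional_def Pi_def)
            show "f(b := f a) \<in> C V R' k"
              using m f unfolding C_def mem_Collect_eq fg by (auto simp: S_def)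
            show "(f(b := f a)) a = (f(b := f a)) b" by simp
          qed
        qed
        then have D: "card ?D = card (C (V - {b}) S k)" by (rule bij_betw_same_card)
        have fin: "finite (C V R' k)"
          unfolding C_def using less.prems(1) by (simp add: finite_PiE)
        have CR: "C V R k = C V R' k - ?D" unfolding C_def R(1) by auto
        have "card (C V R k) = card (C V R' k) - card ?D"
          unfolding CR by (rule card_Diff_subset) (use fin in auto)
        moreover have "card ?D \<le> card (C V R' k)" by (rule card_mono) (use fin in auto)
        ultimately show ?thesis using D by (simp add: p q of_nat_diff)
      qed
      then show ?thesis by blast
    qed
  qed
  then show ?case by (simp add: C_def)
qed

lemma chromatic_poly_unique:
  fixes p q :: "int poly"
  assumes "\<And>k. poly p (int k) = poly q (int k)"
  shows "p = q"
proof (rule ccontr)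
  assume "p \<noteq> q"
  then have "finite {x. poly (p - q) x = 0}" by (intro poly_roots_finite) simp
  moreover have "range int \<subseteq> {x. poly (p - q) x = 0}" using assms by auto
  ultimately have "finite (range int)" by (rule rev_finite_subset)
  then show False by (simp add: finite_image_iff)
qed

lemma poly_chromatic_poly:
  assumes "simple_graph V E"
  shows "poly (chromatic_poly V E) (int k) = int (card (colourings V E k))"
proof -
  have V: "finite V" using assms by (simp add: simple_graph_def)
  let ?R = "{(x, y). {x, y} \<in> E}"
  have R: "?R \<subseteq> V \<times> V" using assms by (auto simp: simple_graph_def)
  have "finite ?R" using R V by (meson finite_SigmaI finite_subset)
  then obtain p :: "int poly" where p: "\<forall>k. poly p (int k) = int (card (colourings V E k))"
    using ex_relation_chromatic_poly[OF V _ R] by (auto simp: colourings_def)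
  have "\<exists>!p :: int poly. \<forall>k. poly p (int k) = int (card (colourings V E k))"
  proof (rule ex1I[of _ p])
    show "q = p" if "\<forall>k. poly q (int k) = int (card (colourings V E k))" for q
      by (rule chromatic_poly_unique) (use p that in simp)
  qed (rule p)
  from theI'[OF this] show ?thesis by (simp add: chromatic_poly_def)
qed


section \<open>Harmonic functions on weighted graphs\<close>

text \<open>
  A graph function with values in \<^typ>\<open>complex\<close> is an element of \<open>V \<rightarrow>\<^sub>E UNIV\<close> and a vector in
  \<open>\<complex>\<^sup>E\<close> is an element of \<open>E \<rightarrow>\<^sub>E UNIV\<close>; extensionality makes counting such functions meaningful.
\<close>

definition neighbours :: "'v set \<Rightarrow> 'v set set \<Rightarrow> 'v \<Rightarrow> 'v set" where
  "neighbours V E i = {j \<in> V. {i, j} \<in> E}"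

definition laplacian :: "'v set \<Rightarrow> 'v set set \<Rightarrow> ('v set \<Rightarrow> complex) \<Rightarrow> 'v \<Rightarrow> 'v \<Rightarrow> complex" where
  "laplacian V E c i j =
    (if i = j then (\<Sum>v\<in>neighbours V E i. c {i, v})
     else if {i, j} \<in> E then - c {i, j} else 0)"

text \<open>
  This is \<^const>\<open>invertible\<close> for the square matrix with rows and columns indexed by the finite set
  \<open>S\<close> instead of a finite type. Only the entries \<open>A i j\<close> with \<open>i, j \<in> S\<close> matter, so
  \<open>nonsingular_on S A\<close> says that the principal submatrix of \<open>A\<close> indexed by \<open>S\<close> is nonsingular.
\<close>

definition nonsingular_on :: "'v set \<Rightarrow> ('v \<Rightarrow> 'v \<Rightarrow> complex) \<Rightarrow> bool" where
  "nonsingular_on S A \<longleftrightarrow>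
    (\<exists>M. \<forall>i\<in>S. \<forall>k\<in>S. (\<Sum>j\<in>S. A i j * M j k) = (if i = k then 1 else 0)
                      \<and> (\<Sum>j\<in>S. M i j * A j k) = (if i = k then 1 else 0))"

definition generic_weights ::
    "'v set \<Rightarrow> 'v set set \<Rightarrow> 'v set \<Rightarrow> ('v set \<Rightarrow> complex) \<Rightarrow> bool" where
  "generic_weights V E B c \<longleftrightarrow> c \<in> E \<rightarrow>\<^sub>E UNIV \<and> nonsingular_on (V - B) (laplacian V E c)"

definition harmonic ::
    "'v set \<Rightarrow> 'v set set \<Rightarrow> 'v set \<Rightarrow> ('v \<Rightarrow> real) \<Rightarrow> ('v set \<Rightarrow> complex) \<Rightarrow> ('v \<Rightarrow> complex) \<Rightarrow> bool"
  where
  "harmonic V E B u c h \<longleftrightarrow> h \<in> V \<rightarrow>\<^sub>E UNIV \<and> (\<forall>b\<in>B. h b = complex_of_real (u b)) \<and>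
    (\<forall>i\<in>V - B. (\<Sum>j\<in>neighbours V E i. c {i, j} * (h i - h j)) = 0)"

definition the_harmonic ::
    "'v set \<Rightarrow> 'v set set \<Rightarrow> 'v set \<Rightarrow> ('v \<Rightarrow> real) \<Rightarrow> ('v set \<Rightarrow> complex) \<Rightarrow> 'v \<Rightarrow> complex" where
  "the_harmonic V E B u c = (THE h. harmonic V E B u c h)"

definition eps_harmonic_functions ::
    "'v set \<Rightarrow> 'v set set \<Rightarrow> 'v set \<Rightarrow> ('v \<Rightarrow> real) \<Rightarrow> ('v set \<Rightarrow> complex) \<Rightarrow> ('v \<Rightarrow> complex) set" where
  "eps_harmonic_functions V E B u \<epsilon> =
    {the_harmonic V E B u c | c. generic_weights V E B c \<and>
      (\<forall>i j. {i, j} \<in> E \<longrightarrow>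
        c {i, j} * (the_harmonic V E B u c i - the_harmonic V E B u c j)\<^sup>2 = \<epsilon> {i, j})}"

lemma laplacian_sum:
  assumes "simple_graph V E" "i \<in> V"
  shows "(\<Sum>j\<in>V. laplacian V E c i j * h j) = (\<Sum>j\<in>neighbours V E i. c {i, j} * (h i - h j))"
proof -
  have V: "finite V" and i: "{i} \<notin> E" using assms by (auto simp: simple_graph_def)
  have eq: "(V - {i}) \<inter> {j. {i, j} \<in> E} = neighbours V E i"
    using i by (auto simp: neighbours_def)
  have "(\<Sum>j\<in>V. laplacian V E c i j * h j)
      = laplacian V E c i i * h i + (\<Sum>j\<in>V - {i}. laplacian V E c i j * h j)"
    using V assms(2) by (rule sum.remove)
  also have "(\<Sum>j\<in>V - {i}. laplacian V E c i j * h j)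
      = (\<Sum>j\<in>V - {i}. if {i, j} \<in> E then - c {i, j} * h j else 0)"
    by (rule sum.cong) (auto simp: laplacian_def)
  also have "\<dots> = (\<Sum>j\<in>neighbours V E i. - c {i, j} * h j)"
    using V by (simp add: sum.If_cases eq)
  finally show ?thesis
    by (simp add: laplacian_def sum_distrib_right right_diff_distrib sum_subtractf sum_negf)
qed

text \<open>Hence \<^const>\<open>the_harmonic\<close> is well defined for generic weights.\<close>

lemma ex1_harmonic:
  assumes G: "simple_graph V E" and B: "B \<subseteq> V" and c: "generic_weights V E B c"
  shows "\<exists>!h. harmonic V E B u c h"
proof -
  let ?S = "V - B" and ?L = "laplacian V E c"
  define r where "r i = - (\<Sum>j\<in>B. ?L i j * complex_of_real (u j))" for i
  obtain M where M: "\<And>i k. i \<in> ?S \<Longrightarrow> k \<in> ?S \<Longrightarrow> (\<Sum>j\<in>?S. ?L i j * M j k) = (if i = k then 1 else 0)"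
    "\<And>i k. i \<in> ?S \<Longrightarrow> k \<in> ?S \<Longrightarrow> (\<Sum>j\<in>?S. M i j * ?L j k) = (if i = k then 1 else 0)"
    using c unfolding generic_weights_def nonsingular_on_def by blast
  have V: "finite V" using G by (simp add: simple_graph_def)
  then have S: "finite ?S" by simp
  have sys: "harmonic V E B u c h \<longleftrightarrow> h \<in> V \<rightarrow>\<^sub>E UNIV \<and> (\<forall>b\<in>B. h b = complex_of_real (u b)) \<and>
      (\<forall>i\<in>?S. (\<Sum>j\<in>?S. ?L i j * h j) = r i)" for h
  proof -
    have "(\<Sum>j\<in>neighbours V E i. c {i, j} * (h i - h j)) = (\<Sum>j\<in>?S. ?L i j * h j) - r i"
      if "\<forall>b\<in>B. h b = complex_of_real (u b)" "i \<in> ?S" for i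
    proof -
      have "(\<Sum>j\<in>neighbours V E i. c {i, j} * (h i - h j)) = (\<Sum>j\<in>V. ?L i j * h j)"
        using laplacian_sum[OF G] that by simp
      also have "\<dots> = (\<Sum>j\<in>?S. ?L i j * h j) + (\<Sum>j\<in>B. ?L i j * h j)"
        using B V by (rule sum.subset_diff)
      also have "(\<Sum>j\<in>B. ?L i j * h j) = - r i" using that by (simp add: r_def)
      finally show ?thesis by simp
    qed
    then show ?thesis unfolding harmonic_def by auto
  qed
  show ?thesis
  proof (rule ex1I)
    let ?h = "\<lambda>i. if i \<in> B then complex_of_real (u i)
        else if i \<in> V then (\<Sum>k\<in>?S. M i k * r k) else undefined"
    have "(\<Sum>j\<in>?S. ?L i j * ?h j) = r i" if i: "i \<in> ?S" for i
    proof -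
      have "(\<Sum>j\<in>?S. ?L i j * ?h j) = (\<Sum>j\<in>?S. \<Sum>k\<in>?S. ?L i j * M j k * r k)"
        by (rule sum.cong) (auto simp: sum_distrib_left mult.assoc)
      also have "\<dots> = (\<Sum>k\<in>?S. (\<Sum>j\<in>?S. ?L i j * M j k) * r k)"
        by (subst sum.swap) (simp add: sum_distrib_right)
      also have "\<dots> = (\<Sum>k\<in>?S. if i = k then r k else 0)"
        by (rule sum.cong) (use M(1) i in auto)
      finally show ?thesis using i S by simp
    qed
    then show "harmonic V E B u c ?h" unfolding sys using B by (auto simp: PiE_def extensional_def)
  next
    fix h assume "harmonic V E B u c h"
    then have h: "h \<in> V \<rightarrow>\<^sub>E UNIV" "\<And>b. b \<in> B \<Longrightarrow> h b = complex_of_real (u b)"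
      "\<And>i. i \<in> ?S \<Longrightarrow> (\<Sum>j\<in>?S. ?L i j * h j) = r i" unfolding sys by auto
    have "h i = (\<Sum>k\<in>?S. M i k * r k)" if i: "i \<in> ?S" for i
    proof -
      have "(\<Sum>k\<in>?S. M i k * r k) = (\<Sum>k\<in>?S. \<Sum>j\<in>?S. M i k * ?L k j * h j)"
        by (rule sum.cong) (auto simp: h(3)[symmetric] sum_distrib_left mult.assoc)
      also have "\<dots> = (\<Sum>j\<in>?S. (\<Sum>k\<in>?S. M i k * ?L k j) * h j)"
        by (subst sum.swap) (simp add: sum_distrib_right)
      also have "\<dots> = (\<Sum>j\<in>?S. if i = j then h j else 0)"
        by (rule sum.cong) (use M(2) i in auto)
      finally show ?thesis using i S by simp
    qed
    then show "h = (\<lambda>i. if i \<in> B then complex_of_real (u i)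
        else if i \<in> V then (\<Sum>k\<in>?S. M i k * r k) else undefined)"
      using h(1,2) by (auto simp: fun_eq_iff PiE_def extensional_def)
  qed
qed


section \<open>Algebraic subsets of affine space\<close>

text \<open>
  A polynomial in variables from \<open>I\<close> is a finitely supported map from exponent vectors to
  coefficients.
\<close>

definition mpoly_vars :: "(('i \<Rightarrow>\<^sub>0 nat) \<Rightarrow>\<^sub>0 complex) \<Rightarrow> 'i set" where
  "mpoly_vars p = (\<Union>m\<in>Poly_Mapping.keys p. Poly_Mapping.keys m)"

definition mpoly_eval :: "(('i \<Rightarrow>\<^sub>0 nat) \<Rightarrow>\<^sub>0 complex) \<Rightarrow> ('i \<Rightarrow> complex) \<Rightarrow> complex" where
  "mpoly_eval p x = (\<Sum>m\<in>Poly_Mapping.keys p. Poly_Mapping.lookup p m *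
      (\<Prod>i\<in>Poly_Mapping.keys m. x i ^ Poly_Mapping.lookup m i))"

definition algebraic_subset :: "'i set \<Rightarrow> ('i \<Rightarrow> complex) set \<Rightarrow> bool" where
  "algebraic_subset I Z \<longleftrightarrow>
    (\<exists>P. (\<forall>p\<in>P. mpoly_vars p \<subseteq> I) \<and> Z = {x \<in> I \<rightarrow>\<^sub>E UNIV. \<forall>p\<in>P. mpoly_eval p x = 0})"

definition holds_generically :: "'i set \<Rightarrow> (('i \<Rightarrow> complex) \<Rightarrow> bool) \<Rightarrow> bool" where
  "holds_generically I Q \<longleftrightarrow>
    (\<exists>Z. algebraic_subset I Z \<and> Z \<subset> I \<rightarrow>\<^sub>E UNIV \<and> (\<forall>x\<in>(I \<rightarrow>\<^sub>E UNIV) - Z. Q x))"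

end

theory Submission
  imports Defs "Jordan_Normal_Form.Determinant"
begin

text \<open>
  Put \<open>F(c)\<^sub>e = c\<^sub>e (h(c)\<^sub>i - h(c)\<^sub>j)\<^sup>2\<close> for \<open>e = ij\<close>. This is a rational map from the generic weights in \<open>\<complex>\<^sup>E\<close>
  to \<open>\<complex>\<^sup>E\<close>, and for \<open>\<epsilon>\<close> without zero entries its fibre over \<open>\<epsilon>\<close> is in bijection with the
  \<open>\<epsilon>\<close>-harmonic functions. Any \<open>|E| + 1\<close> rational functions of \<open>|E|\<close> variables are algebraically dependent; applied
  to the \<open>F\<^sub>e\<close> together with a coordinate \<open>c\<^sub>e\<close> or with \<open>1 / det K(c)\<close> this shows that \<open>F\<close> is proper over
  the complement of a hypersurface. There \<open>F\<close> is also a local homeomorphism, because the Jacobian of the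
  equations \<open>\<Sum>\<^sub>j \<epsilon>\<^sub>i\<^sub>j / (h\<^sub>i - h\<^sub>j) = 0\<close> in \<open>h\<close> is \<open>-K(c)\<close>. As a complex line minus finitely many points is
  connected, all fibres over this complement have the same cardinality, which can be computed at a
  positive real \<open>\<epsilon>\<close>.

  For positive \<open>\<epsilon>\<close> every solution \<open>h\<close> is real, since \<open>Im h\<close> is harmonic for the positive weights
  \<open>\<epsilon>\<^sub>i\<^sub>j / |h\<^sub>i - h\<^sub>j|\<^sup>2\<close> and vanishes on \<open>B\<close>. The region \<open>{h. h\<^sub>i \<noteq> h\<^sub>j}\<close> of a solution orients the edges so that
  no interior vertex is a source or a sink; conversely such a region contains exactly one solution, the
  maximiser of \<open>\<Prod> |h\<^sub>i - h\<^sub>j|\<close> with exponents \<open>\<epsilon>\<^sub>i\<^sub>j\<close>. The number of these regions satisfies deletion-contraction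
  and equals \<open>|Q(1)|\<close>, where \<open>Q(k)\<close> counts the extensions of an injective \<open>k\<close>-colouring of \<open>B\<close> to \<open>\<Gamma>\<close>. The
  chromatic polynomial of the augmented graph is \<open>k (k - 1) \<dots> (k - |B| + 1) Q(k)\<close>, with derivative
  \<open>\<plusminus>(|B| - 2)! Q(1)\<close> at \<open>1\<close>.
\<close>

section \<open>Polynomial functions\<close>

text \<open>One exact identity, a / x - a / y = - a (x - y) / (x y), carries much of the analysis.
  It makes the difference of two solutions h and k harmonic, with zero boundary values, for the
  secant weights \<open>\<epsilon> e / edge_prod h k e\<close>. If h and k are near one solution,
  these weights are near its weights, which gives local uniqueness and the contraction behind local
  existence; if h and k are real and lie in one region, they are positive, which gives uniqueness
  per region. A fibre can lose a point in two ways: a weight escapes to infinity, or the limit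
  weights make K singular. Hence properness needs bounds for both c_e and 1 / det K. In the count of
  regions, evaluation at 1 cannot mean one colour, since |B| \<ge> 2 leaves no injective colouring
  of B; Q has to be found as a polynomial. Contraction removes one interior vertex, so (-1)^|V - B|
  Q(1) obeys the recursion with a plus sign, as the regions do. Deletion isolates vertices, and
  contraction creates loops and edges inside B, so the recursion is proved for finite sets of
  possibly degenerate pairs.\<close>

definition polyfun :: "'i set \<Rightarrow> nat \<Rightarrow> (('i \<Rightarrow> complex) \<Rightarrow> complex) \<Rightarrow> bool" where
  "polyfun I d f \<longleftrightarrow> (\<exists>a. \<forall>x. f x = (\<Sum>\<alpha>\<in>I \<rightarrow>\<^sub>E {..d}. a \<alpha> * (\<Prod>i\<in>I. x i ^ \<alpha> i)))"

lemma polyfun_cong: "polyfun I d f \<Longrightarrow> (\<And>x. f x = g x) \<Longrightarrow> polyfun I d g"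
  by (simp add: polyfun_def)

lemma polyfun_add:
  assumes "polyfun I d f" "polyfun I d g"
  shows "polyfun I d (\<lambda>x. f x + g x)"
proof -
  obtain a b where "\<And>x. f x = (\<Sum>\<alpha>\<in>I \<rightarrow>\<^sub>E {..d}. a \<alpha> * (\<Prod>i\<in>I. x i ^ \<alpha> i))"
    "\<And>x. g x = (\<Sum>\<alpha>\<in>I \<rightarrow>\<^sub>E {..d}. b \<alpha> * (\<Prod>i\<in>I. x i ^ \<alpha> i))"
    using assms unfolding polyfun_def by blast
  then show ?thesis unfolding polyfun_def
    by (intro exI[of _ "\<lambda>\<alpha>. a \<alpha> + b \<alpha>"]) (simp add: sum.distrib distrib_right)
qed

lemma polyfun_scale:
  assumes "polyfun I d f"
  shows "polyfun I d (\<lambda>x. c * f x)"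
proof -
  obtain a where "\<And>x. f x = (\<Sum>\<alpha>\<in>I \<rightarrow>\<^sub>E {..d}. a \<alpha> * (\<Prod>i\<in>I. x i ^ \<alpha> i))"
    using assms unfolding polyfun_def by blast
  then show ?thesis unfolding polyfun_def
    by (intro exI[of _ "\<lambda>\<alpha>. c * a \<alpha>"]) (simp add: sum_distrib_left mult.assoc)
qed

lemma polyfun_monomial:
  assumes "finite I" "\<And>i. i \<in> I \<Longrightarrow> \<beta> i \<le> d"
  shows "polyfun I d (\<lambda>x. \<Prod>i\<in>I. x i ^ \<beta> i)"
proof -
  have "(\<Prod>i\<in>I. x i ^ \<beta> i) = (\<Sum>\<alpha>\<in>I \<rightarrow>\<^sub>E {..d}. (if \<alpha> = restrict \<beta> I then 1 else 0) * (\<Prod>i\<in>I. x i ^ \<alpha> i))"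
    for x :: "'a \<Rightarrow> complex"
  proof -
    have "(\<Sum>\<alpha>\<in>I \<rightarrow>\<^sub>E {..d}. (if \<alpha> = restrict \<beta> I then 1 else 0) * (\<Prod>i\<in>I. x i ^ \<alpha> i))
      = (\<Sum>\<alpha>\<in>I \<rightarrow>\<^sub>E {..d}. if \<alpha> = restrict \<beta> I then (\<Prod>i\<in>I. x i ^ \<alpha> i) else 0)"
      by (rule sum.cong) auto
    also have "\<dots> = (\<Prod>i\<in>I. x i ^ restrict \<beta> I i)"
      using assms by (subst sum.delta) (auto simp: finite_PiE)
    finally show ?thesis by simp
  qed
  then show ?thesis unfolding polyfun_def
    by (intro exI[of _ "\<lambda>\<alpha>. if \<alpha> = restrict \<beta> I then 1 else 0"] allI)
qed

lemma polyfun_const: "finite I \<Longrightarrow> polyfun I d (\<lambda>x. c)"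
  using polyfun_scale[OF polyfun_monomial[of I "\<lambda>_. 0" d], of c] by simp

lemma polyfun_sum:
  assumes "finite I" "\<And>k. k \<in> K \<Longrightarrow> polyfun I d (f k)"
  shows "polyfun I d (\<lambda>x. \<Sum>k\<in>K. f k x)"
  using assms(2)
proof (induction K rule: infinite_finite_induct)
  case (insert k K)
  then show ?case by (simp add: polyfun_add)
qed (auto intro: polyfun_const assms(1))

lemma polyfun_mono:
  assumes "polyfun I d f" "d \<le> d'" "finite I"
  shows "polyfun I d' f"
proof -
  obtain a where a: "\<And>x. f x = (\<Sum>\<alpha>\<in>I \<rightarrow>\<^sub>E {..d}. a \<alpha> * (\<Prod>i\<in>I. x i ^ \<alpha> i))"
    using assms unfolding polyfun_def by blast
  have "polyfun I d' (\<lambda>x. \<Sum>\<alpha>\<in>I \<rightarrow>\<^sub>E {..d}. a \<alpha> * (\<Prod>i\<in>I. x i ^ \<alpha> i))"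
    by (intro polyfun_sum polyfun_scale polyfun_monomial assms(3)) (use assms(2) in \<open>force simp: PiE_def Pi_def\<close>)
  then show ?thesis by (rule polyfun_cong) (simp add: a)
qed

lemma polyfun_coord:
  assumes "finite I" "i \<in> I" "1 \<le> d"
  shows "polyfun I d (\<lambda>x. x i)"
proof -
  have "(\<Prod>j\<in>I. x j ^ (if j = i then 1 else 0)) = x i" for x :: "'a \<Rightarrow> complex"
    using assms(1,2) by (subst prod.remove[of _ i]) auto
  then show ?thesis
    using polyfun_monomial[of I "\<lambda>j. if j = i then 1 else 0" d] assms by (auto intro: polyfun_cong)
qed

lemma polyfun_mult:
  assumes "finite I" "polyfun I d f" "polyfun I d' g"
  shows "polyfun I (d + d') (\<lambda>x. f x * g x)"
proof -
  obtain a b where ab: "\<And>x. f x = (\<Sum>\<alpha>\<in>I \<rightarrow>\<^sub>E {..d}. a \<alpha> * (\<Prod>i\<in>I. x i ^ \<alpha> i))"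
    "\<And>x. g x = (\<Sum>\<alpha>\<in>I \<rightarrow>\<^sub>E {..d'}. b \<alpha> * (\<Prod>i\<in>I. x i ^ \<alpha> i))"
    using assms unfolding polyfun_def by blast
  have "polyfun I (d + d') (\<lambda>x. \<Sum>\<alpha>\<in>I \<rightarrow>\<^sub>E {..d}. \<Sum>\<beta>\<in>I \<rightarrow>\<^sub>E {..d'}.
      (a \<alpha> * b \<beta>) * (\<Prod>i\<in>I. x i ^ (\<alpha> i + \<beta> i)))"
    by (intro polyfun_sum polyfun_scale polyfun_monomial assms(1) add_mono) (auto simp: PiE_def Pi_def)
  then show ?thesis
    by (rule polyfun_cong) (simp add: ab sum_product power_add prod.distrib mult_ac)
qed

lemma polyfun_prod:
  assumes "finite I" "finite K" "\<And>k. k \<in> K \<Longrightarrow> polyfun I (d k) (f k)"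
  shows "polyfun I (\<Sum>k\<in>K. d k) (\<lambda>x. \<Prod>k\<in>K. f k x)"
  using assms(2,3)
proof (induction K rule: finite_induct)
  case (insert k K)
  then show ?case by (simp add: polyfun_mult assms(1))
qed (auto intro: polyfun_const assms(1))

lemma polyfun_power:
  assumes "finite I" "polyfun I d f"
  shows "polyfun I (k * d) (\<lambda>x. f x ^ k)"
  using polyfun_prod[OF assms(1), of "{..<k}" "\<lambda>_. d" "\<lambda>_. f"] assms(2) by simp

lemma polyfun_diff:
  assumes "polyfun I d f" "polyfun I d g"
  shows "polyfun I d (\<lambda>x. f x - g x)"
  using polyfun_add[OF assms(1) polyfun_scale[OF assms(2), of "-1"]] by simp

lemma sum_PiE_insert:
  assumes "i \<notin> I"
  shows "(\<Sum>\<alpha>\<in>insert i I \<rightarrow>\<^sub>E S. F \<alpha>) = (\<Sum>k\<in>S. \<Sum>\<alpha>\<in>I \<rightarrow>\<^sub>E S. F (\<alpha>(i := k)))"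
proof -
  have "(\<Sum>\<alpha>\<in>insert i I \<rightarrow>\<^sub>E S. F \<alpha>) = (\<Sum>(k, \<alpha>)\<in>S \<times> (I \<rightarrow>\<^sub>E S). F (\<alpha>(i := k)))"
    unfolding PiE_insert_eq
    by (subst sum.reindex) (use assms inj_combinator in \<open>auto simp: case_prod_unfold\<close>)
  then show ?thesis by (simp add: sum.cartesian_product)
qed

text \<open>Positivity of the point is what later supplies a positive real \<epsilon> off the
  exceptional hypersurface. Induction on the variables: a point where the coefficient of the power
  \<open>?k\<close> of variable \<open>j\<close> is nonzero leaves a nonzero polynomial in that
  variable alone, which has finitely many roots.\<close>

lemma nonzero_polynomial_positive_point:
  assumes "finite I" "\<alpha>0 \<in> I \<rightarrow>\<^sub>E {..d::nat}" "a \<alpha>0 \<noteq> (0::complex)"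
  shows "\<exists>x :: 'i \<Rightarrow> real. (\<forall>i. x i > 0) \<and>
    (\<Sum>\<alpha>\<in>I \<rightarrow>\<^sub>E {..d}. a \<alpha> * (\<Prod>i\<in>I. complex_of_real (x i) ^ \<alpha> i)) \<noteq> 0"
  using assms
proof (induction I arbitrary: a \<alpha>0 rule: finite_induct)
  case empty
  then show ?case by (intro exI[of _ "\<lambda>_. 1"]) auto
next
  case (insert j I)
  let ?k = "\<alpha>0 j" and ?\<alpha> = "restrict \<alpha>0 I"
  have \<alpha>: "?\<alpha> \<in> I \<rightarrow>\<^sub>E {..d}" "?\<alpha>(j := ?k) = \<alpha>0" "?k \<le> d"
    using insert.prems insert.hyps by (auto simp: PiE_def Pi_def extensional_def fun_eq_iff)
  obtain x where x: "\<forall>i. x i > 0"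
    "(\<Sum>\<alpha>\<in>I \<rightarrow>\<^sub>E {..d}. a (\<alpha>(j := ?k)) * (\<Prod>i\<in>I. complex_of_real (x i) ^ \<alpha> i)) \<noteq> 0"
    using insert.IH[of ?\<alpha> "\<lambda>\<alpha>. a (\<alpha>(j := ?k))", OF \<alpha>(1)] insert.prems(2) unfolding \<alpha>(2) by blast
  define c where "c k = (\<Sum>\<alpha>\<in>I \<rightarrow>\<^sub>E {..d}. a (\<alpha>(j := k)) * (\<Prod>i\<in>I. complex_of_real (x i) ^ \<alpha> i))" for k
  define p where "p = (\<Sum>k\<le>d. monom (c k) k)"
  have "coeff p ?k \<noteq> 0" using x(2) \<alpha>(3) by (simp add: p_def coeff_sum c_def)
  then have "finite {z. poly p z = 0}" by (intro poly_roots_finite) auto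
  moreover have "infinite (complex_of_real ` {0<..})"
    by (subst finite_image_iff) (auto intro!: inj_onI infinite_Ioi)
  ultimately obtain t where t: "t > 0" "poly p (complex_of_real t) \<noteq> 0"
    by (metis (mono_tags, lifting) finite_subset greaterThan_iff image_subset_iff mem_Collect_eq subsetI)
  have "(\<Sum>\<alpha>\<in>insert j I \<rightarrow>\<^sub>E {..d}. a \<alpha> * (\<Prod>i\<in>insert j I. complex_of_real ((x(j := t)) i) ^ \<alpha> i))
    = (\<Sum>k\<le>d. \<Sum>\<alpha>\<in>I \<rightarrow>\<^sub>E {..d}. a (\<alpha>(j := k)) *
        (\<Prod>i\<in>insert j I. complex_of_real ((x(j := t)) i) ^ (\<alpha>(j := k)) i))"
    by (rule sum_PiE_insert) (rule insert.hyps)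
  also have "\<dots> = (\<Sum>k\<le>d. c k * complex_of_real t ^ k)"
  proof (rule sum.cong[OF refl])
    fix k
    have "(\<Prod>i\<in>insert j I. complex_of_real ((x(j := t)) i) ^ (\<alpha>(j := k)) i)
       = complex_of_real t ^ k * (\<Prod>i\<in>I. complex_of_real (x i) ^ \<alpha> i)" for \<alpha>
    proof -
      have "(\<Prod>i\<in>I. complex_of_real ((x(j := t)) i) ^ (\<alpha>(j := k)) i) = (\<Prod>i\<in>I. complex_of_real (x i) ^ \<alpha> i)"
        using insert.hyps by (intro prod.cong) auto
      then show ?thesis using insert.hyps by simp
    qed
    then show "(\<Sum>\<alpha>\<in>I \<rightarrow>\<^sub>E {..d}. a (\<alpha>(j := k)) *
        (\<Prod>i\<in>insert j I. complex_of_real ((x(j := t)) i) ^ (\<alpha>(j := k)) i)) = c k * complex_of_real t ^ k"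
      by (simp add: c_def sum_distrib_left mult_ac)
  qed
  also have "\<dots> = poly p (complex_of_real t)" by (simp add: p_def poly_sum poly_monom)
  finally show ?case using t x(1) by (intro exI[of _ "x(j := t)"]) auto
qed

lemma polyfun_nonzero_positive_point:
  assumes "finite I" "polyfun I d f" "f x0 \<noteq> 0"
  shows "\<exists>x :: 'i \<Rightarrow> real. (\<forall>i. x i > 0) \<and> f (\<lambda>i. complex_of_real (x i)) \<noteq> 0"
proof -
  obtain a where a: "\<And>x. f x = (\<Sum>\<alpha>\<in>I \<rightarrow>\<^sub>E {..d}. a \<alpha> * (\<Prod>i\<in>I. x i ^ \<alpha> i))"
    using assms unfolding polyfun_def by blast
  obtain \<alpha>0 where "\<alpha>0 \<in> I \<rightarrow>\<^sub>E {..d}" "a \<alpha>0 \<noteq> 0"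
    using assms(3) unfolding a by (metis (no_types, lifting) mult_zero_left sum.neutral)
  then show ?thesis using nonzero_polynomial_positive_point[OF assms(1), of \<alpha>0 d a] a by auto
qed

text \<open>Restriction to a complex line reduces several variables to a polynomial with finitely
  many roots. It yields \<open>polyfun_mult_nonzero\<close> and, in \<open>card_Sol_generic\<close>,
  a connected set of good parameters.\<close>

lemma polyfun_line:
  assumes "polyfun I d f"
  shows "\<exists>p. \<forall>s. poly p s = f (\<lambda>i. x i + s * y i)"
proof -
  obtain a where a: "\<And>x. f x = (\<Sum>\<alpha>\<in>I \<rightarrow>\<^sub>E {..d}. a \<alpha> * (\<Prod>i\<in>I. x i ^ \<alpha> i))"
    using assms unfolding polyfun_def by blast
  show ?thesis
    by (rule exI[of _ "\<Sum>\<alpha>\<in>I \<rightarrow>\<^sub>E {..d}. Polynomial.smult (a \<alpha>) (\<Prod>i\<in>I. [:x i, y i:] ^ \<alpha> i)"])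
      (simp add: a poly_sum poly_prod)
qed

text \<open>On the line through x and y neither restriction is the zero polynomial, because one is
  nonzero at the parameter 0 and the other at 1, and univariate polynomials have no zero
  divisors.\<close>

lemma polyfun_mult_nonzero:
  assumes "polyfun I d f" "polyfun I d' g" "f x \<noteq> 0" "g y \<noteq> 0"
  shows "\<exists>z. f z * g z \<noteq> 0"
proof -
  obtain p q where p: "\<And>s. poly p s = f (\<lambda>i. x i + s * (y i - x i))"
    and q: "\<And>s. poly q s = g (\<lambda>i. x i + s * (y i - x i))"
    using polyfun_line[OF assms(1), of x "\<lambda>i. y i - x i"]
      polyfun_line[OF assms(2), of x "\<lambda>i. y i - x i"] by metis
  have "poly p 0 \<noteq> 0" "poly q 1 \<noteq> 0" using assms by (auto simp: p q)
  then have "p * q \<noteq> 0" by (metis mult_eq_0_iff poly_0)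
  then obtain s where "poly (p * q) s \<noteq> 0" using poly_all_0_iff_0 by blast
  then show ?thesis by (auto simp: p q)
qed

lemma polyfun_prod_nonzero:
  assumes "finite I" "finite K" "\<And>k. k \<in> K \<Longrightarrow> \<exists>d. polyfun I d (f k)" "\<And>k. k \<in> K \<Longrightarrow> \<exists>x. f k x \<noteq> 0"
  shows "\<exists>d x. polyfun I d (\<lambda>x. \<Prod>k\<in>K. f k x) \<and> (\<Prod>k\<in>K. f k x) \<noteq> 0"
  using assms(2-)
proof (induction K rule: finite_induct)
  case empty
  then show ?case using polyfun_const[OF assms(1)] by auto
next
  case (insert k K)
  obtain d x where 1: "polyfun I d (\<lambda>x. \<Prod>k\<in>K. f k x)" "(\<Prod>k\<in>K. f k x) \<noteq> 0"
    using insert.IH insert.prems by (metis (no_types, lifting) insertI2)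
  obtain d' y where 2: "polyfun I d' (f k)" "f k y \<noteq> 0" using insert.prems by blast
  obtain z where z: "f k z * (\<Prod>k\<in>K. f k z) \<noteq> 0"
    using polyfun_mult_nonzero[where f = "f k" and g = "\<lambda>x. \<Prod>k\<in>K. f k x" and x = y and y = x, OF 2(1) 1(1) 2(2) 1(2)]
    by (elim exE)
  have "polyfun I (d' + d) (\<lambda>x. \<Prod>k\<in>insert k K. f k x)"
    using polyfun_mult[OF assms(1) 2(1) 1(1)] insert.hyps by simp
  moreover have "(\<Prod>k\<in>insert k K. f k z) \<noteq> 0"
    using z insert.hyps by (simp only: prod.insert not_False_eq_True)
  ultimately show ?case by blast
qed

lemma polyfun_tendsto:
  assumes "polyfun I d f" "\<And>i. i \<in> I \<Longrightarrow> ((\<lambda>n. x n i) \<longlongrightarrow> y i) F"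
  shows "((\<lambda>n. f (x n)) \<longlongrightarrow> f y) F"
proof -
  obtain a where a: "f = (\<lambda>x. \<Sum>\<alpha>\<in>I \<rightarrow>\<^sub>E {..d}. a \<alpha> * (\<Prod>i\<in>I. x i ^ \<alpha> i))"
    using assms(1) unfolding polyfun_def by blast
  show ?thesis unfolding a by (intro tendsto_intros assms(2))
qed

text \<open>Connects polynomial functions with the exponent vectors on which
  \<open>algebraic_subset\<close> is based.\<close>

lemma polyfun_mpoly:
  assumes "finite I" "polyfun I d f"
  shows "\<exists>p. mpoly_vars p \<subseteq> I \<and> (\<forall>x. mpoly_eval p x = f x)"
proof -
  obtain a where a: "\<And>x. f x = (\<Sum>\<alpha>\<in>I \<rightarrow>\<^sub>E {..d}. a \<alpha> * (\<Prod>i\<in>I. x i ^ \<alpha> i))"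
    using assms unfolding polyfun_def by blast
  let ?A = "I \<rightarrow>\<^sub>E {..d}"
  have finA: "finite ?A" using assms(1) by (simp add: finite_PiE)
  define M where "M \<alpha> = Abs_poly_mapping (\<lambda>i. if i \<in> I then \<alpha> i else 0 :: nat)" for \<alpha> :: "'a \<Rightarrow> nat"
  have lM: "Poly_Mapping.lookup (M \<alpha>) i = (if i \<in> I then \<alpha> i else 0)" for \<alpha> i
    unfolding M_def using assms(1) by (subst Abs_poly_mapping_inverse) auto
  have kM: "Poly_Mapping.keys (M \<alpha>) = {i\<in>I. \<alpha> i \<noteq> 0}" for \<alpha>
    by (auto simp: in_keys_iff lM split: if_splits)
  have inj: "inj_on M ?A"
  proof (rule inj_onI)
    fix \<alpha> \<beta> assume *: "\<alpha> \<in> ?A" "\<beta> \<in> ?A" "M \<alpha> = M \<beta>"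
    have "\<alpha> i = \<beta> i" if "i \<in> I" for i using lM[of \<alpha> i] lM[of \<beta> i] *(3) that by simp
    then show "\<alpha> = \<beta>" using * by (intro PiE_ext) auto
  qed
  define c where "c m = (if m \<in> M ` ?A then a (inv_into ?A M m) else 0)" for m
  define p where "p = Abs_poly_mapping c"
  have lp: "Poly_Mapping.lookup p = c"
    unfolding p_def using finite_imageI[OF finA, of M]
    by (subst Abs_poly_mapping_inverse) (auto simp: c_def intro: finite_subset[of _ "M ` ?A"])
  have kp: "Poly_Mapping.keys p \<subseteq> M ` ?A" by (auto simp: in_keys_iff lp c_def split: if_splits)
  have "mpoly_eval p x = f x" for x
  proof -
    have "mpoly_eval p x = (\<Sum>m\<in>M ` ?A. c m * (\<Prod>i\<in>Poly_Mapping.keys m. x i ^ Poly_Mapping.lookup m i))"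
      unfolding mpoly_eval_def lp
      by (rule sum.mono_neutral_left[OF finite_imageI[OF finA] kp]) (auto simp: in_keys_iff lp)
    also have "\<dots> = (\<Sum>\<alpha>\<in>?A. a \<alpha> * (\<Prod>i\<in>I. x i ^ \<alpha> i))"
      using inj
    proof (subst sum.reindex, simp, intro sum.cong refl)
      fix \<alpha> assume \<alpha>: "\<alpha> \<in> ?A"
      have "(\<Prod>i\<in>Poly_Mapping.keys (M \<alpha>). x i ^ Poly_Mapping.lookup (M \<alpha>) i) = (\<Prod>i\<in>I. x i ^ \<alpha> i)"
        unfolding kM lM using assms(1) by (intro prod.mono_neutral_cong_left) auto
      moreover have "c (M \<alpha>) = a \<alpha>" using \<alpha> inj by (simp add: c_def)
      ultimately show "((\<lambda>m. c m * (\<Prod>i\<in>Poly_Mapping.keys m. x i ^ Poly_Mapping.lookup m i)) \<circ> M) \<alpha>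
        = a \<alpha> * (\<Prod>i\<in>I. x i ^ \<alpha> i)" by simp
    qed
    finally show ?thesis by (simp add: a)
  qed
  moreover have "mpoly_vars p \<subseteq> I" using kp by (auto simp: mpoly_vars_def kM)
  ultimately show ?thesis by blast
qed

lemma polyfun_cong_on:
  assumes "polyfun I d f" "\<And>i. i \<in> I \<Longrightarrow> x i = y i"
  shows "f x = f y"
proof -
  obtain a where a: "\<And>x. f x = (\<Sum>\<alpha>\<in>I \<rightarrow>\<^sub>E {..d}. a \<alpha> * (\<Prod>i\<in>I. x i ^ \<alpha> i))"
    using assms unfolding polyfun_def by blast
  show ?thesis unfolding a using assms(2) by simp
qed

lemma holds_genericallyI:
  assumes "finite I" "polyfun I d f" "f x0 \<noteq> 0" "\<And>x. x \<in> I \<rightarrow>\<^sub>E UNIV \<Longrightarrow> f x \<noteq> 0 \<Longrightarrow> Q x"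
  shows "holds_generically I Q"
proof -
  obtain p where p: "mpoly_vars p \<subseteq> I" "\<And>x. mpoly_eval p x = f x"
    using polyfun_mpoly[OF assms(1,2)] by blast
  let ?Z = "{x \<in> I \<rightarrow>\<^sub>E UNIV. f x = 0}"
  have "algebraic_subset I ?Z" unfolding algebraic_subset_def
    by (rule exI[of _ "{p}"]) (use p in auto)
  \<comment> \<open>The point \<open>x0\<close> may have arbitrary values outside \<open>I\<close>;
    restricting it gives a member of the affine space with the same value of
    \<open>f\<close>.\<close>
  moreover have "restrict x0 I \<in> (I \<rightarrow>\<^sub>E UNIV) - ?Z"
    using assms(3) polyfun_cong_on[OF assms(2), of "restrict x0 I" x0] by auto
  then have "?Z \<subset> I \<rightarrow>\<^sub>E UNIV" by blast
  ultimately show ?thesis unfolding holds_generically_def using assms(4) by blast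
qed

section \<open>Algebraic dependence and bounds for algebraic functions\<close>

lemma homogeneous_system:
  fixes A :: "'j \<Rightarrow> 'i \<Rightarrow> 'a :: field"
  assumes "finite J" "finite I" "card J < card I"
  shows "\<exists>x. (\<exists>i\<in>I. x i \<noteq> 0) \<and> (\<forall>j\<in>J. (\<Sum>i\<in>I. A j i * x i) = 0)"
  using assms
proof (induction J arbitrary: I A rule: finite_induct)
  case empty
  then have "I \<noteq> {}" by auto
  then show ?case by (intro exI[of _ "\<lambda>_. 1"]) auto
next
  case (insert j J)
  show ?case
  proof (cases "\<forall>i\<in>I. A j i = 0")
    case True
    obtain x where "\<exists>i\<in>I. x i \<noteq> 0" "\<forall>j\<in>J. (\<Sum>i\<in>I. A j i * x i) = 0"
      using insert.IH[of I A] insert.prems insert.hyps by auto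
    then show ?thesis using True by (intro exI[of _ x]) auto
  next
    case False
    then obtain k where k: "k \<in> I" "A j k \<noteq> 0" by blast
    let ?I = "I - {k}"
    have "card J < card ?I" using insert.prems insert.hyps k by simp
    then obtain x where x: "\<exists>i\<in>?I. x i \<noteq> 0"
      "\<forall>l\<in>J. (\<Sum>i\<in>?I. (A l i - A l k * A j i / A j k) * x i) = 0"
      using insert.IH[of ?I "\<lambda>l i. A l i - A l k * A j i / A j k"] insert.prems by auto
    \<comment> \<open>The value at \<open>k\<close> is chosen to satisfy equation \<open>j\<close>;
      the modified coefficients of the smaller system account for its effect on the other
      equations.\<close>
    define y where "y = x(k := - (\<Sum>i\<in>?I. A j i * x i) / A j k)"
    have y: "(\<Sum>i\<in>I. A l i * y i) = A l k * y k + (\<Sum>i\<in>?I. A l i * x i)" for l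
      using insert.prems(1) k(1) by (subst sum.remove[of _ k]) (auto simp: y_def)
    have "(\<Sum>i\<in>I. A l i * y i) = 0" if "l \<in> insert j J" for l
    proof (cases "l = j")
      case True
      then show ?thesis using k by (simp add: y) (simp add: y_def)
    next
      case False
      then have "(\<Sum>i\<in>?I. (A l i - A l k * A j i / A j k) * x i) = 0" using x(2) that by auto
      moreover have "(\<Sum>i\<in>?I. (A l i - A l k * A j i / A j k) * x i)
          = (\<Sum>i\<in>?I. A l i * x i) - A l k / A j k * (\<Sum>i\<in>?I. A j i * x i)"
        by (simp add: sum_distrib_left sum_subtractf[symmetric] algebra_simps)
      ultimately have "(\<Sum>i\<in>?I. A l i * x i) - A l k / A j k * (\<Sum>i\<in>?I. A j i * x i) = 0" by simp
      then show ?thesis by (simp add: y) (simp add: y_def)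
    qed
    moreover have "\<exists>i\<in>I. y i \<noteq> 0" using x(1) by (auto simp: y_def)
    ultimately show ?thesis by blast
  qed
qed

text \<open>Where |g| \<ge> 1, dividing the equation by \<open>g ^ (D - 1)\<close> bounds |a D| |g|
  by the sum of the absolute lower coefficients. That sum stays bounded, and \<open>a D\<close>
  stays away from 0.\<close>

lemma Bseq_root:
  fixes a :: "nat \<Rightarrow> nat \<Rightarrow> complex"
  assumes conv: "\<And>b. b \<le> D \<Longrightarrow> convergent (a b)" and L: "a D \<longlonglongrightarrow> L" "L \<noteq> 0"
    and root: "\<And>n. (\<Sum>b\<le>D. a b n * g n ^ b) = 0"
  shows "Bseq g"
proof -
  define C where "C n = (\<Sum>b<D. norm (a b n))" for n
  have bound: "norm (a D n) * norm (g n) \<le> C n" if g1: "norm (g n) \<ge> 1" and aD: "a D n \<noteq> 0" for n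
  proof (cases D)
    \<comment> \<open>A relation that does not involve \<open>g\<close> reads
      \<open>a 0 n = 0\<close>, contrary to \<open>aD\<close>.\<close>
    case 0
    then show ?thesis using root[of n] aD by simp
  next
    case (Suc D')
    have "norm (a D n) * norm (g n) * norm (g n) ^ D' = norm (a D n * g n ^ D)"
      by (simp add: Suc norm_mult norm_power)
    also have "a D n * g n ^ D = - (\<Sum>b<D. a b n * g n ^ b)"
      using root[of n] by (simp add: lessThan_Suc_atMost[symmetric] add_eq_0_iff)
    also have "norm \<dots> \<le> (\<Sum>b<D. norm (a b n) * norm (g n) ^ b)"
      by (simp add: sum_norm_le norm_mult norm_power)
    also have "\<dots> \<le> (\<Sum>b<D. norm (a b n) * norm (g n) ^ D')"
      by (intro sum_mono mult_left_mono power_increasing g1) (auto simp: Suc)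
    also have "\<dots> = C n * norm (g n) ^ D'" by (simp add: C_def sum_distrib_right)
    finally show ?thesis
      by (rule mult_right_le_imp_le) (use g1 in \<open>intro zero_less_power; linarith\<close>)
  qed
  have "convergent (\<lambda>n. C n)" unfolding C_def
    by (intro convergent_sum convergent_norm conv) auto
  then obtain K where K: "\<And>n. norm (C n) \<le> K"
    using convergent_imp_Bseq Bseq_def by metis
  have K': "C n \<le> K" for n using K[of n] by simp
  have K0: "K \<ge> 0" using K[of 0] norm_ge_zero order_trans by blast
  have "(\<lambda>n. norm (a D n)) \<longlonglongrightarrow> norm L" using L(1) by (rule tendsto_norm)
  then have "eventually (\<lambda>n. norm L / 2 < norm (a D n)) sequentially"
    by (rule order_tendstoD) (use L(2) in simp)
  then have "eventually (\<lambda>n. norm (g n) \<le> 1 + 2 * K / norm L) sequentially"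
  proof eventually_elim
    case (elim n)
    show ?case
    proof (cases "norm (g n) \<ge> 1")
      case True
      have "a D n \<noteq> 0" using elim L(2) by auto
      then have "norm (a D n) * norm (g n) \<le> K" using bound[OF True] K' order_trans by blast
      moreover have "norm L / 2 * norm (g n) \<le> norm (a D n) * norm (g n)"
        using elim by (intro mult_right_mono) auto
      ultimately have "norm L / 2 * norm (g n) \<le> K" by linarith
      then have "norm (g n) \<le> 2 * K / norm L" using L(2) by (simp add: field_simps)
      then show ?thesis by linarith
    next
      case False
      moreover have "2 * K / norm L \<ge> 0" using K0 by simp
      ultimately show ?thesis by linarith
    qed
  qed
  then show ?thesis by (rule BfunI)
qed

text \<open>
  The functions \<open>P i / \<Delta>\<close> and \<open>G / \<Delta>\<close> are algebraically dependent, as there are more monomials of box degree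
  \<open>k\<close> in them than monomials in the variables. Take for \<open>f\<close> the leading coefficient of such a relation
  with respect to \<open>G / \<Delta>\<close>.
\<close>

lemma generic_bound:
  assumes I: "finite I" and P: "\<And>i. i \<in> I \<Longrightarrow> polyfun I m (P i)"
    and G: "polyfun I m G" and \<Delta>: "polyfun I m \<Delta>"
  shows "\<exists>d f x0. polyfun I d f \<and> f x0 \<noteq> 0 \<and> (\<forall>X y. (\<forall>n. \<Delta> (X n) \<noteq> 0) \<longrightarrow>
    (\<forall>i\<in>I. (\<lambda>n. P i (X n) / \<Delta> (X n)) \<longlonglongrightarrow> y i) \<longrightarrow> f y \<noteq> 0 \<longrightarrow> Bseq (\<lambda>n. G (X n) / \<Delta> (X n)))"
proof -
  \<comment> \<open>Write n for |I|. There are (k + 1)^(n + 1) products with exponents up to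
    \<open>k\<close>, and their total degree is at most \<open>N\<close>. Clearing denominators by
    \<Delta>^N leaves at most (N m + 1)^n monomials, because the degree in \<open>polyfun\<close>
    bounds each exponent separately. As N m + 1 \<le> ((n + 1) m + 1) k, this is at most k^n times
    ((n + 1) m + 1)^n, and the last factor is what \<open>k\<close> is set to.\<close>
  define k where "k = ((card I + 1) * m + 1) ^ card I"
  define N where "N = (card I + 1) * k"
  define T where "T = (I \<rightarrow>\<^sub>E {..k}) \<times> {..k}"
  have finA: "finite (I \<rightarrow>\<^sub>E {..d})" for d :: nat using I by (simp add: finite_PiE)
  have finT: "finite T" by (simp add: T_def finA)
  have cJ: "card (I \<rightarrow>\<^sub>E {..N * m}) < card T"
  proof -
    have "card (I \<rightarrow>\<^sub>E {..N * m}) = (N * m + 1) ^ card I" using I by (simp add: card_funcsetE)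
    also have "\<dots> \<le> (((card I + 1) * m + 1) * k) ^ card I"
      by (rule power_mono) (auto simp: N_def k_def algebra_simps)
    also have "\<dots> = k * k ^ card I" by (simp only: power_mult_distrib k_def)
    also have "\<dots> < (k + 1) * (k + 1) ^ card I"
      by (rule mult_less_le_imp_less) (auto simp: power_mono k_def)
    also have "\<dots> = card T" using I by (simp add: T_def card_funcsetE card_cartesian_product)
    finally show ?thesis .
  qed
  \<comment> \<open>Where \<Delta> is nonzero, \<open>H t\<close> is \<Delta>^N times the product of
    powers of P i / \<Delta> and G / \<Delta> with exponents \<open>t\<close>. Filling up with
    powers of \<Delta> gives every \<open>H t\<close> degree N in P, G and \<Delta>, hence box
    degree N m.\<close>
  define H where "H t x = (\<Prod>i\<in>I. P i x ^ fst t i) * G x ^ snd t *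
      \<Delta> x ^ (N - (\<Sum>i\<in>I. fst t i) - snd t)" for t :: "('a \<Rightarrow> nat) \<times> nat" and x
  have deg: "(\<Sum>i\<in>I. fst t i) + snd t \<le> N" if "t \<in> T" for t
  proof -
    have "(\<Sum>i\<in>I. fst t i) \<le> (\<Sum>i\<in>I. k)"
      using that by (intro sum_mono) (auto simp: T_def PiE_def Pi_def)
    then show ?thesis using that by (auto simp: N_def T_def)
  qed
  have "polyfun I (N * m) (H t)" if t: "t \<in> T" for t
  proof -
    have "polyfun I ((\<Sum>i\<in>I. fst t i * m) + snd t * m + (N - (\<Sum>i\<in>I. fst t i) - snd t) * m) (H t)"
      unfolding H_def by (intro polyfun_mult polyfun_prod polyfun_power P G \<Delta> I)
    moreover have "(\<Sum>i\<in>I. fst t i * m) + snd t * m + (N - (\<Sum>i\<in>I. fst t i) - snd t) * m = N * m"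
      using deg[OF t] by (simp add: sum_distrib_right[symmetric] add_mult_distrib[symmetric])
    ultimately show ?thesis by simp
  qed
  then have "\<forall>t\<in>T. \<exists>a. \<forall>x. H t x = (\<Sum>\<alpha>\<in>I \<rightarrow>\<^sub>E {..N * m}. a \<alpha> * (\<Prod>i\<in>I. x i ^ \<alpha> i))"
    unfolding polyfun_def by blast
  from bchoice[OF this] obtain a where "\<forall>t\<in>T. \<forall>x.
      H t x = (\<Sum>\<alpha>\<in>I \<rightarrow>\<^sub>E {..N * m}. a t \<alpha> * (\<Prod>i\<in>I. x i ^ \<alpha> i))" ..
  then have a: "H t x = (\<Sum>\<alpha>\<in>I \<rightarrow>\<^sub>E {..N * m}. a t \<alpha> * (\<Prod>i\<in>I. x i ^ \<alpha> i))" if "t \<in> T" for t x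
    using that by blast
  obtain q where q: "\<exists>t\<in>T. q t \<noteq> 0" "\<forall>\<alpha>\<in>I \<rightarrow>\<^sub>E {..N * m}. (\<Sum>t\<in>T. a t \<alpha> * q t) = 0"
    using homogeneous_system[OF finA finT cJ, of "\<lambda>\<alpha> t. a t \<alpha>"] by auto
  have zero: "(\<Sum>t\<in>T. q t * H t x) = 0" for x
  proof -
    have "(\<Sum>t\<in>T. q t * H t x) = (\<Sum>t\<in>T. \<Sum>\<alpha>\<in>I \<rightarrow>\<^sub>E {..N * m}. (a t \<alpha> * q t) * (\<Prod>i\<in>I. x i ^ \<alpha> i))"
    proof (rule sum.cong[OF refl])
      fix t assume "t \<in> T"
      then show "q t * H t x = (\<Sum>\<alpha>\<in>I \<rightarrow>\<^sub>E {..N * m}. (a t \<alpha> * q t) * (\<Prod>i\<in>I. x i ^ \<alpha> i))"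
        unfolding a[OF \<open>t \<in> T\<close>] sum_distrib_left by (intro sum.cong refl) (simp only: mult_ac)
    qed
    also have "\<dots> = (\<Sum>\<alpha>\<in>I \<rightarrow>\<^sub>E {..N * m}. (\<Sum>t\<in>T. a t \<alpha> * q t) * (\<Prod>i\<in>I. x i ^ \<alpha> i))"
      by (subst sum.swap) (simp add: sum_distrib_right)
    also have "\<dots> = 0" using q(2) by simp
    finally show ?thesis .
  qed
  define c where "c b y = (\<Sum>\<alpha>\<in>I \<rightarrow>\<^sub>E {..k}. q (\<alpha>, b) * (\<Prod>i\<in>I. y i ^ \<alpha> i))" for b y
  have c: "polyfun I k (c b)" for b
    unfolding c_def polyfun_def by (intro exI[of _ "\<lambda>\<alpha>. q (\<alpha>, b)"]) simp
  have rel: "(\<Sum>b\<le>k. c b (\<lambda>i. P i x / \<Delta> x) * (G x / \<Delta> x) ^ b) = 0" if nz: "\<Delta> x \<noteq> 0" for x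
  proof -
    have H: "H t x = \<Delta> x ^ N * ((\<Prod>i\<in>I. (P i x / \<Delta> x) ^ fst t i) * (G x / \<Delta> x) ^ snd t)" if "t \<in> T" for t
    proof -
      have "\<Delta> x ^ (N - (\<Sum>i\<in>I. fst t i) - snd t) * \<Delta> x ^ (\<Sum>i\<in>I. fst t i) * \<Delta> x ^ snd t = \<Delta> x ^ N"
        using deg[OF that] by (simp add: power_add[symmetric])
      then have "H t x * (\<Delta> x ^ (\<Sum>i\<in>I. fst t i) * \<Delta> x ^ snd t) =
          (\<Prod>i\<in>I. P i x ^ fst t i) * G x ^ snd t * \<Delta> x ^ N"
        by (simp add: H_def mult_ac)
      then have "H t x = (\<Prod>i\<in>I. P i x ^ fst t i) * G x ^ snd t * \<Delta> x ^ N /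
          (\<Delta> x ^ (\<Sum>i\<in>I. fst t i) * \<Delta> x ^ snd t)"
        using nz by (simp add: nonzero_eq_divide_eq)
      moreover have "(\<Prod>i\<in>I. (P i x / \<Delta> x) ^ fst t i) = (\<Prod>i\<in>I. P i x ^ fst t i) / \<Delta> x ^ (\<Sum>i\<in>I. fst t i)"
        by (simp only: power_divide prod_dividef power_sum)
      moreover have "a * g * d / (p * s) = d * (a / p * (g / s))" for a g d p s :: complex by simp
      ultimately show ?thesis by (simp only: power_divide)
    qed
    have "0 = (\<Sum>t\<in>T. q t * (\<Delta> x ^ N * ((\<Prod>i\<in>I. (P i x / \<Delta> x) ^ fst t i) * (G x / \<Delta> x) ^ snd t)))"
      unfolding zero[of x, symmetric] by (rule sum.cong) (simp_all only: H)
    also have "\<dots> = \<Delta> x ^ N * (\<Sum>t\<in>T. q t * ((\<Prod>i\<in>I. (P i x / \<Delta> x) ^ fst t i) * (G x / \<Delta> x) ^ snd t))"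
      by (simp add: sum_distrib_left mult_ac)
    also have "(\<Sum>t\<in>T. q t * ((\<Prod>i\<in>I. (P i x / \<Delta> x) ^ fst t i) * (G x / \<Delta> x) ^ snd t))
       = (\<Sum>\<alpha>\<in>I \<rightarrow>\<^sub>E {..k}. \<Sum>b\<le>k. q (\<alpha>, b) * ((\<Prod>i\<in>I. (P i x / \<Delta> x) ^ \<alpha> i) * (G x / \<Delta> x) ^ b))"
      unfolding T_def by (subst sum.cartesian_product) (simp add: case_prod_unfold)
    also have "\<dots> = (\<Sum>b\<le>k. c b (\<lambda>i. P i x / \<Delta> x) * (G x / \<Delta> x) ^ b)"
      by (subst sum.swap) (simp add: c_def sum_distrib_left mult_ac)
    finally show ?thesis using nz by auto
  qed
  \<comment> \<open>The exponents of G / \<Delta> that really occur. If only 0 occurs, the relation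
    forces \<open>c D y = 0\<close> in the limit, and the claim is vacuous.\<close>
  define S where "S = {b. b \<le> k \<and> (\<exists>\<alpha>\<in>I \<rightarrow>\<^sub>E {..k}. q (\<alpha>, b) \<noteq> 0)}"
  have S: "finite S" "S \<noteq> {}" using q(1) by (auto simp: S_def T_def)
  define D where "D = Max S"
  have D: "D \<in> S" "\<And>b. b \<in> S \<Longrightarrow> b \<le> D" using S by (auto simp: D_def)
  then obtain \<alpha>0 where "\<alpha>0 \<in> I \<rightarrow>\<^sub>E {..k}" "q (\<alpha>0, D) \<noteq> 0" by (auto simp: S_def)
  then obtain x0 where x0: "c D x0 \<noteq> 0"
    using nonzero_polynomial_positive_point[OF I, of \<alpha>0 k "\<lambda>\<alpha>. q (\<alpha>, D)"] by (auto simp: c_def)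
  have above: "c b y = 0" if "b \<le> k" "\<not> b \<le> D" for b y
  proof -
    have "\<forall>\<alpha>\<in>I \<rightarrow>\<^sub>E {..k}. q (\<alpha>, b) = 0" using that D(2)[of b] by (auto simp: S_def)
    then show ?thesis by (simp add: c_def)
  qed
  have "Bseq (\<lambda>n. G (X n) / \<Delta> (X n))"
    if X: "\<And>n. \<Delta> (X n) \<noteq> 0" "\<And>i. i \<in> I \<Longrightarrow> (\<lambda>n. P i (X n) / \<Delta> (X n)) \<longlonglongrightarrow> y i" "c D y \<noteq> 0" for X y
  proof (rule Bseq_root)
    have lim: "(\<lambda>n. c b (\<lambda>i. P i (X n) / \<Delta> (X n))) \<longlonglongrightarrow> c b y" for b
      by (rule polyfun_tendsto[OF c]) (rule X(2))
    show "convergent (\<lambda>n. c b (\<lambda>i. P i (X n) / \<Delta> (X n)))" for b using lim convergentI by blast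
    show "(\<lambda>n. c D (\<lambda>i. P i (X n) / \<Delta> (X n))) \<longlonglongrightarrow> c D y" by (rule lim)
    show "c D y \<noteq> 0" by (rule X(3))
    show "(\<Sum>b\<le>D. c b (\<lambda>i. P i (X n) / \<Delta> (X n)) * (G (X n) / \<Delta> (X n)) ^ b) = 0" for n
      unfolding rel[OF X(1)[of n], symmetric]
      by (rule sum.mono_neutral_left) (use D(1) in \<open>auto simp: S_def above\<close>)
  qed
  then show ?thesis using c[of D] x0 by blast
qed

section \<open>Determinants, subsequences and fixed points\<close>

lemma polyfun_det:
  fixes A :: "('i \<Rightarrow> complex) \<Rightarrow> complex mat"
  assumes I: "finite I" and A: "\<And>x. A x \<in> carrier_mat n n"
    and pA: "\<And>i j. i < n \<Longrightarrow> j < n \<Longrightarrow> polyfun I m (\<lambda>x. A x $$ (i, j))"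
  shows "polyfun I (n * m) (\<lambda>x. det (A x))"
proof -
  have "polyfun I (n * m) (\<lambda>x. \<Sum>p\<in>{p. p permutes {0..<n}}. signof p * (\<Prod>i = 0..<n. A x $$ (i, p i)))"
  proof (intro polyfun_sum I polyfun_scale)
    fix p assume "p \<in> {p. p permutes {0..<n}}"
    then have "p i < n" if "i < n" for i using that permutes_in_image[of p "{0..<n}" i] by auto
    then have "polyfun I (\<Sum>i = 0..<n. m) (\<lambda>x. \<Prod>i = 0..<n. A x $$ (i, p i))"
      by (intro polyfun_prod I pA) auto
    then show "polyfun I (n * m) (\<lambda>x. \<Prod>i = 0..<n. A x $$ (i, p i))" by simp
  qed
  then show ?thesis by (rule polyfun_cong) (use A in \<open>simp add: det_def'[OF A]\<close>)
qed

text \<open>Cramer's rule for a matrix indexed by a set: the inverse has the entries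
  \<open>adj i j / \<Delta>\<close> with one common denominator. The last clause supplies a kernel
  vector where \<Delta> vanishes, so that \<Delta> \<noteq> 0 can later be derived from a maximum
  principle.\<close>

lemma polyfun_adjugate:
  fixes A :: "('i \<Rightarrow> complex) \<Rightarrow> 'v \<Rightarrow> 'v \<Rightarrow> complex"
  assumes I: "finite I" and S: "finite S"
    and pA: "\<And>i j. i \<in> S \<Longrightarrow> j \<in> S \<Longrightarrow> polyfun I m (\<lambda>x. A x i j)"
  shows "\<exists>d \<Delta> adj. polyfun I d \<Delta> \<and> (\<forall>i\<in>S. \<forall>j\<in>S. polyfun I d (adj i j)) \<and>
    (\<forall>x. \<forall>i\<in>S. \<forall>k\<in>S. (\<Sum>j\<in>S. A x i j * adj j k x) = (if i = k then \<Delta> x else 0) \<and>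
        (\<Sum>j\<in>S. adj i j x * A x j k) = (if i = k then \<Delta> x else 0)) \<and>
    (\<forall>x. \<Delta> x = 0 \<longrightarrow> (\<exists>v. (\<exists>i\<in>S. v i \<noteq> 0) \<and> (\<forall>i\<in>S. (\<Sum>j\<in>S. A x i j * v j) = 0)))"
proof -
  define n where "n = card S"
  obtain f where f: "bij_betw f {0..<n} S" using ex_bij_betw_nat_finite[OF S] n_def by blast
  define g where "g = inv_into {0..<n} f"
  have g: "g i < n" "f (g i) = i" if "i \<in> S" for i
    using that f bij_betw_inv_into_right[OF f] bij_betwE[OF bij_betw_inv_into[OF f]] by (auto simp: g_def)
  have gf: "g (f i) = i" if "i < n" for i using that f by (simp add: g_def bij_betw_inv_into_left)
  have fS: "f i \<in> S" if "i < n" for i using that f by (auto simp: bij_betw_def)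
  have ginj: "g i = g k \<longleftrightarrow> i = k" if "i \<in> S" "k \<in> S" for i k using g that by metis
  define M where "M x = mat n n (\<lambda>(i, j). A x (f i) (f j))" for x
  have M: "M x \<in> carrier_mat n n" for x by (simp add: M_def)
  have Mij: "M x $$ (i, j) = A x (f i) (f j)" if "i < n" "j < n" for x i j using that by (simp add: M_def)
  define \<Delta> where "\<Delta> x = det (M x)" for x
  define adj where "adj i j x = adj_mat (M x) $$ (g i, g j)" for i j x
  have reidx: "(\<Sum>j\<in>S. F j) = (\<Sum>j = 0..<n. F (f j))" for F :: "'v \<Rightarrow> complex"
    by (rule sum.reindex_bij_betw[OF f, symmetric])
  have p\<Delta>: "polyfun I (n * m) \<Delta>" unfolding \<Delta>_def
    by (rule polyfun_det[OF I M]) (simp add: Mij pA fS)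
  have padj: "polyfun I (n * m) (adj i j)" if ij: "i \<in> S" "j \<in> S" for i j
  proof -
    have "polyfun I ((n - 1) * m) (\<lambda>x. det (mat_delete (M x) (g j) (g i)))"
    proof (rule polyfun_det[OF I])
      show "mat_delete (M x) (g j) (g i) \<in> carrier_mat (n - 1) (n - 1)" for x
        by (rule mat_delete_carrier[OF M])
      fix k l assume kl: "k < n - 1" "l < n - 1"
      let ?k = "if k < g j then k else Suc k" and ?l = "if l < g i then l else Suc l"
      have "polyfun I m (\<lambda>x. A x (f ?k) (f ?l))" by (rule pA) (use kl in \<open>auto intro: fS\<close>)
      then show "polyfun I m (\<lambda>x. mat_delete (M x) (g j) (g i) $$ (k, l))"
        by (rule polyfun_cong) (use kl in \<open>auto simp: mat_delete_def M_def\<close>)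
    qed
    \<comment> \<open>Cofactors have degree (n - 1) m; raising it to n m lets one degree serve
      \<Delta> and all entries.\<close>
    then have "polyfun I (n * m) (\<lambda>x. (-1) ^ (g j + g i) * det (mat_delete (M x) (g j) (g i)))"
      by (intro polyfun_scale) (rule polyfun_mono[OF _ _ I], auto)
    then show ?thesis
      by (rule polyfun_cong) (use g ij in \<open>simp add: adj_def adj_mat_def cofactor_def M_def\<close>)
  qed
  have prod: "(\<Sum>j\<in>S. A x i j * adj j k x) = (if i = k then \<Delta> x else 0)"
    "(\<Sum>j\<in>S. adj i j x * A x j k) = (if i = k then \<Delta> x else 0)" if ik: "i \<in> S" "k \<in> S" for x i k
  proof -
    have adjM: "adj_mat (M x) \<in> carrier_mat n n" using adj_mat(1)[OF M] .
    have "(\<Sum>j\<in>S. A x i j * adj j k x) = (M x * adj_mat (M x)) $$ (g i, g k)"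
      using g[OF ik(1)] g[OF ik(2)] adjM M[of x]
      by (simp add: reidx scalar_prod_def adj_def gf Mij)
    then show "(\<Sum>j\<in>S. A x i j * adj j k x) = (if i = k then \<Delta> x else 0)"
      using adj_mat(2)[OF M, of x] g[OF ik(1)] g[OF ik(2)] ginj[OF ik] by (simp add: \<Delta>_def)
    have "(\<Sum>j\<in>S. adj i j x * A x j k) = (adj_mat (M x) * M x) $$ (g i, g k)"
      using g[OF ik(1)] g[OF ik(2)] adjM M[of x]
      by (simp add: reidx scalar_prod_def adj_def gf Mij)
    then show "(\<Sum>j\<in>S. adj i j x * A x j k) = (if i = k then \<Delta> x else 0)"
      using adj_mat(3)[OF M, of x] g[OF ik(1)] g[OF ik(2)] ginj[OF ik] by (simp add: \<Delta>_def)
  qed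
  have ker: "\<exists>v. (\<exists>i\<in>S. v i \<noteq> 0) \<and> (\<forall>i\<in>S. (\<Sum>j\<in>S. A x i j * v j) = 0)" if "\<Delta> x = 0" for x
  proof -
    obtain w where w: "w \<in> carrier_vec n" "w \<noteq> 0\<^sub>v n" "M x *\<^sub>v w = 0\<^sub>v n"
      using det_0_iff_vec_prod_zero[OF M, of x] \<open>\<Delta> x = 0\<close> by (auto simp: \<Delta>_def)
    define v where "v i = w $ g i" for i
    have "\<exists>k<n. w $ k \<noteq> 0"
    proof (rule ccontr)
      assume "\<not> ?thesis"
      then have "w = 0\<^sub>v n" using w(1) by (intro eq_vecI) auto
      then show False using w(2) by simp
    qed
    then obtain k where "k < n" "w $ k \<noteq> 0" by blast
    then have "\<exists>i\<in>S. v i \<noteq> 0" using gf fS by (auto simp: v_def intro!: bexI[of _ "f k"])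
    moreover have "(\<Sum>j\<in>S. A x i j * v j) = 0" if i: "i \<in> S" for i
    proof -
      have "(\<Sum>j\<in>S. A x i j * v j) = (M x *\<^sub>v w) $ g i"
        using g[OF i] M[of x] w(1) by (simp add: reidx scalar_prod_def v_def gf Mij)
      then show ?thesis using w(3) g[OF i] by simp
    qed
    ultimately show ?thesis by blast
  qed
  show ?thesis using p\<Delta> padj prod ker by blast
qed

lemma convergent_subsequence_on:
  fixes X :: "nat \<Rightarrow> 'v \<Rightarrow> 'a::heine_borel"
  assumes "finite S" "\<And>v. v \<in> S \<Longrightarrow> bounded (range (\<lambda>n. X n v))"
  shows "\<exists>r L. strict_mono (r :: nat \<Rightarrow> nat) \<and> (\<forall>v\<in>S. (\<lambda>n. X (r n) v) \<longlonglongrightarrow> L v)"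
  using assms
proof (induction S rule: finite_induct)
  case empty
  then show ?case using strict_mono_id by auto
next
  case (insert w S)
  then obtain r L where r: "strict_mono r" "\<And>v. v \<in> S \<Longrightarrow> (\<lambda>n. X (r n) v) \<longlonglongrightarrow> L v" by auto
  have "bounded (range (\<lambda>n. X (r n) w))"
    by (rule bounded_subset[OF insert.prems[of w]]) auto
  then obtain l s where s: "strict_mono s" "((\<lambda>n. X (r n) w) \<circ> s) \<longlonglongrightarrow> l"
    using bounded_imp_convergent_subsequence by blast
  show ?case
  proof (intro exI conjI ballI)
    show "strict_mono (r \<circ> s)" using r(1) s(1) by (rule strict_mono_o)
    fix v assume v: "v \<in> insert w S"
    show "(\<lambda>n. X ((r \<circ> s) n) v) \<longlonglongrightarrow> (L(w := l)) v"
    proof (cases "v = w")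
      case True
      then show ?thesis using s(2) by (simp add: o_def)
    next
      case False
      then show ?thesis using LIMSEQ_subseq_LIMSEQ[OF r(2) s(1), of v] v by (simp add: o_def)
    qed
  qed
qed

text \<open>Banach iteration for the maximum norm on W, with an arbitrary common bound
  \<open>b\<close> in place of the norm. A first step of at most \<rho> and the factor 1/2 add up to
  a displacement of at most 2 \<rho>, the radius of \<open>K\<close>; coordinates outside W stay
  frozen.\<close>

lemma contraction_fixpoint_on:
  fixes T :: "('v \<Rightarrow> complex) \<Rightarrow> 'v \<Rightarrow> complex" and h0 :: "'v \<Rightarrow> complex"
  assumes W: "finite W" and \<rho>: "\<rho> \<ge> 0"
  defines "K \<equiv> {h. (\<forall>v\<in>W. norm (h v - h0 v) \<le> 2 * \<rho>) \<and> (\<forall>v. v \<notin> W \<longrightarrow> h v = h0 v)}"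
  assumes contr: "\<And>h h' b v. h \<in> K \<Longrightarrow> h' \<in> K \<Longrightarrow> (\<And>w. w \<in> W \<Longrightarrow> norm (h w - h' w) \<le> b) \<Longrightarrow> v \<in> W \<Longrightarrow>
      norm (T h v - T h' v) \<le> b / 2"
    and start: "\<And>v. v \<in> W \<Longrightarrow> norm (T h0 v - h0 v) \<le> \<rho>"
    and off: "\<And>h v. h \<in> K \<Longrightarrow> v \<notin> W \<Longrightarrow> T h v = h0 v"
  shows "\<exists>h\<in>K. T h = h"
proof -
  define H where "H n = (T ^^ n) h0" for n
  have H0: "H 0 = h0" and HS: "H (Suc n) = T (H n)" for n by (simp_all add: H_def)
  \<comment> \<open>\<open>2 * \<rho> - 2 * \<rho> / 2 ^ n\<close> is the sum of the first n step
    bounds \<rho>, \<rho> / 2, \<rho> / 4 and so on.\<close>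
  have inv: "(\<forall>v\<in>W. norm (H n v - h0 v) \<le> 2 * \<rho> - 2 * \<rho> / 2 ^ n) \<and> (\<forall>v. v \<notin> W \<longrightarrow> H n v = h0 v) \<and>
      (\<forall>v\<in>W. norm (H (Suc n) v - H n v) \<le> \<rho> / 2 ^ n)" for n
  proof (induction n)
    case 0
    then show ?case using start by (simp add: HS H0)
  next
    case (Suc n)
    have sub: "2 * \<rho> - 2 * \<rho> / 2 ^ n \<le> 2 * \<rho>" for n using \<rho> by simp
    have n: "H n \<in> K" using Suc sub[of n] order_trans by (fastforce simp: K_def)
    have 1: "norm (H (Suc n) v - h0 v) \<le> 2 * \<rho> - 2 * \<rho> / 2 ^ Suc n" if "v \<in> W" for v
    proof -
      have "norm (H (Suc n) v - h0 v) \<le> norm (H (Suc n) v - H n v) + norm (H n v - h0 v)"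
        using norm_triangle_ineq[of "H (Suc n) v - H n v" "H n v - h0 v"] by simp
      also have "\<dots> \<le> \<rho> / 2 ^ n + (2 * \<rho> - 2 * \<rho> / 2 ^ n)" using Suc that by (intro add_mono) auto
      finally show ?thesis by simp
    qed
    have 2: "H (Suc n) v = h0 v" if "v \<notin> W" for v using off[OF n that] by (simp add: HS)
    have Sn: "H (Suc n) \<in> K" using 1 2 sub[of "Suc n"] order_trans unfolding K_def by blast
    have "norm (T (H (Suc n)) v - T (H n) v) \<le> (\<rho> / 2 ^ n) / 2" if "v \<in> W" for v
      by (rule contr[OF Sn n _ that]) (use Suc in auto)
    then show ?case using 1 2 by (simp add: HS mult.commute)
  qed
  have HK: "H n \<in> K" for n
  proof -
    have "2 * \<rho> - 2 * \<rho> / 2 ^ n \<le> 2 * \<rho>" using \<rho> by simp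
    then show ?thesis using inv[of n] order_trans unfolding K_def by blast
  qed
  have "convergent (\<lambda>n. H n v)" for v
  proof (cases "v \<in> W")
    case True
    have "summable (\<lambda>n. \<rho> * (1 / 2) ^ n)" by (intro summable_mult summable_geometric) simp
    then have "summable (\<lambda>n. H (Suc n) v - H n v)"
      by (rule summable_comparison_test'[of _ 0]) (use inv True in \<open>auto simp: power_divide\<close>)
    then have conv: "convergent (\<lambda>n. (\<Sum>k<n. H (Suc k) v - H k v) + H 0 v)"
      by (intro convergent_add convergent_const) (simp add: summable_iff_convergent)
    have eq: "(\<lambda>n. (\<Sum>k<n. H (Suc k) v - H k v) + H 0 v) = (\<lambda>n. H n v)"
    proof
      show "(\<Sum>k<n. H (Suc k) v - H k v) + H 0 v = H n v" for n
        using sum_lessThan_telescope[of "\<lambda>k. H k v" n] by simp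
    qed
    show ?thesis using conv unfolding eq .
  next
    case False
    then have "(\<lambda>n. H n v) = (\<lambda>n. h0 v)" using inv by auto
    then show ?thesis by (simp add: convergent_const)
  qed
  then obtain L where L: "\<And>v. (\<lambda>n. H n v) \<longlonglongrightarrow> L v" unfolding convergent_def by metis
  have LK: "L \<in> K" unfolding K_def
  proof (intro CollectI conjI ballI allI impI)
    fix v assume "v \<in> W"
    show "norm (L v - h0 v) \<le> 2 * \<rho>"
      by (rule LIMSEQ_le_const2[OF tendsto_norm[OF tendsto_diff[OF L tendsto_const]]])
        (use HK \<open>v \<in> W\<close> in \<open>auto simp: K_def\<close>)
  next
    fix v assume "v \<notin> W"
    then have "(\<lambda>n. H n v) = (\<lambda>n. h0 v)" using inv by auto
    then show "L v = h0 v" using L[of v] LIMSEQ_unique tendsto_const by metis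
  qed
  have "T L v = L v" for v
  proof (cases "v \<in> W")
    case True
    \<comment> \<open>One bound for all coordinates that tends to 0, in the form that
      \<open>contr\<close> requires.\<close>
    define b where "b n = (\<Sum>w\<in>W. norm (H n w - L w))" for n
    have b: "b \<longlonglongrightarrow> 0" unfolding b_def
      by (intro tendsto_null_sum tendsto_norm_zero LIM_zero L)
    have bnd: "norm (H (Suc n) v - T L v) \<le> b n / 2" for n
      unfolding HS
    proof (rule contr[OF HK LK _ True])
      fix w assume "w \<in> W"
      then show "norm (H n w - L w) \<le> b n" unfolding b_def using W by (intro member_le_sum) auto
    qed
    have "(\<lambda>n. H (Suc n) v - T L v) \<longlonglongrightarrow> 0"
      by (rule Lim_null_comparison[OF always_eventually tendsto_divide_zero[OF b]]) (rule allI, rule bnd)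
    then have "(\<lambda>n. H (Suc n) v) \<longlonglongrightarrow> T L v" by (rule LIM_zero_cancel)
    then show ?thesis using LIMSEQ_unique LIMSEQ_Suc[OF L] by blast
  next
    case False
    then show ?thesis using off[OF LK False] LK by (simp add: K_def)
  qed
  then show ?thesis using LK by blast
qed

text \<open>The sequential form of the fact that a proper local homeomorphism has fibres of locally
  constant size: \<open>proper\<close> gives accumulation points, while \<open>exist\<close> and
  \<open>unique\<close> give one branch of solutions through each point of the fibre over
  \<open>s0\<close>.\<close>

lemma card_locally_constant:
  fixes Sol :: "complex \<Rightarrow> ('v \<Rightarrow> complex) set"
  assumes V: "finite V" and ext: "\<And>s. Sol s \<subseteq> V \<rightarrow>\<^sub>E UNIV"
    and proper: "\<And>S H. S \<longlonglongrightarrow> s0 \<Longrightarrow> (\<And>n. H n \<in> Sol (S n)) \<Longrightarrow>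
      \<exists>r h. strict_mono (r :: nat \<Rightarrow> nat) \<and> h \<in> Sol s0 \<and> (\<forall>v\<in>V. (\<lambda>n. H (r n) v) \<longlonglongrightarrow> h v)"
    and unique: "\<And>S H H' h. S \<longlonglongrightarrow> s0 \<Longrightarrow> h \<in> Sol s0 \<Longrightarrow> (\<And>n. H n \<in> Sol (S n)) \<Longrightarrow> (\<And>n. H' n \<in> Sol (S n)) \<Longrightarrow>
      (\<And>v. v \<in> V \<Longrightarrow> (\<lambda>n. H n v) \<longlonglongrightarrow> h v) \<Longrightarrow> (\<And>v. v \<in> V \<Longrightarrow> (\<lambda>n. H' n v) \<longlonglongrightarrow> h v) \<Longrightarrow> \<exists>n. H n = H' n"
    and exist: "\<And>S h. S \<longlonglongrightarrow> s0 \<Longrightarrow> h \<in> Sol s0 \<Longrightarrow>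
      \<exists>H. eventually (\<lambda>n. H n \<in> Sol (S n)) sequentially \<and> (\<forall>v\<in>V. (\<lambda>n. H n v) \<longlonglongrightarrow> h v)"
  shows "finite (Sol s0)" "eventually (\<lambda>s. card (Sol s0) = card (Sol s)) (at s0 within A)"
proof -
  show fin: "finite (Sol s0)"
  proof (rule ccontr)
    assume "infinite (Sol s0)"
    then obtain H :: "nat \<Rightarrow> _" where H: "inj H" "range H \<subseteq> Sol s0"
      using infinite_countable_subset by blast
    obtain r h where r: "strict_mono r" "h \<in> Sol s0" "\<And>v. v \<in> V \<Longrightarrow> (\<lambda>n. H (r n) v) \<longlonglongrightarrow> h v"
      using proper[of "\<lambda>_. s0" H, OF tendsto_const] H(2) by blast
    \<comment> \<open>The subsequence and its shift by one converge to the same point of the fibre,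
      so somewhere they agree, although all terms are distinct.\<close>
    have "\<exists>n. H (r n) = H (r (Suc n))"
    proof (rule unique[of "\<lambda>_. s0" h "\<lambda>n. H (r n)" "\<lambda>n. H (r (Suc n))"])
      show "(\<lambda>n. H (r (Suc n)) v) \<longlonglongrightarrow> h v" if "v \<in> V" for v using LIMSEQ_Suc[OF r(3)[OF that]] .
    qed (use r H(2) in auto)
    then obtain n where "r n = r (Suc n)" using injD[OF H(1)] by blast
    then show False using strict_monoD[OF r(1), of n "Suc n"] by simp
  qed
  have seq: "eventually (\<lambda>n. card (Sol s0) = card (Sol (S n))) sequentially" if S: "S \<longlonglongrightarrow> s0" for S
  proof -
    have "\<forall>h\<in>Sol s0. \<exists>H. eventually (\<lambda>n. H n \<in> Sol (S n)) sequentially \<and> (\<forall>v\<in>V. (\<lambda>n. H n v) \<longlonglongrightarrow> h v)"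
      using exist[OF S] by blast
    from bchoice[OF this] obtain H where H: "\<And>h. h \<in> Sol s0 \<Longrightarrow> eventually (\<lambda>n. H h n \<in> Sol (S n)) sequentially"
      "\<And>h v. h \<in> Sol s0 \<Longrightarrow> v \<in> V \<Longrightarrow> (\<lambda>n. H h n v) \<longlonglongrightarrow> h v" by blast
    have into: "eventually (\<lambda>n. \<forall>h\<in>Sol s0. H h n \<in> Sol (S n)) sequentially"
      by (intro eventually_ball_finite fin ballI H(1))
    have inj: "eventually (\<lambda>n. \<forall>h\<in>Sol s0. \<forall>h'\<in>Sol s0. h \<noteq> h' \<longrightarrow> H h n \<noteq> H h' n) sequentially"
    proof (intro eventually_ball_finite fin ballI)
      fix h h' assume hh: "h \<in> Sol s0" "h' \<in> Sol s0"
      show "eventually (\<lambda>n. h \<noteq> h' \<longrightarrow> H h n \<noteq> H h' n) sequentially"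
      proof (cases "h = h'")
        case False
        then obtain v where v: "v \<in> V" "h v \<noteq> h' v"
          using hh ext[of s0] PiE_ext[of h V "\<lambda>_. UNIV" h'] by blast
        have "(\<lambda>n. H h n v - H h' n v) \<longlonglongrightarrow> h v - h' v" by (intro tendsto_diff H(2) hh v(1))
        then have "eventually (\<lambda>n. H h n v - H h' n v \<noteq> 0) sequentially"
          by (rule tendsto_imp_eventually_ne) (use v(2) in simp)
        then show ?thesis by eventually_elim auto
      qed simp
    qed
    \<comment> \<open>Solutions off all branches at infinitely many n would accumulate at some
      \<open>h\<close> over \<open>s0\<close>, and \<open>unique\<close> puts one of them on the
      branch of \<open>h\<close>.\<close>
    have surj: "eventually (\<lambda>n. Sol (S n) \<subseteq> (\<lambda>h. H h n) ` Sol s0) sequentially"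
    proof (rule ccontr)
      assume "\<not> ?thesis"
      then have "frequently (\<lambda>n. (\<forall>h\<in>Sol s0. H h n \<in> Sol (S n)) \<and> \<not> Sol (S n) \<subseteq> (\<lambda>h. H h n) ` Sol s0) sequentially"
        unfolding frequently_def
      proof (rule contrapos_nn)
        assume "eventually (\<lambda>n. \<not> ((\<forall>h\<in>Sol s0. H h n \<in> Sol (S n)) \<and> \<not> Sol (S n) \<subseteq> (\<lambda>h. H h n) ` Sol s0)) sequentially"
        with into show "eventually (\<lambda>n. Sol (S n) \<subseteq> (\<lambda>h. H h n) ` Sol s0) sequentially"
          by eventually_elim blast
      qed
      then have "infinite {n. (\<forall>h\<in>Sol s0. H h n \<in> Sol (S n)) \<and> \<not> Sol (S n) \<subseteq> (\<lambda>h. H h n) ` Sol s0}"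
        by (simp add: frequently_cofinite[symmetric] cofinite_eq_sequentially)
      from infinite_enumerate[OF this] obtain r :: "nat \<Rightarrow> nat" where r: "strict_mono r"
        "\<And>n h. h \<in> Sol s0 \<Longrightarrow> H h (r n) \<in> Sol (S (r n))" "\<And>n. \<not> Sol (S (r n)) \<subseteq> (\<lambda>h. H h (r n)) ` Sol s0"
        by auto
      then have "\<forall>n. \<exists>k. k \<in> Sol (S (r n)) \<and> k \<notin> (\<lambda>h. H h (r n)) ` Sol s0" by blast
      from choice[OF this] obtain k where k: "\<And>n. k n \<in> Sol (S (r n))" "\<And>n. k n \<notin> (\<lambda>h. H h (r n)) ` Sol s0"
        by blast
      have Sr: "(\<lambda>n. S (r n)) \<longlonglongrightarrow> s0" using LIMSEQ_subseq_LIMSEQ[OF S r(1)] by (simp add: o_def)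
      obtain r' h where r': "strict_mono (r' :: nat \<Rightarrow> nat)" "h \<in> Sol s0" "\<And>v. v \<in> V \<Longrightarrow> (\<lambda>n. k (r' n) v) \<longlonglongrightarrow> h v"
        using proper[OF Sr k(1)] by blast
      have "\<exists>n. k (r' n) = H h (r (r' n))"
      proof (rule unique)
        show "(\<lambda>n. S (r (r' n))) \<longlonglongrightarrow> s0" using LIMSEQ_subseq_LIMSEQ[OF Sr r'(1)] by (simp add: o_def)
        show "(\<lambda>n. H h (r (r' n)) v) \<longlonglongrightarrow> h v" if "v \<in> V" for v
          using LIMSEQ_subseq_LIMSEQ[OF H(2)[OF r'(2) that] strict_mono_o[OF r(1) r'(1)]] by (simp add: o_def)
      qed (use k r r' in auto)
      then show False using k(2) r'(2) by blast
    qed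
    show ?thesis using into inj surj
    proof eventually_elim
      case (elim n)
      have "inj_on (\<lambda>h. H h n) (Sol s0)" using elim(2) by (auto intro: inj_onI)
      moreover have "(\<lambda>h. H h n) ` Sol s0 = Sol (S n)" using elim(1,3) by blast
      ultimately show ?case using card_image by metis
    qed
  qed
  show "eventually (\<lambda>s. card (Sol s0) = card (Sol s)) (at s0 within A)"
    by (rule sequentially_imp_eventually_within) (use seq in blast)
qed

section \<open>Counting regions by deletion-contraction\<close>

definition config :: "('v \<Rightarrow> real) \<Rightarrow> 'v set \<Rightarrow> 'v set set \<Rightarrow> ('v \<Rightarrow> real) set" where
  "config u B E = {h. (\<forall>b\<in>B. h b = u b) \<and> (\<forall>x y. {x, y} \<in> E \<longrightarrow> h x \<noteq> h y)}"

text \<open>The label of a region. \<open>config\<close> is the complement of the hyperplanes h x =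
  h y in the affine space given by h = u on B, and its points lie in one region iff they order the
  ends of every edge alike. Edges point to the larger value. Counting labels in place of components
  keeps the count combinatorial.\<close>

definition orientation :: "'v set set \<Rightarrow> ('v \<Rightarrow> real) \<Rightarrow> ('v \<times> 'v) set" where
  "orientation E h = {(x, y). {x, y} \<in> E \<and> h x < h y}"

text \<open>
  On the regions of a graph without isolated interior vertices the product of these weights is \<open>1\<close> if no
  interior vertex is a source or a sink, and \<open>0\<close> otherwise. Isolated vertices get weight \<open>-1\<close>, which
  makes deletion-contraction hold without exception.
\<close>

definition vertex_weight :: "('v \<times> 'v) set \<Rightarrow> 'v \<Rightarrow> int" where
  "vertex_weight D i = of_bool (\<exists>x. (x, i) \<in> D) + of_bool (\<exists>y. (i, y) \<in> D) - 1"

definition region_sum :: "('v \<Rightarrow> real) \<Rightarrow> 'v set \<Rightarrow> 'v set \<Rightarrow> 'v set set \<Rightarrow> int" where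
  "region_sum u B W E = (\<Sum>D\<in>orientation E ` config u B E. \<Prod>i\<in>W. vertex_weight D i)"

lemma orientation_iff: "(x, y) \<in> orientation E h \<longleftrightarrow> {x, y} \<in> E \<and> h x < h y"
  by (simp add: orientation_def)

lemma config_orientation_eq:
  assumes "h \<in> config u B E" "orientation E h' = orientation E h" "\<And>b. b \<in> B \<Longrightarrow> h' b = u b"
  shows "h' \<in> config u B E"
  unfolding config_def
proof (intro CollectI conjI ballI allI impI assms(3))
  fix x y assume xy: "{x, y} \<in> E"
  then have "h x \<noteq> h y" using assms(1) by (auto simp: config_def)
  then have "(x, y) \<in> orientation E h \<or> (y, x) \<in> orientation E h" using xy by (auto simp: orientation_iff insert_commute)
  then show "h' x \<noteq> h' y" unfolding assms(2)[symmetric] by (auto simp: orientation_iff)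
qed

lemma orientation_fun_upd:
  assumes "h \<in> config u B E" "\<And>y. {v, y} \<in> E \<Longrightarrow> (t < h y \<longleftrightarrow> h v < h y) \<and> (h y < t \<longleftrightarrow> h y < h v)"
  shows "orientation E (h(v := t)) = orientation E h"
proof -
  have "{v, v} \<notin> E" using assms(1) unfolding config_def by blast
  then have "(x, y) \<in> orientation E (h(v := t)) \<longleftrightarrow> (x, y) \<in> orientation E h" for x y
    using assms(2)[of x] assms(2)[of y] by (auto simp: orientation_iff insert_commute)
  then show ?thesis by auto
qed

lemma config_neq: "h \<in> config u B E \<Longrightarrow> {x, y} \<in> E \<Longrightarrow> h x < h y \<or> h y < h x"
  by (auto simp: config_def neq_iff)

text \<open>A vertex without outgoing edge exceeds all its neighbours, so raising it crosses no
  wall.\<close>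

lemma orientation_move_up:
  assumes "h \<in> config u B E" "v \<notin> B" "\<nexists>y. (v, y) \<in> orientation E h" "h v \<le> t"
  shows "orientation E (h(v := t)) = orientation E h" "h(v := t) \<in> config u B E"
proof -
  show *: "orientation E (h(v := t)) = orientation E h"
    by (rule orientation_fun_upd[OF assms(1)]) (use assms(3,4) config_neq[OF assms(1), of v] in \<open>force simp: orientation_iff\<close>)
  show "h(v := t) \<in> config u B E"
    by (rule config_orientation_eq[OF assms(1) *]) (use assms(1,2) in \<open>auto simp: config_def\<close>)
qed

lemma orientation_move_down:
  assumes "h \<in> config u B E" "v \<notin> B" "\<nexists>y. (y, v) \<in> orientation E h" "t \<le> h v"
  shows "orientation E (h(v := t)) = orientation E h" "h(v := t) \<in> config u B E"
proof -
  show *: "orientation E (h(v := t)) = orientation E h"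
    by (rule orientation_fun_upd[OF assms(1)])
      (use assms(3,4) config_neq[OF assms(1), of v] in \<open>force simp: orientation_iff insert_commute\<close>)
  show "h(v := t) \<in> config u B E"
    by (rule config_orientation_eq[OF assms(1) *]) (use assms(1,2) in \<open>auto simp: config_def\<close>)
qed

lemma orientation_perturb:
  assumes "h \<in> config u B E" "v \<notin> B" "finite E" "\<And>e. e \<in> E \<Longrightarrow> finite e"
  shows "\<exists>\<delta>>0. \<forall>t. \<bar>t - h v\<bar> < \<delta> \<longrightarrow> orientation E (h(v := t)) = orientation E h \<and> h(v := t) \<in> config u B E"
proof -
  let ?N = "{y. {v, y} \<in> E}"
  have "?N \<subseteq> \<Union>E" by auto
  then have fin: "finite ?N" using assms(3,4) by (meson finite_Union finite_subset)
  \<comment> \<open>The distance to the nearest neighbouring value; the 1 keeps the set nonempty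
    when \<open>v\<close> has no neighbour.\<close>
  define \<delta> where "\<delta> = Min (insert 1 ((\<lambda>y. \<bar>h y - h v\<bar>) ` ?N))"
  have "\<delta> > 0" unfolding \<delta>_def using fin config_neq[OF assms(1), of v] by (subst Min_gr_iff) force+
  moreover have "orientation E (h(v := t)) = orientation E h \<and> h(v := t) \<in> config u B E" if t: "\<bar>t - h v\<bar> < \<delta>" for t
  proof -
    have "\<bar>t - h v\<bar> < \<bar>h y - h v\<bar>" if "{v, y} \<in> E" for y
    proof -
      have "\<delta> \<le> \<bar>h y - h v\<bar>" unfolding \<delta>_def using fin that by (intro Min_le) auto
      then show ?thesis using t by simp
    qed
    then have *: "orientation E (h(v := t)) = orientation E h"
      by (intro orientation_fun_upd[OF assms(1)]) (smt (verit))
    moreover have "h(v := t) \<in> config u B E"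
      by (rule config_orientation_eq[OF assms(1) *]) (use assms(1,2) in \<open>auto simp: config_def\<close>)
    ultimately show ?thesis by blast
  qed
  ultimately show ?thesis by blast
qed

text \<open>Regions are convex, and the linear function h q - h p changes sign on the segment from
  \<open>h\<close> to \<open>h'\<close>; the parameter \<open>s\<close> is its zero.\<close>

lemma orientation_convex:
  assumes "h \<in> config u B E" "h' \<in> config u B E" "orientation E h' = orientation E h" "h p < h q" "h' q < h' p"
  shows "\<exists>k \<in> config u B E. orientation E k = orientation E h \<and> k p = k q"
proof -
  define s where "s = (h q - h p) / ((h q - h p) + (h' p - h' q))"
  have s: "0 < s" "s < 1" using assms(4,5) by (auto simp: s_def field_simps)
  define k where "k x = (1 - s) * h x + s * h' x" for x
  have less: "k x < k y" if "h x < h y" "h' x < h' y" for x y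
    unfolding k_def using that s by (intro add_strict_mono mult_strict_left_mono) auto
  have "(x, y) \<in> orientation E k \<longleftrightarrow> (x, y) \<in> orientation E h" for x y
  proof (cases "{x, y} \<in> E")
    case True
    have "h x < h y \<longleftrightarrow> h' x < h' y" "h y < h x \<longleftrightarrow> h' y < h' x"
    proof -
      have "(x, y) \<in> orientation E h \<longleftrightarrow> (x, y) \<in> orientation E h'" "(y, x) \<in> orientation E h \<longleftrightarrow> (y, x) \<in> orientation E h'"
        using assms(3) by auto
      moreover have "{y, x} \<in> E" using True by (simp add: insert_commute)
      ultimately show "h x < h y \<longleftrightarrow> h' x < h' y" "h y < h x \<longleftrightarrow> h' y < h' x"
        using True by (simp_all add: orientation_iff)
    qed
    then show ?thesis using less[of x y] less[of y x] config_neq[OF assms(1) True] True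
      by (auto simp: orientation_iff)
  qed (auto simp: orientation_iff)
  then have orientation: "orientation E k = orientation E h" by auto
  have "k \<in> config u B E"
    by (rule config_orientation_eq[OF assms(1) orientation]) (use assms(1,2) in \<open>auto simp: config_def k_def algebra_simps\<close>)
  moreover have "k p = k q"
  proof -
    have d: "(h q - h p) + (h' p - h' q) \<noteq> 0" using assms(4,5) by auto
    have "s * ((h q - h p) + (h' p - h' q)) = h q - h p" using d by (simp add: s_def)
    then show ?thesis by (simp add: k_def algebra_simps)
  qed
  ultimately show ?thesis using orientation by blast
qed

text \<open>The effect of a new edge pq at its two ends. The letters a and b stand for incoming and
  outgoing edges, \<open>w\<close> for an interior q, and \<open>lt\<close>, \<open>gt\<close>,
  \<open>tie\<close> tell how the region lies to the wall h p = h q. If it meets both sides, expand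
  and use that a \<or> a' has the value a + a' - a a'. If it lies on one side, the forced truth
  values make both sides of the equation coincide.\<close>

lemma vertex_weight_identity:
  assumes "lt \<or> gt" "tie \<longleftrightarrow> lt \<and> gt" "lt \<and> \<not> gt \<Longrightarrow> bp \<and> (w \<longrightarrow> aq)" "gt \<and> \<not> lt \<Longrightarrow> ap \<and> (w \<longrightarrow> bq)"
  shows "of_bool lt * (of_bool ap * (if w then of_bool bq else 1)) + of_bool gt * (of_bool bp * (if w then of_bool aq else 1))
    = (of_bool ap + of_bool bp - 1) * (if w then of_bool aq + of_bool bq - 1 else 1)
      + of_bool tie * (if w then of_bool (ap \<or> aq) + of_bool (bp \<or> bq) - 1 else (1::int))"
  using assms by (cases lt; cases gt; cases ap; cases aq; cases bp; cases bq; cases w) auto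

lemma orientation_finite:
  assumes "finite E" "\<And>e. e \<in> E \<Longrightarrow> finite e"
  shows "finite (orientation E ` S)"
proof -
  have "orientation E ` S \<subseteq> Pow (\<Union>E \<times> \<Union>E)" by (auto simp: orientation_def)
  then show ?thesis by (rule finite_subset) (use assms in auto)
qed

lemma contracted_edge:
  assumes "\<And>e. e \<in> E \<Longrightarrow> \<exists>x y. e = {x, y}" and xy: "{x, y} \<in> (`) g ` E"
  shows "\<exists>x' y'. {x', y'} \<in> E \<and> x = g x' \<and> y = g y'"
proof -
  obtain e where e: "e \<in> E" "{x, y} = g ` e" using xy by blast
  obtain a b where ab: "e = {a, b}" using assms(1)[OF e(1)] by auto
  have "{x, y} = {g a, g b}" using e(2) ab by auto
  then consider "x = g a" "y = g b" | "x = g b" "y = g a" by (metis doubleton_eq_iff)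
  moreover have "{a, b} \<in> E" "{b, a} \<in> E" using e(1) ab by (auto simp: insert_commute)
  ultimately show ?thesis by cases blast+
qed

lemma sum_image_filter:
  fixes F :: "'b \<Rightarrow> int"
  assumes "finite R" "inj_on f {x \<in> R. P x}"
  shows "(\<Sum>y\<in>f ` {x \<in> R. P x}. F y) = (\<Sum>x\<in>R. of_bool (P x) * F (f x))"
proof -
  have "(\<Sum>y\<in>f ` {x \<in> R. P x}. F y) = (\<Sum>x\<in>{x \<in> R. P x}. F (f x))"
    using assms(2) by (simp add: sum.reindex)
  also have "\<dots> = (\<Sum>x\<in>R. if P x then F (f x) else 0)" using assms(1) by (rule sum.inter_filter)
  also have "\<dots> = (\<Sum>x\<in>R. of_bool (P x) * F (f x))" by (rule sum.cong) auto
  finally show ?thesis .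
qed

text \<open>The edge pq adds the wall h p = h q. A region that the wall cuts (\<open>tie\<close>)
  splits in two and leaves a region of the contraction on the wall; the others only gain an oriented
  edge. The weights are compared region by region in \<open>key\<close>. The interior vertex
  \<open>p\<close> is merged into \<open>q\<close>, which may lie in B.\<close>

lemma region_sum_deletion_contraction:
  fixes E :: "'v set set"
  assumes W: "finite W" "W \<inter> B = {}" and E: "finite E" "\<And>e. e \<in> E \<Longrightarrow> \<exists>x y. e = {x, y}"
    and pq: "p \<in> W" "q \<in> W \<union> B" "p \<noteq> q" "{p, q} \<notin> E"
  defines "g \<equiv> (\<lambda>x. if x = p then q else x)"
  shows "region_sum u B W (insert {p, q} E) = region_sum u B W E + region_sum u B (W - {p}) ((`) g ` E)"
proof -
  let ?X = "config u B E" and ?E = "insert {p, q} E" and ?E' = "(`) g ` E"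
  define R where "R = orientation E ` ?X"
  have Ef: "finite e" if "e \<in> E" for e using E(2)[OF that] by auto
  have finR: "finite R" unfolding R_def by (rule orientation_finite[OF E(1) Ef])
  define lt where "lt D \<longleftrightarrow> (\<exists>h\<in>?X. orientation E h = D \<and> h p < h q)" for D
  define gt where "gt D \<longleftrightarrow> (\<exists>h\<in>?X. orientation E h = D \<and> h q < h p)" for D
  define tie where "tie D \<longleftrightarrow> (\<exists>h\<in>?X. orientation E h = D \<and> h p = h q)" for D
  have pB: "p \<notin> B" using pq W by auto
  \<comment> \<open>Regions are open, so a tie can be broken either way by moving \<open>p\<close>;
    they are convex, so points on both sides of the wall give a tie.\<close>
  have tie_iff: "tie D \<longleftrightarrow> lt D \<and> gt D" for D
  proof
    assume "tie D"
    then obtain h where h: "h \<in> ?X" "orientation E h = D" "h p = h q" by (auto simp: tie_def)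
    obtain \<delta> where \<delta>: "\<delta> > 0" "\<And>t. \<bar>t - h p\<bar> < \<delta> \<Longrightarrow> orientation E (h(p := t)) = D \<and> h(p := t) \<in> ?X"
      using orientation_perturb[OF h(1) pB E(1) Ef] h(2) by auto
    show "lt D \<and> gt D" unfolding lt_def gt_def
    proof (intro conjI bexI)
      show "orientation E (h(p := h p - \<delta> / 2)) = D" "h(p := h p - \<delta> / 2) \<in> ?X"
        "orientation E (h(p := h p + \<delta> / 2)) = D" "h(p := h p + \<delta> / 2) \<in> ?X"
        using \<delta>(2)[of "h p - \<delta> / 2"] \<delta>(2)[of "h p + \<delta> / 2"] \<delta>(1) by auto
    qed (use h(3) pq(3) \<delta>(1) in auto)
  next
    assume "lt D \<and> gt D"
    then obtain h h' where "h \<in> ?X" "orientation E h = D" "h p < h q" "h' \<in> ?X" "orientation E h' = D" "h' q < h' p"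
      by (auto simp: lt_def gt_def)
    then show "tie D" using orientation_convex[of h u B E h' p q] by (auto simp: tie_def)
  qed
  have ltgt: "lt D \<or> gt D" if D: "D \<in> R" for D
  proof (rule ccontr)
    assume "\<not> (lt D \<or> gt D)"
    moreover from this have "tie D" using D unfolding R_def lt_def gt_def tie_def
      by (metis (lifting) imageE linorder_less_linear)
    ultimately show False using tie_iff by blast
  qed
  \<comment> \<open>If \<open>p\<close> had no larger neighbour, it could be raised past
    \<open>q\<close>; if an interior \<open>q\<close> had no smaller neighbour, it could be lowered
    past \<open>p\<close>. Either move would reach the other side of the wall.\<close>
  have only_lt: "(\<exists>y. (p, y) \<in> D) \<and> (q \<in> W \<longrightarrow> (\<exists>x. (x, q) \<in> D))" if "lt D \<and> \<not> gt D" for D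
  proof (rule ccontr)
    assume neg: "\<not> ?thesis"
    obtain h where h: "h \<in> ?X" "orientation E h = D" "h p < h q" using \<open>lt D \<and> \<not> gt D\<close> by (auto simp: lt_def)
    consider "\<nexists>y. (p, y) \<in> D" | "q \<notin> B" "\<nexists>x. (x, q) \<in> D" using neg W by auto
    then have "gt D"
    proof cases
      case 1
      then show ?thesis unfolding gt_def
        using orientation_move_up[OF h(1) pB, of "h q + 1"] h pq(3) by (intro bexI[of _ "h(p := h q + 1)"]) auto
    next
      case 2
      then show ?thesis unfolding gt_def
        using orientation_move_down[OF h(1), of q "h p - 1"] h pq(3) by (intro bexI[of _ "h(q := h p - 1)"]) auto
    qed
    then show False using \<open>lt D \<and> \<not> gt D\<close> by blast
  qed
  have only_gt: "(\<exists>x. (x, p) \<in> D) \<and> (q \<in> W \<longrightarrow> (\<exists>y. (q, y) \<in> D))" if "gt D \<and> \<not> lt D" for D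
  proof (rule ccontr)
    assume neg: "\<not> ?thesis"
    obtain h where h: "h \<in> ?X" "orientation E h = D" "h q < h p" using \<open>gt D \<and> \<not> lt D\<close> by (auto simp: gt_def)
    consider "\<nexists>x. (x, p) \<in> D" | "q \<notin> B" "\<nexists>y. (q, y) \<in> D" using neg W by auto
    then have "lt D"
    proof cases
      case 1
      then show ?thesis unfolding lt_def
        using orientation_move_down[OF h(1) pB, of "h q - 1"] h pq(3) by (intro bexI[of _ "h(p := h q - 1)"]) auto
    next
      case 2
      then show ?thesis unfolding lt_def
        using orientation_move_up[OF h(1), of q "h p + 1"] h pq(3) by (intro bexI[of _ "h(q := h p + 1)"]) auto
    qed
    then show False using \<open>gt D \<and> \<not> lt D\<close> by blast
  qed
  define mp where "mp D = map_prod g g ` D" for D :: "('v \<times> 'v) set"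
  have pqD: "(p, q) \<notin> D" "(q, p) \<notin> D" if "D \<in> R" for D
    using that pq(4) by (auto simp: R_def orientation_iff insert_commute)
  have split: "(\<Prod>i\<in>W. f i) = f p * (if q \<in> W then f q else 1) * (\<Prod>i\<in>W - {p, q}. f i)" for f :: "'v \<Rightarrow> int"
  proof -
    have "(\<Prod>i\<in>W. f i) = f p * (\<Prod>i\<in>W - {p}. f i)" using W pq by (subst prod.remove[of _ p]) auto
    also have "(\<Prod>i\<in>W - {p}. f i) = (if q \<in> W then f q else 1) * (\<Prod>i\<in>W - {p, q}. f i)"
    proof (cases "q \<in> W")
      case True
      then have "(\<Prod>i\<in>W - {p}. f i) = f q * (\<Prod>i\<in>W - {p} - {q}. f i)"
        using W pq by (subst prod.remove[of _ q]) auto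
      then show ?thesis using True by (simp add: Diff_insert2[symmetric])
    next
      case False
      then have "W - {p, q} = W - {p}" by auto
      then show ?thesis using False by simp
    qed
    finally show ?thesis by (simp add: mult.assoc)
  qed
  have split': "(\<Prod>i\<in>W - {p}. f i) = (if q \<in> W then f q else 1) * (\<Prod>i\<in>W - {p, q}. f i)" for f :: "'v \<Rightarrow> int"
    using split[of "\<lambda>i. if i = p then 1 else f i"] W pq by (simp add: prod.remove[of W p] cong: prod.cong_simp)
  have key: "of_bool (lt D) * (\<Prod>i\<in>W. vertex_weight (insert (p, q) D) i) + of_bool (gt D) * (\<Prod>i\<in>W. vertex_weight (insert (q, p) D) i)
    = (\<Prod>i\<in>W. vertex_weight D i) + of_bool (tie D) * (\<Prod>i\<in>W - {p}. vertex_weight (mp D) i)" if D: "D \<in> R" for D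
  proof -
    let ?r = "\<Prod>i\<in>W - {p, q}. vertex_weight D i"
    have r: "(\<Prod>i\<in>W - {p, q}. vertex_weight (insert (p, q) D) i) = ?r" "(\<Prod>i\<in>W - {p, q}. vertex_weight (insert (q, p) D) i) = ?r"
      by (intro prod.cong; auto simp: vertex_weight_def)+
    have r': "(\<Prod>i\<in>W - {p, q}. vertex_weight (mp D) i) = ?r"
    proof (intro prod.cong refl)
      fix i assume "i \<in> W - {p, q}"
      then have gi: "g y = i \<longleftrightarrow> y = i" for y by (auto simp: g_def)
      have "(\<exists>x. (x, i) \<in> mp D) \<longleftrightarrow> (\<exists>x. (x, i) \<in> D)" "(\<exists>y. (i, y) \<in> mp D) \<longleftrightarrow> (\<exists>y. (i, y) \<in> D)"
        unfolding mp_def using gi by (force simp: image_iff)+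
      then show "vertex_weight (mp D) i = vertex_weight D i" by (simp add: vertex_weight_def)
    qed
    have gq: "g y = q \<longleftrightarrow> y = p \<or> y = q" for y by (auto simp: g_def)
    have "(\<exists>x. (x, q) \<in> mp D) \<longleftrightarrow> (\<exists>x. (x, p) \<in> D) \<or> (\<exists>x. (x, q) \<in> D)"
      "(\<exists>y. (q, y) \<in> mp D) \<longleftrightarrow> (\<exists>y. (p, y) \<in> D) \<or> (\<exists>y. (q, y) \<in> D)"
      unfolding mp_def using gq by (force simp: image_iff)+
    then have wq: "vertex_weight (mp D) q = of_bool ((\<exists>x. (x, p) \<in> D) \<or> (\<exists>x. (x, q) \<in> D))
        + of_bool ((\<exists>y. (p, y) \<in> D) \<or> (\<exists>y. (q, y) \<in> D)) - 1" by (simp add: vertex_weight_def)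
    have w: "vertex_weight (insert (p, q) D) p = of_bool (\<exists>x. (x, p) \<in> D)" "vertex_weight (insert (p, q) D) q = of_bool (\<exists>y. (q, y) \<in> D)"
      "vertex_weight (insert (q, p) D) p = of_bool (\<exists>y. (p, y) \<in> D)" "vertex_weight (insert (q, p) D) q = of_bool (\<exists>x. (x, q) \<in> D)"
      using pq(3) by (auto simp: vertex_weight_def)
    show ?thesis
      unfolding split[of "vertex_weight _"] split'[of "vertex_weight _"] r r' w wq
      using arg_cong[OF vertex_weight_identity[OF ltgt[OF D] tie_iff only_lt only_gt], where f = "\<lambda>z. z * ?r"]
      by (simp add: vertex_weight_def distrib_right mult.assoc)
  qed
  have lt_set: "orientation ?E ` config u B ?E = insert (p, q) ` {D \<in> R. lt D} \<union> insert (q, p) ` {D \<in> R. gt D}"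
  proof -
    have c: "config u B ?E = {h \<in> ?X. h p \<noteq> h q}" by (auto simp: config_def doubleton_eq_iff)
    have o1: "orientation ?E h = insert (p, q) (orientation E h)" if "h p < h q" for h
      using that by (auto simp: orientation_def doubleton_eq_iff)
    have o2: "orientation ?E h = insert (q, p) (orientation E h)" if "h q < h p" for h
      using that by (auto simp: orientation_def doubleton_eq_iff)
    show ?thesis
    proof (intro equalityI subsetI)
      fix D assume "D \<in> orientation ?E ` config u B ?E"
      then obtain h where h: "h \<in> ?X" "h p \<noteq> h q" "D = orientation ?E h" unfolding c by auto
      show "D \<in> insert (p, q) ` {D \<in> R. lt D} \<union> insert (q, p) ` {D \<in> R. gt D}"
      proof (cases "h p < h q")
        case True
        then have "orientation E h \<in> {D \<in> R. lt D}" using h(1) unfolding R_def lt_def by blast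
        then show ?thesis unfolding h(3) o1[OF True] by blast
      next
        case False
        then have lt: "h q < h p" using h(2) by simp
        then have "orientation E h \<in> {D \<in> R. gt D}" using h(1) unfolding R_def gt_def by blast
        then show ?thesis unfolding h(3) o2[OF lt] by blast
      qed
    next
      fix D assume "D \<in> insert (p, q) ` {D \<in> R. lt D} \<union> insert (q, p) ` {D \<in> R. gt D}"
      then consider D' where "D = insert (p, q) D'" "lt D'" | D' where "D = insert (q, p) D'" "gt D'"
        by blast
      then show "D \<in> orientation ?E ` config u B ?E"
      proof cases
        case 1
        then obtain h where "h \<in> ?X" "orientation E h = D'" "h p < h q" by (auto simp: lt_def)
        then show ?thesis using 1(1) o1[of h] c by (metis (mono_tags, lifting) image_eqI less_irrefl mem_Collect_eq)
      next
        case 2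
        then obtain h where "h \<in> ?X" "orientation E h = D'" "h q < h p" by (auto simp: gt_def)
        then show ?thesis using 2(1) o2[of h] c by (metis (mono_tags, lifting) image_eqI less_irrefl mem_Collect_eq)
      qed
    qed
  qed
  have "region_sum u B W ?E = (\<Sum>D\<in>insert (p, q) ` {D \<in> R. lt D}. \<Prod>i\<in>W. vertex_weight D i) + (\<Sum>D\<in>insert (q, p) ` {D \<in> R. gt D}. \<Prod>i\<in>W. vertex_weight D i)"
    unfolding region_sum_def lt_set
  proof (rule sum.union_disjoint)
    have "insert (p, q) D \<noteq> insert (q, p) D'" if "D' \<in> R" for D D'
      using pqD[OF that] pq(3) by blast
    then show "insert (p, q) ` {D \<in> R. lt D} \<inter> insert (q, p) ` {D \<in> R. gt D} = {}" by blast
  qed (use finR in auto)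
  also have "(\<Sum>D\<in>insert (p, q) ` {D \<in> R. lt D}. \<Prod>i\<in>W. vertex_weight D i) = (\<Sum>D\<in>R. of_bool (lt D) * (\<Prod>i\<in>W. vertex_weight (insert (p, q) D) i))"
  proof -
    have "inj_on (insert (p, q)) {D \<in> R. lt D}" using pqD by (intro inj_onI) (metis (lifting) insert_ident mem_Collect_eq)
    then show ?thesis by (rule sum_image_filter[OF finR])
  qed
  also have "(\<Sum>D\<in>insert (q, p) ` {D \<in> R. gt D}. \<Prod>i\<in>W. vertex_weight D i) = (\<Sum>D\<in>R. of_bool (gt D) * (\<Prod>i\<in>W. vertex_weight (insert (q, p) D) i))"
  proof -
    have "inj_on (insert (q, p)) {D \<in> R. gt D}" using pqD by (intro inj_onI) (metis (lifting) insert_ident mem_Collect_eq)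
    then show ?thesis by (rule sum_image_filter[OF finR])
  qed
  also have "(\<Sum>D\<in>R. of_bool (lt D) * (\<Prod>i\<in>W. vertex_weight (insert (p, q) D) i)) + (\<Sum>D\<in>R. of_bool (gt D) * (\<Prod>i\<in>W. vertex_weight (insert (q, p) D) i))
     = (\<Sum>D\<in>R. (\<Prod>i\<in>W. vertex_weight D i) + of_bool (tie D) * (\<Prod>i\<in>W - {p}. vertex_weight (mp D) i))"
    unfolding sum.distrib[symmetric] by (rule sum.cong) (auto simp: key)
  also have "\<dots> = region_sum u B W E + (\<Sum>D\<in>R. of_bool (tie D) * (\<Prod>i\<in>W - {p}. vertex_weight (mp D) i))"
    by (simp add: sum.distrib region_sum_def R_def)
  also have "(\<Sum>D\<in>R. of_bool (tie D) * (\<Prod>i\<in>W - {p}. vertex_weight (mp D) i)) = region_sum u B (W - {p}) ?E'"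
  proof -
    have E'1: "{g x, g y} \<in> ?E'" if "{x, y} \<in> E" for x y
      using imageI[OF that, of "(`) g"] by simp
    have E'2: "\<exists>x' y'. {x', y'} \<in> E \<and> x = g x' \<and> y = g y'" if "{x, y} \<in> ?E'" for x y
      by (rule contracted_edge[OF E(2) that])
    have gp: "g x \<noteq> p" for x using pq(3) by (auto simp: g_def)
    have hg: "h (g x) = h x" if "h p = h q" for h :: "'v \<Rightarrow> real" and x using that by (auto simp: g_def)
    have orientation': "orientation ?E' h = mp (orientation E h)" if h: "h p = h q" for h
    proof (intro equalityI subsetI)
      fix z assume "z \<in> orientation ?E' h"
      then obtain x y where z: "z = (x, y)" "{x, y} \<in> ?E'" "h x < h y" by (auto simp: orientation_def)
      then show "z \<in> mp (orientation E h)" using E'2[OF z(2)] hg[OF h] by (force simp: mp_def orientation_iff)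
    next
      fix z assume "z \<in> mp (orientation E h)"
      then show "z \<in> orientation ?E' h" using E'1 hg[OF h] by (auto simp: mp_def orientation_def)
    qed
    have config': "h \<in> config u B ?E' \<longleftrightarrow> h \<in> ?X" if h: "h p = h q" for h
    proof -
      have "(\<forall>x y. {x, y} \<in> ?E' \<longrightarrow> h x \<noteq> h y) \<longleftrightarrow> (\<forall>x y. {x, y} \<in> E \<longrightarrow> h x \<noteq> h y)"
        using E'1 E'2 hg[OF h] by metis
      then show ?thesis by (simp add: config_def)
    qed
    have "orientation ?E' ` config u B ?E' = mp ` {D \<in> R. tie D}"
    proof (intro equalityI subsetI)
      fix D assume "D \<in> orientation ?E' ` config u B ?E'"
      then obtain h where h: "h \<in> config u B ?E'" "D = orientation ?E' h" by auto
      \<comment> \<open>After the contraction \<open>p\<close> lies on no edge, so its value can be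
        reset to that of \<open>q\<close>, which puts the point on the wall.\<close>
      let ?h = "h(p := h q)"
      have hq: "?h p = ?h q" using pq(3) by simp
      have pE: "{p, y} \<notin> ?E'" "{y, p} \<notin> ?E'" for y using E'2 gp by metis+
      have eqv: "?h x = h x \<and> ?h y = h y" if "{x, y} \<in> ?E'" for x y
      proof -
        have "x \<noteq> p" "y \<noteq> p" using that pE by blast+
        then show ?thesis by simp
      qed
      have "(x, y) \<in> orientation ?E' ?h \<longleftrightarrow> (x, y) \<in> orientation ?E' h" for x y
        unfolding orientation_iff using eqv[of x y] by argo
      then have "orientation ?E' ?h = D" unfolding h(2) set_eq_iff split_paired_All by blast
      moreover have "?h \<in> config u B ?E'" unfolding config_def
      proof (intro CollectI conjI allI impI)
        show "\<forall>b\<in>B. ?h b = u b" using h(1) pB by (auto simp: config_def)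
        show "?h x \<noteq> ?h y" if "{x, y} \<in> ?E'" for x y
        proof -
          have "h x \<noteq> h y" using h(1) that unfolding config_def by blast
          then show ?thesis using eqv[OF that] by argo
        qed
      qed
      ultimately have "?h \<in> ?X" "D = mp (orientation E ?h)"
        by (simp_all only: config'[OF hq, symmetric] orientation'[OF hq, symmetric])
      then show "D \<in> mp ` {D \<in> R. tie D}" unfolding R_def tie_def using hq by blast
    next
      fix D assume "D \<in> mp ` {D \<in> R. tie D}"
      then obtain h where h: "h \<in> ?X" "h p = h q" "D = mp (orientation E h)" by (auto simp: tie_def)
      then show "D \<in> orientation ?E' ` config u B ?E'" using config'[OF h(2)] orientation'[OF h(2)] by auto
    qed
    moreover have "inj_on mp {D \<in> R. tie D}"
    proof -
      \<comment> \<open>On the wall an edge of E and its image are oriented alike, so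
        \<open>D\<close> can be read off from \<open>mp D\<close>.\<close>
      have *: "D = {(x, y). {x, y} \<in> E \<and> (g x, g y) \<in> mp D}" if "tie D" for D
      proof -
        obtain h where h: "h p = h q" "D = orientation E h" using \<open>tie D\<close> by (auto simp: tie_def)
        show ?thesis unfolding h(2) orientation'[OF h(1), symmetric] using E'1 hg[OF h(1)] by (auto simp: orientation_def)
      qed
      show ?thesis
      proof (rule inj_onI)
        fix D D' assume "D \<in> {D \<in> R. tie D}" "D' \<in> {D \<in> R. tie D}" "mp D = mp D'"
        then show "D = D'" using *[of D] *[of D'] by simp
      qed
    qed
    ultimately show ?thesis unfolding region_sum_def by (simp add: sum_image_filter[OF finR])
  qed
  finally show ?thesis .
qed


section \<open>Extensions of a colouring of B, and the beta invariant\<close>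

definition colouring_extensions :: "'v set \<Rightarrow> 'v set \<Rightarrow> 'v set set \<Rightarrow> ('v \<Rightarrow> nat) \<Rightarrow> nat \<Rightarrow> ('v \<Rightarrow> nat) set" where
  "colouring_extensions W B E \<kappa> k = {f \<in> W \<rightarrow>\<^sub>E {..<k}. \<forall>x y. {x, y} \<in> E \<longrightarrow> override_on f \<kappa> B x \<noteq> override_on f \<kappa> B y}"

lemma card_colouring_extensions_deletion_contraction:
  fixes E :: "'v set set"
  assumes W: "finite W" "W \<inter> B = {}" and E: "\<And>e. e \<in> E \<Longrightarrow> \<exists>x y. e = {x, y}" "\<Union>E \<subseteq> W \<union> B"
    and pq: "p \<in> W" "q \<in> W \<union> B" "p \<noteq> q" "{p, q} \<notin> E" and \<kappa>: "\<kappa> ` B \<subseteq> {..<k}"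
  defines "g \<equiv> (\<lambda>x. if x = p then q else x)"
  shows "int (card (colouring_extensions W B (insert {p, q} E) \<kappa> k)) =
    int (card (colouring_extensions W B E \<kappa> k)) - int (card (colouring_extensions (W - {p}) B ((`) g ` E) \<kappa> k))"
proof -
  let ?F = "\<lambda>f. override_on f \<kappa> B"
  let ?E' = "(`) g ` E" and ?A = "colouring_extensions W B E \<kappa> k"
  let ?D = "{f \<in> ?A. ?F f p = ?F f q}"
  have pB: "p \<notin> B" using pq W by auto
  have fin: "finite ?A" unfolding colouring_extensions_def using W(1) by (auto simp: finite_PiE)
  have E'1: "{g x, g y} \<in> ?E'" if "{x, y} \<in> E" for x y
    using imageI[OF that, of "(`) g"] by simp
  have E'2: "\<exists>x' y'. {x', y'} \<in> E \<and> x = g x' \<and> y = g y'" if "{x, y} \<in> ?E'" for x y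
    by (rule contracted_edge[OF E(1) that])
  have proper': "(\<forall>x y. {x, y} \<in> ?E' \<longrightarrow> h x \<noteq> h y) \<longleftrightarrow> (\<forall>x y. {x, y} \<in> E \<longrightarrow> h (g x) \<noteq> h (g y))"
    for h :: "'v \<Rightarrow> nat" using E'1 E'2 by metis
  have EV: "x \<in> W \<union> B" "y \<in> W \<union> B" if "{x, y} \<in> E" for x y using that E(2) by auto
  have "bij_betw (\<lambda>f. restrict f (W - {p})) ?D (colouring_extensions (W - {p}) B ?E' \<kappa> k)"
  proof (rule bij_betw_byWitness[where f' = "\<lambda>f. f(p := ?F f q)"])
    show "\<forall>f\<in>?D. (restrict f (W - {p}))(p := ?F (restrict f (W - {p})) q) = f"
      using pq pB by (auto simp: colouring_extensions_def fun_eq_iff PiE_def extensional_def override_on_def)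
    show "\<forall>f\<in>colouring_extensions (W - {p}) B ?E' \<kappa> k. restrict (f(p := ?F f q)) (W - {p}) = f"
      using pq by (auto simp: colouring_extensions_def fun_eq_iff restrict_def PiE_def extensional_def)
    show "(\<lambda>f. restrict f (W - {p})) ` ?D \<subseteq> colouring_extensions (W - {p}) B ?E' \<kappa> k"
    proof safe
      fix f assume f: "f \<in> ?A" "?F f p = ?F f q"
      have "?F (restrict f (W - {p})) (g x) = ?F f x" if "x \<in> W \<union> B" for x
        using that f(2) pB pq by (auto simp: g_def override_on_def split: if_splits)
      then have "\<forall>x y. {x, y} \<in> E \<longrightarrow> ?F (restrict f (W - {p})) (g x) \<noteq> ?F (restrict f (W - {p})) (g y)"
        using f(1) EV by (simp add: colouring_extensions_def)
      then show "restrict f (W - {p}) \<in> colouring_extensions (W - {p}) B ?E' \<kappa> k"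
        using f(1) unfolding colouring_extensions_def mem_Collect_eq proper' by auto
    qed
    show "(\<lambda>f. f(p := ?F f q)) ` colouring_extensions (W - {p}) B ?E' \<kappa> k \<subseteq> ?D"
    proof safe
      fix f assume f: "f \<in> colouring_extensions (W - {p}) B ?E' \<kappa> k"
      have Fg: "?F (f(p := ?F f q)) x = ?F f (g x)" for x
        using pB pq by (auto simp: g_def override_on_def)
      \<comment> \<open>If \<open>q\<close> lies in B, then \<open>p\<close> receives the colour of
        \<open>q\<close> under \<kappa>, and the bound on \<kappa> makes it one of the k
        colours.\<close>
      have "f(p := ?F f q) \<in> W \<rightarrow>\<^sub>E {..<k}"
        using f pq \<kappa> by (auto simp: colouring_extensions_def PiE_def extensional_def Pi_def override_on_def)
      then show "f(p := ?F f q) \<in> ?A"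
        using f unfolding colouring_extensions_def mem_Collect_eq proper' Fg by blast
      show "?F (f(p := ?F f q)) p = ?F (f(p := ?F f q)) q" unfolding Fg using pq by (simp add: g_def)
    qed
  qed
  then have D: "card ?D = card (colouring_extensions (W - {p}) B ?E' \<kappa> k)" by (rule bij_betw_same_card)
  have "colouring_extensions W B (insert {p, q} E) \<kappa> k = ?A - ?D"
    by (auto simp: colouring_extensions_def doubleton_eq_iff)
  moreover have "card (?A - ?D) = card ?A - card ?D" by (rule card_Diff_subset) (use fin in auto)
  moreover have "card ?D \<le> card ?A" by (rule card_mono) (use fin in auto)
  ultimately show ?thesis using D by (simp add: of_nat_diff)
qed

text \<open>Both quantities obey deletion-contraction: the sign (-1) ^ card W turns the minus of the
  colourings into the plus of the regions. A loop makes both 0. The recursion ends when all edges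
  lie in B: then an injective \<kappa> extends arbitrarily, Q is the monomial of degree card W, and
  every interior vertex is isolated with weight -1. One Q has to serve all injective \<kappa>,
  because the chromatic count sums over them.\<close>

lemma region_sum_polynomial:
  fixes E :: "'v set set"
  assumes "finite W" "finite B" "W \<inter> B = {}" "finite E" "\<And>e. e \<in> E \<Longrightarrow> \<exists>x y. e = {x, y}"
    "\<Union>E \<subseteq> W \<union> B" "inj_on u B"
  shows "\<exists>Q :: int poly. (\<forall>\<kappa> k. inj_on \<kappa> B \<longrightarrow> \<kappa> ` B \<subseteq> {..<k} \<longrightarrow>
      poly Q (int k) = int (card (colouring_extensions W B E \<kappa> k))) \<and> (-1) ^ card W * poly Q 1 = region_sum u B W E"
  using assms(1,3-6)
proof (induction "card E" arbitrary: W E rule: less_induct)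
  case less
  consider x where "{x} \<in> E" | p q where "{p, q} \<in> E" "p \<in> W" "p \<noteq> q"
    | "\<Union>E \<subseteq> B" "\<And>x. {x} \<notin> E"
  proof -
    assume *: "\<And>x. {x} \<in> E \<Longrightarrow> thesis" "\<And>p q. {p, q} \<in> E \<Longrightarrow> p \<in> W \<Longrightarrow> p \<noteq> q \<Longrightarrow> thesis"
      "\<Union>E \<subseteq> B \<Longrightarrow> (\<And>x. {x} \<notin> E) \<Longrightarrow> thesis"
    show thesis
    proof (cases "\<exists>x. {x} \<in> E")
      case False
      have "\<Union>E \<subseteq> B" if no: "\<nexists>p q. {p, q} \<in> E \<and> p \<in> W \<and> p \<noteq> q"
      proof
        fix x assume "x \<in> \<Union>E"
        then obtain e where e: "e \<in> E" "x \<in> e" by blast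
        obtain a b where ab: "e = {a, b}" using less.prems(4)[OF e(1)] by blast
        have "a \<noteq> b" using ab e(1) False by auto
        moreover have "{b, a} \<in> E" using e(1) ab by (simp add: insert_commute)
        ultimately have "a \<notin> W" "b \<notin> W" using no e(1) ab by blast+
        then show "x \<in> B" using e ab less.prems(5) by blast
      qed
      then show thesis
        using *(2) *(3)[OF _ False[unfolded not_ex, rule_format]] by (cases "\<exists>p q. {p, q} \<in> E \<and> p \<in> W \<and> p \<noteq> q") blast+
    qed (use *(1) in blast)
  qed
  then show ?case
  proof cases
    case (1 x)
    then have xx: "{x, x} \<in> E" by simp
    have "config u B E = {}" using xx unfolding config_def by blast
    moreover have "colouring_extensions W B E \<kappa> k = {}" for \<kappa> k using xx unfolding colouring_extensions_def by blast
    ultimately show ?thesis by (intro exI[of _ 0]) (simp add: region_sum_def)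
  next
    case (2 p q)
    define E' where "E' = E - {{p, q}}"
    define g where "g x = (if x = p then q else x)" for x
    have E: "E = insert {p, q} E'" and pqE': "{p, q} \<notin> E'" using 2 by (auto simp: E'_def)
    have fE': "finite E'" using less.prems(3) by (simp add: E'_def)
    have cE: "card E' < card E" using less.prems(3) 2 unfolding E'_def by (intro psubset_card_mono) auto
    have cE'': "card ((`) g ` E') < card E" using card_image_le[OF fE', of "(`) g"] cE by simp
    have pairs: "\<exists>x y. e = {x, y}" if "e \<in> E'" for e using that less.prems(4) by (auto simp: E'_def)
    have pairs'': "\<exists>x y. e = {x, y}" if e: "e \<in> (`) g ` E'" for e
    proof -
      obtain d where d: "d \<in> E'" "e = g ` d" using e by blast
      obtain x y where "d = {x, y}" using pairs[OF d(1)] by blast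
      then have "e = {g x, g y}" using d(2) by simp
      then show ?thesis by blast
    qed
    have UE': "\<Union>E' \<subseteq> W \<union> B" using less.prems(5) by (auto simp: E'_def)
    have q: "q \<in> W \<union> B" using less.prems(5) 2 by auto
    have UE'': "\<Union>((`) g ` E') \<subseteq> (W - {p}) \<union> B"
      using UE' q 2 less.prems(2) by (auto simp: g_def)
    obtain Q1 :: "int poly" where Q1: "\<And>\<kappa> k. inj_on \<kappa> B \<Longrightarrow> \<kappa> ` B \<subseteq> {..<k} \<Longrightarrow>
      poly Q1 (int k) = int (card (colouring_extensions W B E' \<kappa> k))" "(-1) ^ card W * poly Q1 1 = region_sum u B W E'"
      using less.hyps[OF cE less.prems(1,2) fE' pairs UE'] by blast
    have "finite (W - {p})" "(W - {p}) \<inter> B = {}" using less.prems by auto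
    then obtain Q2 :: "int poly" where Q2: "\<And>\<kappa> k. inj_on \<kappa> B \<Longrightarrow> \<kappa> ` B \<subseteq> {..<k} \<Longrightarrow>
      poly Q2 (int k) = int (card (colouring_extensions (W - {p}) B ((`) g ` E') \<kappa> k))"
      "(-1) ^ card (W - {p}) * poly Q2 1 = region_sum u B (W - {p}) ((`) g ` E')"
      using less.hyps[OF cE'' _ _ finite_imageI[OF fE'] pairs'' UE''] by blast
    have g: "g = (\<lambda>x. if x = p then q else x)" by (simp add: g_def fun_eq_iff)
    have "card W = Suc (card (W - {p}))" using less.prems(1) 2 by (metis card.remove)
    then have "(-1) ^ card W * poly (Q1 - Q2) 1 = region_sum u B W E"
      using Q1(2) Q2(2) region_sum_deletion_contraction[OF less.prems(1,2) fE' pairs 2(2) q 2(3) pqE', of u]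
      unfolding E g by (simp add: algebra_simps)
    moreover have "poly (Q1 - Q2) (int k) = int (card (colouring_extensions W B E \<kappa> k))"
      if "inj_on \<kappa> B" "\<kappa> ` B \<subseteq> {..<k}" for \<kappa> k
      using Q1(1)[OF that] Q2(1)[OF that]
        card_colouring_extensions_deletion_contraction[OF less.prems(1,2) pairs UE' 2(2) q 2(3) pqE' that(2)]
      unfolding E g by simp
    ultimately show ?thesis by blast
  next
    case 3
    have inB: "x \<in> B" "y \<in> B" "x \<noteq> y" if "{x, y} \<in> E" for x y
    proof -
      show "x \<in> B" "y \<in> B" using that 3(1) by blast+
      show "x \<noteq> y" using that 3(2)[of x] by auto
    qed
    have orientation: "orientation E h = orientation E u" if "h \<in> config u B E" for h
      using that inB by (auto simp: orientation_def config_def)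
    have "u \<in> config u B E" using inB inj_onD[OF assms(7)] by (force simp: config_def)
    then have "orientation E ` config u B E = {orientation E u}" using orientation by blast
    moreover have "vertex_weight (orientation E u) i = -1" if "i \<in> W" for i
      using that inB less.prems(2) by (auto simp: vertex_weight_def orientation_def)
    ultimately have "region_sum u B W E = (-1) ^ card W" by (simp add: region_sum_def)
    moreover have "colouring_extensions W B E \<kappa> k = W \<rightarrow>\<^sub>E {..<k}" if \<kappa>: "inj_on \<kappa> B" for \<kappa> k
    proof -
      have "override_on f \<kappa> B x \<noteq> override_on f \<kappa> B y" if "{x, y} \<in> E" for f x y
        using inB[OF that] inj_onD[OF \<kappa>, of x y] by (auto simp: override_on_def)
      then show ?thesis by (auto simp: colouring_extensions_def)
    qed
    ultimately show ?thesis using less.prems(1)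
      by (intro exI[of _ "monom 1 (card W)"]) (simp add: poly_monom card_funcsetE)
  qed
qed

lemma card_inj_PiE:
  assumes "finite B"
  shows "int (card {f \<in> B \<rightarrow>\<^sub>E {..<k::nat}. inj_on f B}) = (\<Prod>j<card B. int k - int j)"
proof -
  have *: "card {f \<in> B \<rightarrow>\<^sub>E {..<k}. inj_on f B} = (\<Prod>j<card B. k - j)"
    using card_inj_on_subset_funcset[of B "{..<k}" B] assms by (simp add: lessThan_atLeast0)
  show ?thesis
  proof (cases "card B \<le> k")
    case True
    then show ?thesis unfolding * by (simp add: of_nat_diff)
  next
    \<comment> \<open>Natural and integer subtraction differ here, but both products contain the
      factor with j = k, which is 0.\<close>
    case False
    then have "(\<Prod>j<card B. k - j) = 0" "(\<Prod>j<card B. int k - int j) = 0" by auto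
    then show ?thesis unfolding * by (simp only: of_nat_0)
  qed
qed

lemma beta_invariant_regions:
  fixes V B :: "'v set"
  assumes G: "simple_graph V E" and B: "B \<subseteq> V" "card B \<ge> 2" and BE: "\<forall>x\<in>B. \<forall>y\<in>B. {x, y} \<notin> E"
    and u: "inj_on u B"
  shows "beta_invariant V (E \<union> complete_on B) = fact (card B - 2) * \<bar>region_sum u B (V - B) E\<bar>"
proof -
  let ?W = "V - B" and ?E = "E \<union> complete_on B"
  define m where "m = card B"
  have V: "finite V" and E: "\<And>e. e \<in> E \<Longrightarrow> e \<subseteq> V \<and> card e = 2" using G by (auto simp: simple_graph_def)
  have fB: "finite B" using B V finite_subset by blast
  have fE: "finite E" using V E by (meson finite_Pow_iff finite_subset PowI subsetI)
  have pairs: "\<exists>x y. e = {x, y}" if "e \<in> E" for e using E[OF that] by (auto simp: card_2_iff)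
  have G': "simple_graph V ?E" using G B by (auto simp: simple_graph_def complete_on_def)
  have Diff_disjoint': "?W \<inter> B = {}" by blast
  have "\<Union>E \<subseteq> ?W \<union> B" using E by blast
  then obtain Q :: "int poly" where Q: "\<And>\<kappa> k. inj_on \<kappa> B \<Longrightarrow> \<kappa> ` B \<subseteq> {..<k} \<Longrightarrow>
      poly Q (int k) = int (card (colouring_extensions ?W B E \<kappa> k))" "(-1) ^ card ?W * poly Q 1 = region_sum u B ?W E"
    using region_sum_polynomial[OF finite_Diff[OF V] fB Diff_disjoint' fE pairs _ u] by blast
  define P where "P = (\<Prod>j<m. [:- int j, 1:])"
  have "poly (chromatic_poly V ?E) (int k) = poly (P * Q) (int k)" for k
  proof -
    let ?I = "{f \<in> B \<rightarrow>\<^sub>E {..<k::nat}. inj_on f B}"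
    have "bij_betw (\<lambda>(\<kappa>, f). override_on f \<kappa> B) (SIGMA \<kappa>:?I. colouring_extensions ?W B E \<kappa> k) (colourings V ?E k)"
    proof (rule bij_betw_byWitness[where f' = "\<lambda>f. (restrict f B, restrict f ?W)"])
      have "restrict (override_on f \<kappa> B) B = \<kappa>" "restrict (override_on f \<kappa> B) ?W = f"
        if "\<kappa> \<in> B \<rightarrow>\<^sub>E {..<k}" "f \<in> ?W \<rightarrow>\<^sub>E {..<k}" for \<kappa> f
        using that by (auto simp: fun_eq_iff PiE_def extensional_def override_on_def)
      then show "\<forall>z\<in>SIGMA \<kappa>:?I. colouring_extensions ?W B E \<kappa> k. (restrict ((\<lambda>(\<kappa>, f). override_on f \<kappa> B) z) B,
          restrict ((\<lambda>(\<kappa>, f). override_on f \<kappa> B) z) ?W) = z"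
        by (auto simp: colouring_extensions_def)
      have ov: "override_on (restrict f ?W) (restrict f B) B = f" if "f \<in> V \<rightarrow>\<^sub>E {..<k}" for f
        using that B by (auto simp: fun_eq_iff PiE_def extensional_def override_on_def)
      then show "\<forall>f\<in>colourings V ?E k. (\<lambda>(\<kappa>, f). override_on f \<kappa> B) (restrict f B, restrict f ?W) = f"
        by (auto simp: colourings_def)
      show "(\<lambda>(\<kappa>, f). override_on f \<kappa> B) ` (SIGMA \<kappa>:?I. colouring_extensions ?W B E \<kappa> k) \<subseteq> colourings V ?E k"
      proof safe
        fix \<kappa> f assume \<kappa>: "\<kappa> \<in> B \<rightarrow>\<^sub>E {..<k}" "inj_on \<kappa> B" and f: "f \<in> colouring_extensions ?W B E \<kappa> k"
        have "override_on f \<kappa> B \<in> V \<rightarrow>\<^sub>E {..<k}"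
          using \<kappa> f B by (auto simp: colouring_extensions_def PiE_def extensional_def Pi_def override_on_def)
        moreover have "override_on f \<kappa> B x \<noteq> override_on f \<kappa> B y" if "{x, y} \<in> ?E" for x y
        proof (cases "{x, y} \<in> E")
          case False
          then have "x \<in> B" "y \<in> B" "x \<noteq> y" using that by (auto simp: complete_on_def doubleton_eq_iff)
          then show ?thesis using inj_onD[OF \<kappa>(2), of x y] by (auto simp: override_on_def)
        qed (use f in \<open>simp add: colouring_extensions_def\<close>)
        ultimately show "override_on f \<kappa> B \<in> colourings V ?E k" by (simp add: colourings_def)
      qed
      show "(\<lambda>f. (restrict f B, restrict f ?W)) ` colourings V ?E k \<subseteq> (SIGMA \<kappa>:?I. colouring_extensions ?W B E \<kappa> k)"
      proof (rule image_subsetI)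
        fix f assume f: "f \<in> colourings V ?E k"
        then have f1: "f \<in> V \<rightarrow>\<^sub>E {..<k}" and f2: "\<And>x y. {x, y} \<in> ?E \<Longrightarrow> f x \<noteq> f y"
          by (auto simp: colourings_def)
        have r1: "restrict f B \<in> B \<rightarrow>\<^sub>E {..<k}" using f1 B by auto
        have r2: "inj_on (restrict f B) B"
        proof (rule inj_onI)
          fix x y assume xy: "x \<in> B" "y \<in> B" "restrict f B x = restrict f B y"
          show "x = y"
          proof (rule ccontr)
            assume "x \<noteq> y"
            then have "{x, y} \<in> ?E" using xy by (auto simp: complete_on_def)
            then show False using f2[of x y] xy by simp
          qed
        qed
        have r3: "restrict f ?W \<in> colouring_extensions ?W B E (restrict f B) k"
          unfolding colouring_extensions_def mem_Collect_eq ov[OF f1] using f1 f2 by auto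
        show "(restrict f B, restrict f ?W) \<in> (SIGMA \<kappa>:?I. colouring_extensions ?W B E \<kappa> k)"
          by (intro SigmaI CollectI conjI r1 r2 r3)
      qed
    qed
    then have "card (colourings V ?E k) = card (SIGMA \<kappa>:?I. colouring_extensions ?W B E \<kappa> k)"
      by (rule bij_betw_same_card[symmetric])
    also have "\<dots> = (\<Sum>\<kappa>\<in>?I. card (colouring_extensions ?W B E \<kappa> k))"
      using V fB by (intro card_SigmaI) (auto simp: finite_PiE colouring_extensions_def)
    finally have "int (card (colourings V ?E k)) = (\<Sum>\<kappa>\<in>?I. int (card (colouring_extensions ?W B E \<kappa> k)))" by simp
    also have "\<dots> = (\<Sum>\<kappa>\<in>?I. poly Q (int k))"
    proof (rule sum.cong[OF refl])
      fix \<kappa> assume "\<kappa> \<in> ?I"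
      then have "inj_on \<kappa> B" "\<kappa> ` B \<subseteq> {..<k}" by blast+
      then show "int (card (colouring_extensions ?W B E \<kappa> k)) = poly Q (int k)" by (rule Q(1)[symmetric])
    qed
    also have "\<dots> = poly P (int k) * poly Q (int k)"
    proof -
      have "poly P (int k) = int (card ?I)" unfolding card_inj_PiE[OF fB] by (simp add: P_def poly_prod m_def)
      then show ?thesis by (simp only: sum_constant of_nat_id)
    qed
    finally show ?thesis using poly_chromatic_poly[OF G', of k] by simp
  qed
  then have \<chi>: "chromatic_poly V ?E = P * Q" by (rule chromatic_poly_unique)
  \<comment> \<open>The factor with j = 1 vanishes at 1, so among the terms of the product rule only
    the one that differentiates this factor survives there.\<close>
  define P' where "P' = (\<Prod>j\<in>{..<m} - {1}. [:- int j, 1:])"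
  have P: "P = [:-1, 1:] * P'"
    unfolding P_def P'_def using B by (subst prod.remove[of _ 1]) (auto simp: m_def)
  have "poly (pderiv (chromatic_poly V ?E)) 1 = poly P' 1 * poly Q 1"
  proof -
    have "pderiv ([:-1, 1:] * (P' * Q)) = [:-1, 1:] * pderiv (P' * Q) + P' * Q * pderiv [:-1, 1:]"
      by (rule pderiv_mult)
    then have "poly (pderiv ([:-1, 1:] * (P' * Q))) 1 = poly P' 1 * poly Q 1"
      by (simp only: poly_add poly_mult) (simp add: pderiv_pCons)
    then show ?thesis unfolding \<chi> P by (simp only: mult.assoc)
  qed
  moreover have "\<bar>poly P' 1\<bar> = fact (m - 2)"
  proof -
    have "\<bar>poly P' 1\<bar> = (\<Prod>j\<in>{..<m} - {1}. \<bar>1 - int j\<bar>)" by (simp add: P'_def poly_prod abs_prod)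
    \<comment> \<open>The factor with j = 0 is 1, and the factor with j = i + 1 has absolute value
      i; together they give the factorial.\<close>
    also have "\<dots> = (\<Prod>j\<in>insert 0 ((\<lambda>i. i + 1) ` {1..m - 2}). \<bar>1 - int j\<bar>)"
    proof (rule prod.cong)
      have "j \<in> insert 0 ((\<lambda>i. i + 1) ` {1..m - 2})" if "j < m" "j \<noteq> 1" for j
      proof (cases j)
        case (Suc i)
        then have "i \<in> {1..m - 2}" using that by auto
        then show ?thesis using Suc by auto
      qed simp
      then show "{..<m} - {1} = insert 0 ((\<lambda>i. i + 1) ` {1..m - 2})" using B by (auto simp: m_def)
    qed simp
    also have "\<dots> = (\<Prod>j\<in>(\<lambda>i. i + 1) ` {1..m - 2}. \<bar>1 - int j\<bar>)"
      by (subst prod.insert) auto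
    also have "\<dots> = (\<Prod>i = 1..m - 2. \<bar>1 - int (i + 1)\<bar>)"
      by (subst prod.reindex) (auto intro: inj_onI)
    also have "\<dots> = (\<Prod>i = 1..m - 2. int i)" by (rule prod.cong) auto
    also have "\<dots> = fact (m - 2)" by (simp add: fact_prod)
    finally show ?thesis .
  qed
  moreover have "\<bar>poly Q 1\<bar> = \<bar>region_sum u B ?W E\<bar>"
    unfolding Q(2)[symmetric] by (simp add: abs_mult power_abs)
  ultimately show ?thesis by (simp add: beta_invariant_def abs_mult m_def)
qed

section \<open>Generic constancy of the number of solutions\<close>

text \<open>
  A formula for \<open>(h i - h j) * (k i - k j)\<close> that makes sense for the unordered pair \<open>e = {i, j}\<close>.
\<close>

definition edge_prod :: "('v \<Rightarrow> 'a::comm_ring_1) \<Rightarrow> ('v \<Rightarrow> 'a) \<Rightarrow> 'v set \<Rightarrow> 'a" where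
  "edge_prod h k e = 2 * (\<Sum>i\<in>e. h i * k i) - (\<Sum>i\<in>e. h i) * (\<Sum>i\<in>e. k i)"

lemma edge_prod_pair: "i \<noteq> j \<Longrightarrow> edge_prod h k {i, j} = (h i - h j) * (k i - k j)"
  by (simp add: edge_prod_def algebra_simps)

lemma sum_delta_mult:
  fixes a :: "'a::semiring_0"
  assumes "finite S" "i \<in> S"
  shows "(\<Sum>k\<in>S. (if i = k then a else 0) * v k) = a * v i"
proof -
  have "(\<Sum>k\<in>S. (if i = k then a else 0) * v k) = (\<Sum>k\<in>S. if i = k then a * v k else 0)"
    by (rule sum.cong) auto
  then show ?thesis using assms by simp
qed

lemma tendsto_edge_prod:
  fixes h k :: "'v \<Rightarrow> 'a::real_normed_field"
  assumes "\<And>i. i \<in> e \<Longrightarrow> ((\<lambda>n. H n i) \<longlongrightarrow> h i) F" "\<And>i. i \<in> e \<Longrightarrow> ((\<lambda>n. K n i) \<longlongrightarrow> k i) F"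
  shows "((\<lambda>n. edge_prod (H n) (K n) e) \<longlongrightarrow> edge_prod h k e) F"
  unfolding edge_prod_def by (intro tendsto_intros assms)

lemma edge_prod_cong: "(\<And>i. i \<in> e \<Longrightarrow> h i = h' i) \<Longrightarrow> (\<And>i. i \<in> e \<Longrightarrow> k i = k' i) \<Longrightarrow> edge_prod h k e = edge_prod h' k' e"
  by (simp add: edge_prod_def)

locale dirichlet_problem =
  fixes V B :: "'v set" and E :: "'v set set" and u :: "'v \<Rightarrow> real"
  assumes graph: "simple_graph V E" and conn: "connected_graph V E"
    and BV: "B \<subset> V" and cardB: "card B \<ge> 2"
    and noBB: "\<forall>x\<in>B. \<forall>y\<in>B. {x, y} \<notin> E" and inju: "inj_on u B"
begin

abbreviation "W \<equiv> V - B"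
abbreviation "L \<equiv> laplacian V E"
abbreviation "nb \<equiv> neighbours V E"
abbreviation "Sol \<equiv> eps_harmonic_functions V E B u"

lemma finV: "finite V" and edge: "e \<in> E \<Longrightarrow> e \<subseteq> V \<and> card e = 2"
  using graph by (auto simp: simple_graph_def)

lemma finW: "finite W"
  using finV by simp

lemma finE: "finite E"
  using finV edge by (meson PowI finite_Pow_iff finite_subset subsetI)

lemma edgeE:
  assumes "e \<in> E"
  obtains i j where "e = {i, j}" "i \<noteq> j" "i \<in> V" "j \<in> V"
  using edge[OF assms] by (auto simp: card_2_iff)

lemma edge_neq: "{i, j} \<in> E \<Longrightarrow> i \<noteq> j"
  using edge[of "{i, j}"] by auto

lemma nb: "j \<in> nb i \<longleftrightarrow> {i, j} \<in> E"
  using edge[of "{i, j}"] by (auto simp: neighbours_def)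

lemma fin_nb: "finite (nb i)"
  using finV by (simp add: neighbours_def)

lemma edge_prod_edge: "{i, j} \<in> E \<Longrightarrow> edge_prod h k {i, j} = (h i - h j) * (k i - k j)"
  by (rule edge_prod_pair) (rule edge_neq)

lemma harmonic_the_harmonic:
  assumes "generic_weights V E B c"
  shows "harmonic V E B u c h \<longleftrightarrow> h = the_harmonic V E B u c"
  using ex1_harmonic[OF graph _ assms, of u] BV theI'[of "harmonic V E B u c"] unfolding the_harmonic_def by auto

text \<open>Trades the definite description for harmonicity, so that a solution can be handled as a
  pair of weights and function.\<close>

lemma Sol_iff:
  "h \<in> Sol \<epsilon> \<longleftrightarrow> (\<exists>c. generic_weights V E B c \<and> harmonic V E B u c h \<and> (\<forall>e\<in>E. c e * edge_prod h h e = \<epsilon> e))"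
proof -
  have "(\<forall>i j. {i, j} \<in> E \<longrightarrow> c {i, j} * (h i - h j)\<^sup>2 = \<epsilon> {i, j}) \<longleftrightarrow> (\<forall>e\<in>E. c e * edge_prod h h e = \<epsilon> e)"
    for c :: "'v set \<Rightarrow> complex"
  proof
    assume *: "\<forall>i j. {i, j} \<in> E \<longrightarrow> c {i, j} * (h i - h j)\<^sup>2 = \<epsilon> {i, j}"
    show "\<forall>e\<in>E. c e * edge_prod h h e = \<epsilon> e"
    proof
      fix e assume e: "e \<in> E"
      then obtain i j where ij: "e = {i, j}" by (rule edgeE)
      then have "edge_prod h h e = (h i - h j)\<^sup>2" using e by (simp add: edge_prod_edge power2_eq_square)
      then show "c e * edge_prod h h e = \<epsilon> e" using * ij e by metis
    qed
  next
    assume *: "\<forall>e\<in>E. c e * edge_prod h h e = \<epsilon> e"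
    then show "\<forall>i j. {i, j} \<in> E \<longrightarrow> c {i, j} * (h i - h j)\<^sup>2 = \<epsilon> {i, j}"
      using edge_prod_edge by (metis power2_eq_square)
  qed
  note eq = this
  have "h = the_harmonic V E B u c \<and> generic_weights V E B c \<and>
      (\<forall>i j. {i, j} \<in> E \<longrightarrow> c {i, j} * (the_harmonic V E B u c i - the_harmonic V E B u c j)\<^sup>2 = \<epsilon> {i, j})
    \<longleftrightarrow> generic_weights V E B c \<and> harmonic V E B u c h \<and> (\<forall>e\<in>E. c e * edge_prod h h e = \<epsilon> e)" for c
  proof (cases "generic_weights V E B c \<and> the_harmonic V E B u c = h")
    case True
    then show ?thesis using eq[of c] harmonic_the_harmonic[of c h] by simp
  next
    case False
    then show ?thesis using harmonic_the_harmonic[of c h] by blast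
  qed
  then show ?thesis unfolding eps_harmonic_functions_def by simp
qed

lemma laplacian_interior:
  assumes "\<And>b. b \<in> B \<Longrightarrow> d b = 0" "i \<in> V"
  shows "(\<Sum>j\<in>W. L c i j * d j) = (\<Sum>j\<in>nb i. c {i, j} * (d i - d j))"
proof -
  have "(\<Sum>j\<in>W. L c i j * d j) = (\<Sum>j\<in>V. L c i j * d j)"
    by (rule sum.mono_neutral_left) (use finV assms in auto)
  then show ?thesis using laplacian_sum[OF graph assms(2)] by simp
qed

lemma harmonic_system:
  assumes "harmonic V E B u c h" "i \<in> W"
  shows "(\<Sum>j\<in>W. L c i j * h j) = - (\<Sum>j\<in>B. L c i j * complex_of_real (u j))"
proof -
  have "(\<Sum>j\<in>V. L c i j * h j) = 0"
    using laplacian_sum[OF graph, of i c h] assms by (simp add: harmonic_def)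
  moreover have "(\<Sum>j\<in>V. L c i j * h j) = (\<Sum>j\<in>W. L c i j * h j) + (\<Sum>j\<in>B. L c i j * h j)"
    by (rule sum.subset_diff) (use BV finV in auto)
  moreover have "(\<Sum>j\<in>B. L c i j * h j) = (\<Sum>j\<in>B. L c i j * complex_of_real (u j))"
    using assms(1) by (simp add: harmonic_def)
  ultimately show ?thesis by (simp add: eq_neg_iff_add_eq_0)
qed

lemma polyfun_laplacian: "polyfun E 1 (\<lambda>c. L c i j)"
proof -
  have "polyfun E 1 (\<lambda>c. \<Sum>v\<in>nb i. c {i, v})"
    by (intro polyfun_sum polyfun_coord finE) (auto simp: nb)
  moreover have "polyfun E 1 (\<lambda>c. - c {i, j})" if "{i, j} \<in> E"
    using polyfun_scale[OF polyfun_coord[OF finE that, of 1], of "-1"] by simp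
  ultimately show ?thesis
    by (cases "i = j"; cases "{i, j} \<in> E") (simp_all add: laplacian_def polyfun_const[OF finE])
qed

text \<open>Cramer's rule for the interior system, with the boundary values moved to the right-hand
  side. The same \<Delta> tests for nonsingularity and is the denominator of every coordinate of
  h.\<close>

lemma ex_rational_solution:
  "\<exists>m \<Delta> N. polyfun E m \<Delta> \<and> (\<forall>i\<in>V. polyfun E m (N i)) \<and>
    (\<forall>c. nonsingular_on W (L c) \<longleftrightarrow> \<Delta> c \<noteq> 0) \<and>
    (\<forall>c. \<Delta> c = 0 \<longrightarrow> (\<exists>d. (\<exists>i\<in>W. d i \<noteq> 0) \<and> (\<forall>b\<in>B. d b = 0) \<and>
      (\<forall>i\<in>W. (\<Sum>j\<in>nb i. c {i, j} * (d i - d j)) = 0))) \<and>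
    (\<forall>c h. \<Delta> c \<noteq> 0 \<longrightarrow> harmonic V E B u c h \<longrightarrow> (\<forall>i\<in>V. h i = N i c / \<Delta> c))"
proof -
  from polyfun_adjugate[of E W 1 L, OF finE finW polyfun_laplacian]
  obtain d \<Delta> adj where p1: "polyfun E d \<Delta>" and p2: "\<forall>i\<in>W. \<forall>j\<in>W. polyfun E d (adj i j)"
    and prods: "\<forall>c. \<forall>i\<in>W. \<forall>k\<in>W. (\<Sum>j\<in>W. L c i j * adj j k c) = (if i = k then \<Delta> c else 0) \<and>
      (\<Sum>j\<in>W. adj i j c * L c j k) = (if i = k then \<Delta> c else 0)"
    and ker: "\<forall>c. \<Delta> c = 0 \<longrightarrow> (\<exists>v. (\<exists>i\<in>W. v i \<noteq> 0) \<and> (\<forall>i\<in>W. (\<Sum>j\<in>W. L c i j * v j) = 0))"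
    by (elim exE conjE)
  note p = p1 p2[rule_format]
  have prod: "(\<Sum>j\<in>W. L c i j * adj j k c) = (if i = k then \<Delta> c else 0)"
      "(\<Sum>j\<in>W. adj i j c * L c j k) = (if i = k then \<Delta> c else 0)" if "i \<in> W" "k \<in> W" for c i k
    using prods that by blast+
  define r where "r k c = - (\<Sum>j\<in>B. L c k j * complex_of_real (u j))" for k c
  \<comment> \<open>On B the numerator is chosen so that \<open>N i c / \<Delta> c\<close> is the
    boundary value; thus one formula covers all vertices.\<close>
  define N where "N i c = (if i \<in> B then complex_of_real (u i) * \<Delta> c else (\<Sum>k\<in>W. adj i k c * r k c))" for i c
  have pr: "polyfun E 1 (r k)" for k
  proof -
    have "polyfun E 1 (\<lambda>c. -1 * (\<Sum>j\<in>B. complex_of_real (u j) * L c k j))"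
      by (intro polyfun_scale polyfun_sum finE polyfun_laplacian)
    then show ?thesis by (rule polyfun_cong) (simp add: r_def mult.commute)
  qed
  have pN: "polyfun E (d + 1) (N i)" if i: "i \<in> V" for i
  proof (cases "i \<in> B")
    case True
    have "polyfun E (d + 1) (\<lambda>c. complex_of_real (u i) * \<Delta> c)"
      by (intro polyfun_scale) (rule polyfun_mono[OF p(1) _ finE], simp)
    then show ?thesis by (rule polyfun_cong) (simp add: N_def True)
  next
    case False
    have "polyfun E (d + 1) (\<lambda>c. \<Sum>k\<in>W. adj i k c * r k c)"
      using i False by (intro polyfun_sum finE polyfun_mult p(2) pr) auto
    then show ?thesis by (rule polyfun_cong) (simp add: N_def False)
  qed
  have p\<Delta>: "polyfun E (d + 1) \<Delta>" by (rule polyfun_mono[OF p(1) _ finE]) simp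
  have ns: "nonsingular_on W (L c) \<longleftrightarrow> \<Delta> c \<noteq> 0" for c
  proof
    assume "\<Delta> c \<noteq> 0"
    then show "nonsingular_on W (L c)" unfolding nonsingular_on_def using prod
      by (intro exI[of _ "\<lambda>i j. adj i j c / \<Delta> c"]) (simp add: sum_divide_distrib[symmetric])
  next
    assume "nonsingular_on W (L c)"
    then obtain M where M: "\<And>i k. i \<in> W \<Longrightarrow> k \<in> W \<Longrightarrow> (\<Sum>j\<in>W. M i j * L c j k) = (if i = k then 1 else 0)"
      unfolding nonsingular_on_def by blast
    show "\<Delta> c \<noteq> 0"
    proof
      assume "\<Delta> c = 0"
      from mp[OF spec[OF ker] this]
      obtain v where v: "\<exists>i\<in>W. v i \<noteq> 0" "\<forall>i\<in>W. (\<Sum>j\<in>W. L c i j * v j) = 0"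
        by (elim exE conjE)
      have "v i = 0" if i: "i \<in> W" for i
      proof -
        have "v i = (\<Sum>k\<in>W. (if i = k then 1 else 0) * v k)" using sum_delta_mult[OF finW i, of 1 v] by simp
        also have "\<dots> = (\<Sum>k\<in>W. (\<Sum>j\<in>W. M i j * L c j k) * v k)" by (rule sum.cong) (simp_all only: M[OF i])
        also have "\<dots> = (\<Sum>j\<in>W. M i j * (\<Sum>k\<in>W. L c j k * v k))"
          unfolding sum_distrib_right sum_distrib_left by (subst sum.swap) (simp add: mult.assoc)
        also have "\<dots> = 0" using v(2) by simp
        finally show ?thesis .
      qed
      then show False using v(1) by blast
    qed
  qed
  have kern: "\<exists>d. (\<exists>i\<in>W. d i \<noteq> 0) \<and> (\<forall>b\<in>B. d b = 0) \<and> (\<forall>i\<in>W. (\<Sum>j\<in>nb i. c {i, j} * (d i - d j)) = 0)"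
    if z: "\<Delta> c = 0" for c
  proof -
    obtain v where v: "\<exists>i\<in>W. v i \<noteq> 0" "\<forall>i\<in>W. (\<Sum>j\<in>W. L c i j * v j) = 0"
      using mp[OF spec[OF ker] z] by (elim exE conjE)
    define d where "d i = (if i \<in> B then 0 else v i)" for i
    have "(\<Sum>j\<in>nb i. c {i, j} * (d i - d j)) = 0" if i: "i \<in> W" for i
    proof -
      have "(\<Sum>j\<in>nb i. c {i, j} * (d i - d j)) = (\<Sum>j\<in>W. L c i j * d j)"
        by (rule laplacian_interior[symmetric]) (use i in \<open>auto simp: d_def\<close>)
      also have "\<dots> = (\<Sum>j\<in>W. L c i j * v j)" by (rule sum.cong) (auto simp: d_def)
      finally show ?thesis using bspec[OF v(2) i] by simp
    qed
    moreover have "\<exists>i\<in>W. d i \<noteq> 0" using v(1) by (auto simp: d_def)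
    ultimately show ?thesis by (intro exI[of _ d]) (auto simp: d_def)
  qed
  have sol: "h i = N i c / \<Delta> c" if c: "\<Delta> c \<noteq> 0" and h: "harmonic V E B u c h" and i: "i \<in> V" for c h i
  proof (cases "i \<in> B")
    case True
    then show ?thesis using h c by (simp add: N_def harmonic_def)
  next
    case False
    then have iW: "i \<in> W" using i by simp
    have "N i c = (\<Sum>k\<in>W. adj i k c * (\<Sum>j\<in>W. L c k j * h j))"
      using False by (simp add: N_def r_def harmonic_system[OF h])
    also have "\<dots> = (\<Sum>j\<in>W. (\<Sum>k\<in>W. adj i k c * L c k j) * h j)"
      unfolding sum_distrib_right sum_distrib_left by (subst sum.swap) (simp add: mult.assoc)
    also have "\<dots> = (\<Sum>j\<in>W. (if i = j then \<Delta> c else 0) * h j)" by (rule sum.cong) (simp_all only: prod(2)[OF iW])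
    also have "\<dots> = \<Delta> c * h i" by (rule sum_delta_mult[OF finW iW])
    finally show ?thesis using c by simp
  qed
  show ?thesis using p\<Delta> pN ns kern sol by blast
qed

end

section \<open>Solutions over a generic \<epsilon>: properness, local uniqueness, local
  existence\<close>

locale dirichlet_rational = dirichlet_problem V B E u
  for V B :: "'v set" and E :: "'v set set" and u :: "'v \<Rightarrow> real" +
  fixes m :: nat and \<Delta> :: "('v set \<Rightarrow> complex) \<Rightarrow> complex" and N :: "'v \<Rightarrow> ('v set \<Rightarrow> complex) \<Rightarrow> complex"
  assumes poly_\<Delta>: "polyfun E m \<Delta>" and poly_N: "i \<in> V \<Longrightarrow> polyfun E m (N i)"
    and nonsingular_iff: "nonsingular_on (V - B) (laplacian V E c) \<longleftrightarrow> \<Delta> c \<noteq> 0"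
    and kernel: "\<Delta> c = 0 \<Longrightarrow> \<exists>d. (\<exists>i\<in>V - B. d i \<noteq> 0) \<and> (\<forall>b\<in>B. d b = 0) \<and>
      (\<forall>i\<in>V - B. (\<Sum>j\<in>neighbours V E i. c {i, j} * (d i - d j)) = 0)"
    and solution: "\<Delta> c \<noteq> 0 \<Longrightarrow> harmonic V E B u c h \<Longrightarrow> i \<in> V \<Longrightarrow> h i = N i c / \<Delta> c"
begin

lemma \<Delta>_cong: "(\<And>e. e \<in> E \<Longrightarrow> c e = c' e) \<Longrightarrow> \<Delta> c = \<Delta> c'"
  by (rule polyfun_cong_on[OF poly_\<Delta>])

lemma trivial_kernel:
  assumes c: "\<Delta> c \<noteq> 0" and d: "\<And>b. b \<in> B \<Longrightarrow> d b = 0"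
    "\<And>i. i \<in> W \<Longrightarrow> (\<Sum>j\<in>nb i. c {i, j} * (d i - d j)) = 0" and i: "i \<in> V"
  shows "d i = 0"
proof (cases "i \<in> B")
  case False
  then have iW: "i \<in> W" using i by simp
  obtain M where M: "\<And>i k. i \<in> W \<Longrightarrow> k \<in> W \<Longrightarrow> (\<Sum>j\<in>W. M i j * L c j k) = (if i = k then 1 else 0)"
    using c nonsingular_iff unfolding nonsingular_on_def by blast
  have "d i = (\<Sum>k\<in>W. (if i = k then 1 else 0) * d k)" using sum_delta_mult[OF finW iW, of 1 d] by simp
  also have "\<dots> = (\<Sum>k\<in>W. (\<Sum>j\<in>W. M i j * L c j k) * d k)" by (rule sum.cong) (simp_all only: M[OF iW])
  also have "\<dots> = (\<Sum>j\<in>W. M i j * (\<Sum>k\<in>W. L c j k * d k))"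
    unfolding sum_distrib_right sum_distrib_left by (subst sum.swap) (simp add: mult.assoc)
  also have "\<dots> = 0" using laplacian_interior[OF d(1)] d(2) by (intro sum.neutral) auto
  finally show ?thesis .
qed (rule d(1))

text \<open>The term with \<open>edge_prod\<close> is F_e as a rational function of the weights, and
  the bounds express that F is proper where \<open>f\<close> does not vanish: bounded weights have a
  convergent subsequence, and the bound on 1 / \<Delta> keeps its limit nonsingular. Nonzero entries
  of \<epsilon> let the weights be recovered from h.\<close>

definition generic_poly :: "(('v set \<Rightarrow> complex) \<Rightarrow> complex) \<Rightarrow> bool" where
  "generic_poly f \<longleftrightarrow> (\<exists>d. polyfun E d f) \<and> (\<exists>x. f x \<noteq> 0) \<and> (\<forall>\<epsilon>. f \<epsilon> \<noteq> 0 \<longrightarrow> (\<forall>e\<in>E. \<epsilon> e \<noteq> 0)) \<and>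
    (\<forall>C \<epsilon>. (\<forall>n. \<Delta> (C n) \<noteq> 0) \<longrightarrow>
      (\<forall>e\<in>E. (\<lambda>n. C n e * edge_prod (\<lambda>i. N i (C n) / \<Delta> (C n)) (\<lambda>i. N i (C n) / \<Delta> (C n)) e) \<longlonglongrightarrow> \<epsilon> e) \<longrightarrow>
      f \<epsilon> \<noteq> 0 \<longrightarrow> Bseq (\<lambda>n. 1 / \<Delta> (C n)) \<and> (\<forall>e\<in>E. Bseq (\<lambda>n. C n e)))"

lemma ex_generic_poly: "\<exists>f. generic_poly f"
proof -
  \<comment> \<open>F_e has the denominator \<Delta>^2, and \<open>generic_bound\<close> works with
    one denominator; so c_e and 1 / \<Delta> are written as c_e \<Delta>^2 / \<Delta>^2 and \<Delta>
    / \<Delta>^2. The degree accounts for c_e times two factors of degree m.\<close>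
  let ?d = "1 + (m + m)"
  let ?D = "\<lambda>c. \<Delta> c * \<Delta> c"
  let ?P = "\<lambda>e c. c e * edge_prod (\<lambda>i. N i c) (\<lambda>i. N i c) e"
  have PP: "?P e c / ?D c = c e * edge_prod (\<lambda>i. N i c / \<Delta> c) (\<lambda>i. N i c / \<Delta> c) e" if e: "e \<in> E" for e c
  proof -
    obtain i j where "e = {i, j}" "i \<noteq> j" using e by (rule edgeE)
    then show ?thesis by (simp add: edge_prod_pair diff_divide_distrib[symmetric])
  qed
  have pD: "polyfun E ?d ?D" by (rule polyfun_mono[OF polyfun_mult[OF finE poly_\<Delta> poly_\<Delta>] _ finE]) simp
  have pP: "polyfun E ?d (?P e)" if e: "e \<in> E" for e
  proof -
    obtain i j where ij: "e = {i, j}" "i \<noteq> j" "i \<in> V" "j \<in> V" using e by (rule edgeE)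
    have "polyfun E ?d (\<lambda>c. c e * ((N i c - N j c) * (N i c - N j c)))"
      by (intro polyfun_mult polyfun_diff poly_N ij polyfun_coord finE e) simp
    then show ?thesis by (rule polyfun_cong) (simp add: ij edge_prod_pair)
  qed
  have pG: "polyfun E ?d (\<lambda>c. c e * (\<Delta> c * \<Delta> c))" if e: "e \<in> E" for e
    by (intro polyfun_mult poly_\<Delta> polyfun_coord finE e) simp
  have p\<Delta>: "polyfun E ?d \<Delta>" by (rule polyfun_mono[OF poly_\<Delta> _ finE]) simp
  define bd where "bd G f \<longleftrightarrow> (\<exists>d. polyfun E d f) \<and> (\<exists>x. f x \<noteq> 0) \<and> (\<forall>X y. (\<forall>n. ?D (X n) \<noteq> 0) \<longrightarrow>
    (\<forall>i\<in>E. (\<lambda>n. ?P i (X n) / ?D (X n)) \<longlonglongrightarrow> y i) \<longrightarrow> f y \<noteq> 0 \<longrightarrow> Bseq (\<lambda>n. G (X n) / ?D (X n)))" for G f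
  have ex: "\<exists>f. bd G f" if "polyfun E ?d G" for G
    using generic_bound[where P = ?P, OF finE pP that pD] unfolding bd_def by blast
  obtain f0 where f0: "bd \<Delta> f0" using ex[OF p\<Delta>] by blast
  obtain fe where fe: "\<And>e. e \<in> E \<Longrightarrow> bd (\<lambda>c. c e * (\<Delta> c * \<Delta> c)) (fe e)" using ex[OF pG] by metis
  obtain d1 x1 where 1: "polyfun E d1 (\<lambda>x. \<Prod>e\<in>E. fe e x)" "(\<Prod>e\<in>E. fe e x1) \<noteq> 0"
  proof -
    have "\<exists>d x. polyfun E d (\<lambda>x. \<Prod>e\<in>E. fe e x) \<and> (\<Prod>e\<in>E. fe e x) \<noteq> 0"
      by (rule polyfun_prod_nonzero[OF finE finE]) (use fe in \<open>auto simp: bd_def\<close>)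
    then show thesis using that by blast
  qed
  obtain d2 x2 where 2: "polyfun E d2 (\<lambda>x. \<Prod>e\<in>E. x e)" "(\<Prod>e\<in>E. x2 e) \<noteq> (0 :: complex)"
  proof -
    have "\<exists>d x. polyfun E d (\<lambda>x. \<Prod>e\<in>E. x e) \<and> (\<Prod>e\<in>E. x e) \<noteq> (0 :: complex)"
    proof (rule polyfun_prod_nonzero[OF finE finE])
      fix e assume e: "e \<in> E"
      show "\<exists>d. polyfun E d (\<lambda>x. x e)" using polyfun_coord[OF finE e, of 1] by blast
      show "\<exists>x :: 'v set \<Rightarrow> complex. x e \<noteq> 0" by (rule exI[of _ "\<lambda>_. 1"]) simp
    qed
    then show thesis using that by blast
  qed
  obtain d3 x3 where 3: "polyfun E d3 f0" "f0 x3 \<noteq> 0" using f0 unfolding bd_def by blast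
  define f12 where "f12 x = (\<Prod>e\<in>E. fe e x) * (\<Prod>e\<in>E. x e)" for x
  have p12: "polyfun E (d1 + d2) f12" unfolding f12_def by (rule polyfun_mult[OF finE 1(1) 2(1)])
  obtain x12 where x12: "f12 x12 \<noteq> 0"
    using polyfun_mult_nonzero[where f = "\<lambda>x. \<Prod>e\<in>E. fe e x" and g = "\<lambda>x. \<Prod>e\<in>E. x e" and x = x1 and y = x2,
      OF 1(1) 2(1) 1(2) 2(2)] unfolding f12_def by (elim exE)
  define f where "f x = f12 x * f0 x" for x
  have pf: "polyfun E (d1 + d2 + d3) f" unfolding f_def by (rule polyfun_mult[OF finE p12 3(1)])
  obtain xf where xf: "f xf \<noteq> 0"
    using polyfun_mult_nonzero[where f = f12 and g = f0 and x = x12 and y = x3, OF p12 3(1) x12 3(2)]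
    unfolding f_def by (elim exE)
  have nz: "f0 \<epsilon> \<noteq> 0" "\<And>e. e \<in> E \<Longrightarrow> fe e \<epsilon> \<noteq> 0" "\<And>e. e \<in> E \<Longrightarrow> \<epsilon> e \<noteq> 0" if "f \<epsilon> \<noteq> 0" for \<epsilon>
    using that finE unfolding f_def f12_def by auto
  have "Bseq (\<lambda>n. 1 / \<Delta> (C n)) \<and> (\<forall>e\<in>E. Bseq (\<lambda>n. C n e))"
    if C: "\<And>n. \<Delta> (C n) \<noteq> 0"
      "\<And>e. e \<in> E \<Longrightarrow> (\<lambda>n. C n e * edge_prod (\<lambda>i. N i (C n) / \<Delta> (C n)) (\<lambda>i. N i (C n) / \<Delta> (C n)) e) \<longlonglongrightarrow> \<epsilon> e"
      "f \<epsilon> \<noteq> 0" for C \<epsilon>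
  proof -
    have D: "\<forall>n. ?D (C n) \<noteq> 0" using C(1) by simp
    have lim: "\<forall>e\<in>E. (\<lambda>n. ?P e (C n) / ?D (C n)) \<longlonglongrightarrow> \<epsilon> e"
    proof
      fix e assume e: "e \<in> E"
      show "(\<lambda>n. ?P e (C n) / ?D (C n)) \<longlonglongrightarrow> \<epsilon> e" unfolding PP[OF e] by (rule C(2)[OF e])
    qed
    have "Bseq (\<lambda>n. \<Delta> (C n) / ?D (C n))" using f0 D lim nz(1)[OF C(3)] unfolding bd_def by blast
    moreover have "Bseq (\<lambda>n. C n e * (\<Delta> (C n) * \<Delta> (C n)) / ?D (C n))" if "e \<in> E" for e
      using fe[OF that] D lim nz(2)[OF C(3) that] unfolding bd_def by blast
    ultimately show ?thesis using C(1) by simp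
  qed
  then have "generic_poly f" unfolding generic_poly_def using pf xf nz(3) by blast
  then show ?thesis by blast
qed

lemma Sol_ext: "h \<in> Sol \<epsilon> \<Longrightarrow> h \<in> V \<rightarrow>\<^sub>E UNIV"
  and Sol_bd: "h \<in> Sol \<epsilon> \<Longrightarrow> b \<in> B \<Longrightarrow> h b = complex_of_real (u b)"
  by (auto simp: Sol_iff harmonic_def)

text \<open>As \<epsilon>_e is nonzero, the function determines the weights as \<epsilon>_e / (h i -
  h j)^2, and harmonicity becomes a system in h alone. \<open>SolI\<close> is the converse.\<close>

lemma Sol_critical:
  assumes h: "h \<in> Sol \<epsilon>" and \<epsilon>: "\<forall>e\<in>E. \<epsilon> e \<noteq> 0"
  shows "\<And>e. e \<in> E \<Longrightarrow> edge_prod h h e \<noteq> 0" "i \<in> W \<Longrightarrow> (\<Sum>j\<in>nb i. \<epsilon> {i, j} / (h i - h j)) = 0"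
    "\<Delta> (\<lambda>e. \<epsilon> e / edge_prod h h e) \<noteq> 0"
proof -
  obtain c where c: "generic_weights V E B c" "harmonic V E B u c h" "\<And>e. e \<in> E \<Longrightarrow> c e * edge_prod h h e = \<epsilon> e"
    using h by (auto simp: Sol_iff)
  show ne: "edge_prod h h e \<noteq> 0" if "e \<in> E" for e using c(3)[OF that] \<epsilon> that by auto
  have c_eq: "c e = \<epsilon> e / edge_prod h h e" if "e \<in> E" for e
    using c(3)[OF that] ne[OF that] by (simp add: nonzero_eq_divide_eq)
  then show "\<Delta> (\<lambda>e. \<epsilon> e / edge_prod h h e) \<noteq> 0"
    using c(1) nonsingular_iff \<Delta>_cong[of c "\<lambda>e. \<epsilon> e / edge_prod h h e"] by (simp add: generic_weights_def)
  assume i: "i \<in> W"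
  have "(\<Sum>j\<in>nb i. \<epsilon> {i, j} / (h i - h j)) = (\<Sum>j\<in>nb i. c {i, j} * (h i - h j))"
  proof (rule sum.cong[OF refl])
    fix j assume "j \<in> nb i"
    then have e: "{i, j} \<in> E" by (simp add: nb)
    show "\<epsilon> {i, j} / (h i - h j) = c {i, j} * (h i - h j)"
      using ne[OF e] unfolding c_eq[OF e] edge_prod_edge[OF e] by simp
  qed
  then show "(\<Sum>j\<in>nb i. \<epsilon> {i, j} / (h i - h j)) = 0" using c(2) i by (simp add: harmonic_def)
qed

lemma SolI:
  assumes h: "h \<in> V \<rightarrow>\<^sub>E UNIV" "\<And>b. b \<in> B \<Longrightarrow> h b = complex_of_real (u b)"
    and ne: "\<And>e. e \<in> E \<Longrightarrow> edge_prod h h e \<noteq> 0"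
    and crit: "\<And>i. i \<in> W \<Longrightarrow> (\<Sum>j\<in>nb i. \<epsilon> {i, j} / (h i - h j)) = 0"
    and ns: "\<Delta> (\<lambda>e. \<epsilon> e / edge_prod h h e) \<noteq> 0"
  shows "h \<in> Sol \<epsilon>"
  unfolding Sol_iff
proof (intro exI conjI ballI)
  let ?c = "restrict (\<lambda>e. \<epsilon> e / edge_prod h h e) E"
  have "\<Delta> ?c \<noteq> 0" using ns \<Delta>_cong[of ?c "\<lambda>e. \<epsilon> e / edge_prod h h e"] by simp
  then show "generic_weights V E B ?c" by (simp add: generic_weights_def nonsingular_iff)
  have "(\<Sum>j\<in>nb i. ?c {i, j} * (h i - h j)) = (\<Sum>j\<in>nb i. \<epsilon> {i, j} / (h i - h j))" for i
  proof (rule sum.cong[OF refl])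
    fix j assume "j \<in> nb i"
    then have e: "{i, j} \<in> E" by (simp add: nb)
    show "?c {i, j} * (h i - h j) = \<epsilon> {i, j} / (h i - h j)"
      using ne[OF e] e unfolding edge_prod_edge[OF e] by (simp add: edge_prod_edge)
  qed
  then show "harmonic V E B u ?c h" using h crit by (simp add: harmonic_def)
  show "?c e * edge_prod h h e = \<epsilon> e" if "e \<in> E" for e using ne[OF that] that by simp
qed

text \<open>Compactness comes from the weights, not from the functions: a subsequence of the weights
  of \<open>H n\<close> converges, its limit is nonsingular, and h depends continuously on
  nonsingular weights through N / \<Delta>.\<close>

lemma Sol_proper:
  assumes f: "generic_poly f" "f \<epsilon> \<noteq> 0" and \<epsilon>s: "\<forall>e\<in>E. (\<lambda>n. \<epsilon>s n e) \<longlonglongrightarrow> \<epsilon> e"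
    and H: "\<And>n. H n \<in> Sol (\<epsilon>s n)"
  shows "\<exists>r h. strict_mono (r :: nat \<Rightarrow> nat) \<and> h \<in> Sol \<epsilon> \<and> (\<forall>v\<in>V. (\<lambda>n. H (r n) v) \<longlonglongrightarrow> h v)"
proof -
  have "\<forall>n. \<exists>c. generic_weights V E B c \<and> harmonic V E B u c (H n) \<and> (\<forall>e\<in>E. c e * edge_prod (H n) (H n) e = \<epsilon>s n e)"
    using H by (simp add: Sol_iff)
  from choice[OF this] obtain C where C: "\<And>n. generic_weights V E B (C n)" "\<And>n. harmonic V E B u (C n) (H n)"
    "\<And>n e. e \<in> E \<Longrightarrow> C n e * edge_prod (H n) (H n) e = \<epsilon>s n e" by blast
  have \<Delta>C: "\<Delta> (C n) \<noteq> 0" for n using C(1)[of n] by (simp add: generic_weights_def nonsingular_iff)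
  have HN: "H n i = N i (C n) / \<Delta> (C n)" if "i \<in> V" for n i by (rule solution[OF \<Delta>C C(2) that])
  have "(\<lambda>n. C n e * edge_prod (\<lambda>i. N i (C n) / \<Delta> (C n)) (\<lambda>i. N i (C n) / \<Delta> (C n)) e) \<longlonglongrightarrow> \<epsilon> e" if e: "e \<in> E" for e
  proof -
    have "edge_prod (\<lambda>i. N i (C n) / \<Delta> (C n)) (\<lambda>i. N i (C n) / \<Delta> (C n)) e = edge_prod (H n) (H n) e" for n
      by (rule edge_prod_cong) (use edge[OF e] HN in auto)
    then show ?thesis using bspec[OF \<epsilon>s e] C(3)[OF e] by simp
  qed
  then have bd: "Bseq (\<lambda>n. 1 / \<Delta> (C n))" "\<And>e. e \<in> E \<Longrightarrow> Bseq (\<lambda>n. C n e)"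
    using f \<Delta>C unfolding generic_poly_def by blast+
  obtain r c where r: "strict_mono (r :: nat \<Rightarrow> nat)" "\<And>e. e \<in> E \<Longrightarrow> (\<lambda>n. C (r n) e) \<longlonglongrightarrow> c e"
    using convergent_subsequence_on[OF finE, of C] bd(2) by (auto simp: Bseq_eq_bounded)
  define c' where "c' = restrict c E"
  have c': "(\<lambda>n. C (r n) e) \<longlonglongrightarrow> c' e" if "e \<in> E" for e using r(2)[OF that] that by (simp add: c'_def)
  have \<Delta>lim: "(\<lambda>n. \<Delta> (C (r n))) \<longlonglongrightarrow> \<Delta> c'" by (rule polyfun_tendsto[OF poly_\<Delta> c'])
  have \<Delta>0: "\<Delta> c' \<noteq> 0"
  proof
    assume "\<Delta> c' = 0"
    obtain K where K: "\<And>n. norm (1 / \<Delta> (C n)) \<le> K" using bd(1) unfolding Bseq_def by blast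
    \<comment> \<open>In multiplied form the bound on 1 / \<Delta> passes to a limit at which
      \<Delta> is not yet known to be nonzero.\<close>
    have "1 \<le> K * norm (\<Delta> (C (r n)))" for n
      using K[of "r n"] \<Delta>C[of "r n"] by (simp add: norm_divide pos_divide_le_eq)
    moreover have "(\<lambda>n. K * norm (\<Delta> (C (r n)))) \<longlonglongrightarrow> K * norm (\<Delta> c')"
      by (intro tendsto_intros \<Delta>lim)
    ultimately have "1 \<le> K * norm (\<Delta> c')" by (intro LIMSEQ_le_const) auto
    then show False using \<open>\<Delta> c' = 0\<close> by simp
  qed
  have gen: "generic_weights V E B c'" using \<Delta>0 by (simp add: generic_weights_def nonsingular_iff c'_def)
  define h where "h = the_harmonic V E B u c'"
  have harm: "harmonic V E B u c' h" using harmonic_the_harmonic[OF gen] by (simp add: h_def)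
  have hlim: "(\<lambda>n. H (r n) v) \<longlonglongrightarrow> h v" if v: "v \<in> V" for v
    unfolding HN[OF v] solution[OF \<Delta>0 harm v]
    by (intro tendsto_divide polyfun_tendsto[OF poly_N[OF v] c'] \<Delta>lim \<Delta>0)
  have "c' e * edge_prod h h e = \<epsilon> e" if e: "e \<in> E" for e
  proof (rule LIMSEQ_unique)
    show "(\<lambda>n. C (r n) e * edge_prod (H (r n)) (H (r n)) e) \<longlonglongrightarrow> c' e * edge_prod h h e"
      by (intro tendsto_mult c' e tendsto_edge_prod hlim) (use edge[OF e] in auto)
    show "(\<lambda>n. C (r n) e * edge_prod (H (r n)) (H (r n)) e) \<longlonglongrightarrow> \<epsilon> e"
      unfolding C(3)[OF e] using LIMSEQ_subseq_LIMSEQ[OF bspec[OF \<epsilon>s e] r(1)] by (simp add: o_def)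
  qed
  then have "h \<in> Sol \<epsilon>" using gen harm by (auto simp: Sol_iff)
  then show ?thesis using r(1) hlim by blast
qed

text \<open>
  The difference of two solutions is harmonic for the secant weights \<open>\<epsilon> e / edge_prod h k e\<close>.
\<close>

lemma critical_difference:
  fixes h k :: "'v \<Rightarrow> complex"
  assumes "\<forall>e\<in>E. edge_prod h k e \<noteq> 0"
  shows "(\<Sum>j\<in>nb i. \<epsilon> {i, j} / (h i - h j)) - (\<Sum>j\<in>nb i. \<epsilon> {i, j} / (k i - k j))
    = - (\<Sum>j\<in>nb i. \<epsilon> {i, j} / edge_prod h k {i, j} * ((h i - k i) - (h j - k j)))"
  unfolding sum_subtractf[symmetric] sum_negf[symmetric]
proof (rule sum.cong[OF refl])
  fix j assume "j \<in> nb i"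
  then have e: "{i, j} \<in> E" by (simp add: nb)
  have ne: "h i - h j \<noteq> 0" "k i - k j \<noteq> 0" using bspec[OF assms e] unfolding edge_prod_edge[OF e] by auto
  have "a / x - a / y = - (a / (x * y) * (x - y))" if "x \<noteq> 0" "y \<noteq> 0" for a x y :: complex
    using that by (simp add: field_simps)
  from this[OF ne, of "\<epsilon> {i, j}"]
  show "\<epsilon> {i, j} / (h i - h j) - \<epsilon> {i, j} / (k i - k j)
      = - (\<epsilon> {i, j} / edge_prod h k {i, j} * ((h i - k i) - (h j - k j)))"
    unfolding edge_prod_edge[OF e] by (simp add: algebra_simps)
qed

lemma secant_weights_tendsto:
  fixes h :: "'v \<Rightarrow> complex"
  assumes ne: "\<forall>e\<in>E. edge_prod h h e \<noteq> 0" and \<epsilon>s: "\<forall>e\<in>E. (\<lambda>n. \<epsilon>s n e) \<longlonglongrightarrow> \<epsilon> e"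
    and H: "\<forall>v\<in>V. (\<lambda>n. H n v) \<longlonglongrightarrow> h v" and K: "\<forall>v\<in>V. (\<lambda>n. K n v) \<longlonglongrightarrow> h v"
  shows "\<And>e. e \<in> E \<Longrightarrow> (\<lambda>n. \<epsilon>s n e / edge_prod (H n) (K n) e) \<longlonglongrightarrow> \<epsilon> e / edge_prod h h e"
    "eventually (\<lambda>n. \<forall>e\<in>E. edge_prod (H n) (K n) e \<noteq> 0) sequentially"
proof -
  have lim: "(\<lambda>n. edge_prod (H n) (K n) e) \<longlonglongrightarrow> edge_prod h h e" if "e \<in> E" for e
    by (intro tendsto_edge_prod bspec[OF H] bspec[OF K]) (use edge[OF that] in auto)
  show "(\<lambda>n. \<epsilon>s n e / edge_prod (H n) (K n) e) \<longlonglongrightarrow> \<epsilon> e / edge_prod h h e" if "e \<in> E" for e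
    by (intro tendsto_divide bspec[OF \<epsilon>s] lim bspec[OF ne] that)
  show "eventually (\<lambda>n. \<forall>e\<in>E. edge_prod (H n) (K n) e \<noteq> 0) sequentially"
    by (intro eventually_ball_finite finE ballI tendsto_imp_eventually_ne[OF lim] bspec[OF ne])
qed

text \<open>The secant weights of \<open>H n\<close> and \<open>K n\<close> converge to the weights
  of \<open>h\<close>, where \<Delta> \<noteq> 0. For large n they are therefore nonsingular, and
  the difference of the two solutions, harmonic for them and 0 on B, vanishes.\<close>

lemma Sol_locally_unique:
  assumes \<epsilon>: "\<forall>e\<in>E. \<epsilon> e \<noteq> 0" and h: "h \<in> Sol \<epsilon>" and \<epsilon>s: "\<forall>e\<in>E. (\<lambda>n. \<epsilon>s n e) \<longlonglongrightarrow> \<epsilon> e"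
    and H: "\<And>n. H n \<in> Sol (\<epsilon>s n)" "\<forall>v\<in>V. (\<lambda>n. H n v) \<longlonglongrightarrow> h v"
    and K: "\<And>n. K n \<in> Sol (\<epsilon>s n)" "\<forall>v\<in>V. (\<lambda>n. K n v) \<longlonglongrightarrow> h v"
  shows "\<exists>n. H n = K n"
proof -
  have ne: "\<forall>e\<in>E. edge_prod h h e \<noteq> 0" using Sol_critical(1)[OF h \<epsilon>] by blast
  note sec = secant_weights_tendsto[OF ne \<epsilon>s H(2) K(2)]
  have "(\<lambda>n. \<Delta> (\<lambda>e. \<epsilon>s n e / edge_prod (H n) (K n) e)) \<longlonglongrightarrow> \<Delta> (\<lambda>e. \<epsilon> e / edge_prod h h e)"
    by (rule polyfun_tendsto[OF poly_\<Delta>]) (rule sec(1))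
  then have "eventually (\<lambda>n. \<Delta> (\<lambda>e. \<epsilon>s n e / edge_prod (H n) (K n) e) \<noteq> 0) sequentially"
    by (rule tendsto_imp_eventually_ne) (rule Sol_critical(3)[OF h \<epsilon>])
  moreover have "eventually (\<lambda>n. \<forall>e\<in>E. \<epsilon>s n e \<noteq> 0) sequentially"
    by (intro eventually_ball_finite finE ballI tendsto_imp_eventually_ne[OF bspec[OF \<epsilon>s]] bspec[OF \<epsilon>])
  ultimately have "eventually (\<lambda>n. \<Delta> (\<lambda>e. \<epsilon>s n e / edge_prod (H n) (K n) e) \<noteq> 0 \<and> (\<forall>e\<in>E. \<epsilon>s n e \<noteq> 0)
      \<and> (\<forall>e\<in>E. edge_prod (H n) (K n) e \<noteq> 0)) sequentially"
    using sec(2) by eventually_elim blast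
  then obtain n where n: "\<Delta> (\<lambda>e. \<epsilon>s n e / edge_prod (H n) (K n) e) \<noteq> 0" "\<forall>e\<in>E. \<epsilon>s n e \<noteq> 0"
      "\<forall>e\<in>E. edge_prod (H n) (K n) e \<noteq> 0"
    by (auto simp: eventually_sequentially)
  have "H n v - K n v = 0" if v: "v \<in> V" for v
  proof (rule trivial_kernel[OF n(1), of "\<lambda>v. H n v - K n v"])
    show "H n b - K n b = 0" if "b \<in> B" for b using Sol_bd[OF H(1) that] Sol_bd[OF K(1) that] by simp
    show "(\<Sum>j\<in>nb i. \<epsilon>s n {i, j} / edge_prod (H n) (K n) {i, j} * (H n i - K n i - (H n j - K n j))) = 0"
      if i: "i \<in> W" for i
      using critical_difference[OF n(3), where i = i and \<epsilon> = "\<epsilon>s n"] Sol_critical(2)[OF H(1) n(2) i] Sol_critical(2)[OF K(1) n(2) i]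
      by simp
  qed (rule v)
  then have "H n = K n" by (intro PiE_ext[OF Sol_ext[OF H(1)] Sol_ext[OF K(1)]]) simp
  then show ?thesis by blast
qed

lemma laplacian_diff_bound:
  "norm (L c i j - L c' i j) \<le> (\<Sum>e\<in>E. norm (c e - c' e))"
proof (cases "i = j")
  case True
  have inj: "inj_on (\<lambda>v. {i, v}) (nb i)" by (auto intro!: inj_onI simp: doubleton_eq_iff)
  have "norm (L c i j - L c' i j) = norm (\<Sum>v\<in>nb i. c {i, v} - c' {i, v})"
    using True by (simp add: laplacian_def sum_subtractf)
  also have "\<dots> \<le> (\<Sum>v\<in>nb i. norm (c {i, v} - c' {i, v}))" by (rule norm_sum)
  also have "\<dots> = (\<Sum>e\<in>(\<lambda>v. {i, v}) ` nb i. norm (c e - c' e))" using inj by (simp add: sum.reindex)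
  also have "\<dots> \<le> (\<Sum>e\<in>E. norm (c e - c' e))" by (rule sum_mono2) (auto simp: finE nb)
  finally show ?thesis .
next
  case False
  show ?thesis
  proof (cases "{i, j} \<in> E")
    case True
    then have "norm (c {i, j} - c' {i, j}) \<le> (\<Sum>e\<in>E. norm (c e - c' e))"
      using finE by (intro member_le_sum) auto
    then show ?thesis using True False by (simp add: laplacian_def norm_minus_commute)
  next
    case no: False
    then show ?thesis using False by (simp add: laplacian_def sum_nonneg)
  qed
qed

text \<open>A uniform version of \<open>secant_weights_tendsto\<close>, since the contraction
  estimate concerns all pairs in a ball at once. Failure for every \<rho> = 1 / (n + 1) would
  produce sequences that contradict the sequential version.\<close>

lemma secant_weights_close:
  fixes h :: "'v \<Rightarrow> complex"
  assumes ne: "\<forall>e\<in>E. edge_prod h h e \<noteq> 0" and \<eta>: "\<eta> > 0"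
  shows "\<exists>\<rho>>0. \<forall>\<epsilon>' k k'. (\<forall>e\<in>E. norm (\<epsilon>' e - \<epsilon> e) \<le> \<rho>) \<longrightarrow> (\<forall>v\<in>V. norm (k v - h v) \<le> \<rho>) \<longrightarrow>
    (\<forall>v\<in>V. norm (k' v - h v) \<le> \<rho>) \<longrightarrow> (\<forall>e\<in>E. edge_prod k k' e \<noteq> 0) \<and>
    (\<Sum>e\<in>E. norm (\<epsilon>' e / edge_prod k k' e - \<epsilon> e / edge_prod h h e)) < \<eta>"
proof (rule ccontr)
  define near where "near \<rho> \<epsilon>' k k' \<longleftrightarrow> ((\<forall>e\<in>E. norm (\<epsilon>' e - \<epsilon> e) \<le> \<rho>) \<longrightarrow> (\<forall>v\<in>V. norm (k v - h v) \<le> \<rho>) \<longrightarrow>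
    (\<forall>v\<in>V. norm (k' v - h v) \<le> \<rho>) \<longrightarrow> (\<forall>e\<in>E. edge_prod k k' e \<noteq> 0) \<and>
    (\<Sum>e\<in>E. norm (\<epsilon>' e / edge_prod k k' e - \<epsilon> e / edge_prod h h e)) < \<eta>)" for \<rho> \<epsilon>' k k'
  assume "\<not> ?thesis"
  then have no: "\<not> (\<exists>\<rho>>0. \<forall>\<epsilon>' k k'. near \<rho> \<epsilon>' k k')" unfolding near_def .
  have "\<exists>\<epsilon>' k k'. \<not> near (inverse (real (Suc n))) \<epsilon>' k k'" for n
  proof (rule ccontr)
    assume "\<not> ?thesis"
    moreover have "inverse (real (Suc n)) > 0" by simp
    ultimately show False using no by blast
  qed
  then obtain \<epsilon>s H K where "\<And>n. \<not> near (inverse (real (Suc n))) (\<epsilon>s n) (H n) (K n)" by metis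
  note bad = this[unfolded near_def]
  have lim: "(\<lambda>n. x n) \<longlonglongrightarrow> l" if "\<And>n. norm (x n - l) \<le> inverse (real (Suc n))" for x :: "nat \<Rightarrow> complex" and l
    by (rule LIM_zero_cancel, rule Lim_null_comparison[OF always_eventually LIMSEQ_inverse_real_of_nat])
      (rule allI, rule that)
  have \<epsilon>s: "\<forall>e\<in>E. (\<lambda>n. \<epsilon>s n e) \<longlonglongrightarrow> \<epsilon> e" using bad by (intro ballI lim) blast
  have H: "\<forall>v\<in>V. (\<lambda>n. H n v) \<longlonglongrightarrow> h v" using bad by (intro ballI lim) blast
  have K: "\<forall>v\<in>V. (\<lambda>n. K n v) \<longlonglongrightarrow> h v" using bad by (intro ballI lim) blast
  note sec = secant_weights_tendsto[OF ne \<epsilon>s H K]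
  have "(\<lambda>n. \<Sum>e\<in>E. norm (\<epsilon>s n e / edge_prod (H n) (K n) e - \<epsilon> e / edge_prod h h e)) \<longlonglongrightarrow> 0"
    by (intro tendsto_null_sum tendsto_norm_zero LIM_zero sec(1))
  then have "eventually (\<lambda>n. (\<Sum>e\<in>E. norm (\<epsilon>s n e / edge_prod (H n) (K n) e - \<epsilon> e / edge_prod h h e)) < \<eta>) sequentially"
    by (rule order_tendstoD) (rule \<eta>)
  with sec(2) have "eventually (\<lambda>n. False) sequentially"
    by eventually_elim (use bad in blast)
  then show False by simp
qed

text \<open>
  Newton's iteration with the inverse of \<open>K(c)\<close> at \<open>h\<close> held fixed.
\<close>

lemma Sol_locally_exists:
  assumes \<epsilon>: "\<forall>e\<in>E. \<epsilon> e \<noteq> 0" and h: "h \<in> Sol \<epsilon>" and \<epsilon>s: "\<forall>e\<in>E. (\<lambda>n. \<epsilon>s n e) \<longlonglongrightarrow> \<epsilon> e"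
  shows "\<exists>H. eventually (\<lambda>n. H n \<in> Sol (\<epsilon>s n)) sequentially \<and> (\<forall>v\<in>V. (\<lambda>n. H n v) \<longlonglongrightarrow> h v)"
proof -
  define c where "c e = \<epsilon> e / edge_prod h h e" for e
  have ne: "\<forall>e\<in>E. edge_prod h h e \<noteq> 0" using Sol_critical(1)[OF h \<epsilon>] by blast
  have \<Delta>c: "\<Delta> c \<noteq> 0" unfolding c_def by (rule Sol_critical(3)[OF h \<epsilon>])
  obtain M where invr: "\<And>i k. i \<in> W \<Longrightarrow> k \<in> W \<Longrightarrow> (\<Sum>j\<in>W. L c i j * M j k) = (if i = k then 1 else 0)"
    and invl: "\<And>i k. i \<in> W \<Longrightarrow> k \<in> W \<Longrightarrow> (\<Sum>j\<in>W. M i j * L c j k) = (if i = k then 1 else 0)"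
    using \<Delta>c nonsingular_iff unfolding nonsingular_on_def by blast
  define K0 where "K0 = (\<Sum>i\<in>W. \<Sum>k\<in>W. norm (M i k)) + 1"
  have K0: "K0 \<ge> 1" unfolding K0_def by (simp add: sum_nonneg)
  have MK: "(\<Sum>k\<in>W. norm (M i k)) \<le> K0" if "i \<in> W" for i
  proof -
    have "(\<Sum>k\<in>W. norm (M i k)) \<le> (\<Sum>i\<in>W. \<Sum>k\<in>W. norm (M i k))"
      using that finW by (intro member_le_sum[of i W "\<lambda>i. \<Sum>k\<in>W. norm (M i k)"] sum_nonneg) auto
    then show ?thesis by (simp add: K0_def)
  qed
  \<comment> \<open>If the entries of K(c) - K(c') are at most \<eta>, then M times this matrix
    contracts by 1/2, as \<open>K0\<close> bounds the row sums of M. The summands 1 in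
    \<open>K0\<close> and here keep the denominator positive.\<close>
  define \<eta> where "\<eta> = 1 / (2 * K0 * (real (card W) + 1))"
  have \<eta>: "\<eta> > 0" using K0 by (simp add: \<eta>_def add_pos_pos)
  have \<eta>K: "K0 * (real (card W) * \<eta>) \<le> 1 / 2"
  proof -
    have "K0 * (real (card W) * \<eta>) \<le> K0 * ((real (card W) + 1) * \<eta>)"
      using K0 \<eta> by (intro mult_left_mono mult_right_mono) auto
    also have "\<dots> = 1 / 2"
    proof -
      have "real (card W) + 1 \<noteq> 0" "K0 \<noteq> 0" using K0 by linarith+
      then show ?thesis by (simp add: \<eta>_def)
    qed
    finally show ?thesis .
  qed
  obtain \<rho> where \<rho>: "\<rho> > 0" and close: "\<And>\<epsilon>' k k'. \<forall>e\<in>E. norm (\<epsilon>' e - \<epsilon> e) \<le> \<rho> \<Longrightarrow> \<forall>v\<in>V. norm (k v - h v) \<le> \<rho> \<Longrightarrow>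
      \<forall>v\<in>V. norm (k' v - h v) \<le> \<rho> \<Longrightarrow> (\<forall>e\<in>E. edge_prod k k' e \<noteq> 0) \<and>
      (\<Sum>e\<in>E. norm (\<epsilon>' e / edge_prod k k' e - c e)) < \<eta>"
    using secant_weights_close[OF ne \<eta>, of \<epsilon>] unfolding c_def by blast
  define G where "G \<epsilon>' k i = (\<Sum>j\<in>nb i. \<epsilon>' {i, j} / (k i - k j))" for \<epsilon>' :: "'v set \<Rightarrow> complex" and k i
  have Gh: "G \<epsilon> h i = 0" if "i \<in> W" for i unfolding G_def by (rule Sol_critical(2)[OF h \<epsilon> that])
  \<comment> \<open>The Jacobian of \<open>G\<close> is -K(c), so the Newton step adds M G with a
    plus sign.\<close>
  define T where "T \<epsilon>' k v = (if v \<in> W then k v + (\<Sum>i\<in>W. M v i * G \<epsilon>' k i) else h v)" for \<epsilon>' k v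
  define \<tau> where "\<tau> n = (\<Sum>v\<in>W. norm (\<Sum>i\<in>W. M v i * G (\<epsilon>s n) h i))" for n
  have \<tau>0: "\<tau> n \<ge> 0" for n unfolding \<tau>_def by (intro sum_nonneg) auto
  have "(\<lambda>n. G (\<epsilon>s n) h i) \<longlonglongrightarrow> 0" if i: "i \<in> W" for i
  proof -
    have "(\<lambda>n. G (\<epsilon>s n) h i) \<longlonglongrightarrow> G \<epsilon> h i" unfolding G_def
    proof (intro tendsto_sum tendsto_divide tendsto_const)
      fix j assume "j \<in> nb i"
      then have e: "{i, j} \<in> E" by (simp add: nb)
      show "(\<lambda>n. \<epsilon>s n {i, j}) \<longlonglongrightarrow> \<epsilon> {i, j}" using \<epsilon>s e by blast
      show "h i - h j \<noteq> 0" using bspec[OF ne e] unfolding edge_prod_edge[OF e] by auto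
    qed
    then show ?thesis using Gh[OF i] by simp
  qed
  then have \<tau>: "\<tau> \<longlonglongrightarrow> 0" unfolding \<tau>_def
    by (intro tendsto_null_sum tendsto_norm_zero tendsto_mult_right_zero)
  have fix_ex: "\<exists>k. (\<forall>v\<in>W. norm (k v - h v) \<le> 2 * \<tau> n) \<and> (\<forall>v. v \<notin> W \<longrightarrow> k v = h v) \<and>
      (\<forall>i\<in>W. G (\<epsilon>s n) k i = 0)"
    if n: "2 * \<tau> n \<le> \<rho>" "\<forall>e\<in>E. norm (\<epsilon>s n e - \<epsilon> e) \<le> \<rho>" for n
  proof -
    define K where "K = {k. (\<forall>v\<in>W. norm (k v - h v) \<le> 2 * \<tau> n) \<and> (\<forall>v. v \<notin> W \<longrightarrow> k v = h v)}"
    have KV: "\<forall>v\<in>V. norm (k v - h v) \<le> \<rho>" if "k \<in> K" for k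
    proof
      fix v assume "v \<in> V"
      show "norm (k v - h v) \<le> \<rho>"
      proof (cases "v \<in> W")
        case True
        then have "norm (k v - h v) \<le> 2 * \<tau> n" using that by (simp add: K_def)
        then show ?thesis using n(1) by linarith
      next
        case False
        then show ?thesis using that \<rho> by (simp add: K_def)
      qed
    qed
    have "\<exists>k\<in>K. T (\<epsilon>s n) k = k" unfolding K_def
    proof (rule contraction_fixpoint_on[OF finW \<tau>0], unfold K_def[symmetric])
      show "norm (T (\<epsilon>s n) h v - h v) \<le> \<tau> n" if "v \<in> W" for v
        using member_le_sum[of v W "\<lambda>v. norm (\<Sum>i\<in>W. M v i * G (\<epsilon>s n) h i)"] that finW
        by (simp add: T_def \<tau>_def)
      show "T (\<epsilon>s n) k v = h v" if "k \<in> K" "v \<notin> W" for k v by (simp only: T_def that(2) if_False)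
      fix k k' b v
      assume k: "k \<in> K" "k' \<in> K" and b: "\<And>w. w \<in> W \<Longrightarrow> norm (k w - k' w) \<le> b" and v: "v \<in> W"
      define c' where "c' e = \<epsilon>s n e / edge_prod k k' e" for e
      have cl: "\<forall>e\<in>E. edge_prod k k' e \<noteq> 0" "(\<Sum>e\<in>E. norm (c' e - c e)) < \<eta>"
        using close[OF n(2) KV[OF k(1)] KV[OF k(2)]] by (auto simp: c'_def)
      define d where "d i = k i - k' i" for i
      have dB: "d i = 0" if "i \<in> B" for i using k that by (simp add: d_def K_def)
      have Gd: "G (\<epsilon>s n) k i - G (\<epsilon>s n) k' i = - (\<Sum>j\<in>W. L c' i j * d j)" if i: "i \<in> W" for i
        using critical_difference[OF cl(1), where i = i and \<epsilon> = "\<epsilon>s n"] laplacian_interior[where d = d and i = i and c = c', OF dB] i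
        by (simp add: G_def c'_def d_def)
      \<comment> \<open>Writing \<open>d v\<close> as a coordinate of M K(c) d leaves only the
        difference of two Laplacians, which is small entrywise.\<close>
      have "(\<Sum>i\<in>W. M v i * (\<Sum>j\<in>W. L c i j * d j)) = (\<Sum>j\<in>W. (\<Sum>i\<in>W. M v i * L c i j) * d j)"
        unfolding sum_distrib_right sum_distrib_left by (subst sum.swap) (simp add: mult.assoc)
      also have "\<dots> = (\<Sum>j\<in>W. (if v = j then 1 else 0) * d j)" by (rule sum.cong) (simp_all only: invl[OF v])
      also have "\<dots> = d v" using sum_delta_mult[OF finW v, of 1 d] by simp
      finally have dv: "d v = (\<Sum>i\<in>W. M v i * (\<Sum>j\<in>W. L c i j * d j))" by simp
      have "T (\<epsilon>s n) k v - T (\<epsilon>s n) k' v = d v + (\<Sum>i\<in>W. M v i * (G (\<epsilon>s n) k i - G (\<epsilon>s n) k' i))"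
        using v by (simp add: T_def d_def right_diff_distrib sum_subtractf)
      also have "(\<Sum>i\<in>W. M v i * (G (\<epsilon>s n) k i - G (\<epsilon>s n) k' i)) = (\<Sum>i\<in>W. M v i * - (\<Sum>j\<in>W. L c' i j * d j))"
        by (rule sum.cong) (simp_all only: Gd)
      finally have eq: "T (\<epsilon>s n) k v - T (\<epsilon>s n) k' v = (\<Sum>i\<in>W. M v i * (\<Sum>j\<in>W. (L c i j - L c' i j) * d j))"
        using dv by (simp add: sum_subtractf left_diff_distrib right_diff_distrib sum_negf)
      have b0: "b \<ge> 0" using b[OF v] norm_ge_zero order_trans by blast
      have Ld: "norm (L c i j - L c' i j) \<le> \<eta>" for i j
        using laplacian_diff_bound[of c i j c'] cl(2) by (simp add: norm_minus_commute)
      have inner: "norm (\<Sum>j\<in>W. (L c i j - L c' i j) * d j) \<le> real (card W) * (\<eta> * b)" for i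
      proof -
        have "norm (\<Sum>j\<in>W. (L c i j - L c' i j) * d j) \<le> (\<Sum>j\<in>W. \<eta> * b)"
        proof (rule sum_norm_le)
          fix j assume "j \<in> W"
          then show "norm ((L c i j - L c' i j) * d j) \<le> \<eta> * b"
            unfolding norm_mult d_def using b Ld \<eta> by (intro mult_mono) auto
        qed
        then show ?thesis by simp
      qed
      have "norm (T (\<epsilon>s n) k v - T (\<epsilon>s n) k' v) \<le> (\<Sum>i\<in>W. norm (M v i) * (real (card W) * (\<eta> * b)))"
        unfolding eq by (rule sum_norm_le) (auto simp: norm_mult intro!: mult_left_mono inner)
      also have "\<dots> = (\<Sum>i\<in>W. norm (M v i)) * (real (card W) * (\<eta> * b))" by (simp add: sum_distrib_right)
      also have "\<dots> \<le> K0 * (real (card W) * (\<eta> * b))"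
        using MK[OF v] \<eta> b0 by (intro mult_right_mono) auto
      also have "\<dots> = (K0 * (real (card W) * \<eta>)) * b" by simp
      also have "\<dots> \<le> 1 / 2 * b" using \<eta>K b0 by (rule mult_right_mono)
      finally show "norm (T (\<epsilon>s n) k v - T (\<epsilon>s n) k' v) \<le> b / 2" by simp
    qed
    then obtain k where k: "k \<in> K" "T (\<epsilon>s n) k = k" by blast
    have MG: "(\<Sum>i\<in>W. M v i * G (\<epsilon>s n) k i) = 0" if "v \<in> W" for v
      using fun_cong[OF k(2), of v] that by (simp add: T_def)
    have "G (\<epsilon>s n) k i = 0" if i: "i \<in> W" for i
    proof -
      have "G (\<epsilon>s n) k i = (\<Sum>l\<in>W. (if i = l then 1 else 0) * G (\<epsilon>s n) k l)"
        using sum_delta_mult[OF finW i, of 1 "G (\<epsilon>s n) k"] by simp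
      also have "\<dots> = (\<Sum>l\<in>W. (\<Sum>j\<in>W. L c i j * M j l) * G (\<epsilon>s n) k l)"
        by (rule sum.cong) (simp_all only: invr[OF i])
      also have "\<dots> = (\<Sum>j\<in>W. L c i j * (\<Sum>l\<in>W. M j l * G (\<epsilon>s n) k l))"
        unfolding sum_distrib_right sum_distrib_left by (subst sum.swap) (simp add: mult.assoc)
      also have "\<dots> = 0" by (rule sum.neutral) (simp add: MG)
      finally show ?thesis .
    qed
    then show ?thesis using k(1) by (auto simp: K_def)
  qed
  \<comment> \<open>The default \<open>h\<close> makes \<open>Hoff\<close> and \<open>Hbd\<close>
    hold for all n, also where no fixed point is available.\<close>
  define H where "H n = (if 2 * \<tau> n \<le> \<rho> \<and> (\<forall>e\<in>E. norm (\<epsilon>s n e - \<epsilon> e) \<le> \<rho>)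
    then (SOME k. (\<forall>v\<in>W. norm (k v - h v) \<le> 2 * \<tau> n) \<and> (\<forall>v. v \<notin> W \<longrightarrow> k v = h v) \<and>
      (\<forall>i\<in>W. G (\<epsilon>s n) k i = 0)) else h)" for n
  have H: "(\<forall>v\<in>W. norm (H n v - h v) \<le> 2 * \<tau> n) \<and> (\<forall>v. v \<notin> W \<longrightarrow> H n v = h v) \<and> (\<forall>i\<in>W. G (\<epsilon>s n) (H n) i = 0)"
    if n: "2 * \<tau> n \<le> \<rho>" "\<forall>e\<in>E. norm (\<epsilon>s n e - \<epsilon> e) \<le> \<rho>" for n
  proof -
    have "H n = (SOME k. (\<forall>v\<in>W. norm (k v - h v) \<le> 2 * \<tau> n) \<and> (\<forall>v. v \<notin> W \<longrightarrow> k v = h v) \<and>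
      (\<forall>i\<in>W. G (\<epsilon>s n) k i = 0))" using n by (simp add: H_def)
    then show ?thesis using someI_ex[OF fix_ex[OF n]] by metis
  qed
  have Hoff: "H n v = h v" if "v \<notin> W" for n v
    using H[of n] that by (cases "2 * \<tau> n \<le> \<rho> \<and> (\<forall>e\<in>E. norm (\<epsilon>s n e - \<epsilon> e) \<le> \<rho>)") (auto simp: H_def)
  have Hbd: "norm (H n v - h v) \<le> 2 * \<tau> n" for n v
  proof (cases "2 * \<tau> n \<le> \<rho> \<and> (\<forall>e\<in>E. norm (\<epsilon>s n e - \<epsilon> e) \<le> \<rho>)")
    case True
    then show ?thesis using H[of n] Hoff[of v n] \<tau>0[of n] by (cases "v \<in> W") auto
  next
    case False
    then have "H n = h" by (auto simp: H_def)
    then show ?thesis using \<tau>0[of n] by simp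
  qed
  have Hlim: "(\<lambda>n. H n v) \<longlonglongrightarrow> h v" for v
    by (rule LIM_zero_cancel, rule Lim_null_comparison[OF always_eventually tendsto_mult_right_zero[OF \<tau>]])
      (rule allI, rule Hbd)
  then have Hlim': "\<forall>v\<in>V. (\<lambda>n. H n v) \<longlonglongrightarrow> h v" by blast
  note sec = secant_weights_tendsto[OF ne \<epsilon>s Hlim' Hlim']
  have "(\<lambda>n. \<Delta> (\<lambda>e. \<epsilon>s n e / edge_prod (H n) (H n) e)) \<longlonglongrightarrow> \<Delta> c"
    by (rule polyfun_tendsto[OF poly_\<Delta>]) (unfold c_def, rule sec(1))
  then have ev1: "eventually (\<lambda>n. \<Delta> (\<lambda>e. \<epsilon>s n e / edge_prod (H n) (H n) e) \<noteq> 0) sequentially"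
    by (rule tendsto_imp_eventually_ne) (rule \<Delta>c)
  have "(\<lambda>n. 2 * \<tau> n) \<longlonglongrightarrow> 0" using tendsto_mult_right_zero[OF \<tau>] .
  then have ev2: "eventually (\<lambda>n. 2 * \<tau> n < \<rho>) sequentially" by (rule order_tendstoD) (rule \<rho>)
  have ev3: "eventually (\<lambda>n. \<forall>e\<in>E. norm (\<epsilon>s n e - \<epsilon> e) < \<rho>) sequentially"
  proof (intro eventually_ball_finite finE ballI)
    fix e assume "e \<in> E"
    then have "(\<lambda>n. norm (\<epsilon>s n e - \<epsilon> e)) \<longlonglongrightarrow> 0" using \<epsilon>s by (intro tendsto_norm_zero LIM_zero) blast
    then show "eventually (\<lambda>n. norm (\<epsilon>s n e - \<epsilon> e) < \<rho>) sequentially" by (rule order_tendstoD) (rule \<rho>)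
  qed
  have "eventually (\<lambda>n. H n \<in> Sol (\<epsilon>s n)) sequentially"
    using ev1 ev2 ev3 sec(2)
  proof eventually_elim
    case (elim n)
    have "2 * \<tau> n \<le> \<rho>" "\<forall>e\<in>E. norm (\<epsilon>s n e - \<epsilon> e) \<le> \<rho>" using elim by auto
    note Hn = H[OF this]
    show ?case
    proof (rule SolI)
      show "H n \<in> V \<rightarrow>\<^sub>E UNIV"
        using Hoff Sol_ext[OF h] by (auto simp: PiE_def extensional_def)
      show "H n b = complex_of_real (u b)" if "b \<in> B" for b using Hoff[of b n] Sol_bd[OF h that] that by simp
    qed (use elim Hn in \<open>auto simp: G_def\<close>)
  qed
  then show ?thesis using Hlim' by blast
qed

lemma card_Sol_generic:
  assumes f: "generic_poly f" and \<epsilon>0: "f \<epsilon>0 \<noteq> 0" and \<epsilon>1: "f \<epsilon>1 \<noteq> 0"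
  shows "finite (Sol \<epsilon>0)" "card (Sol \<epsilon>0) = card (Sol \<epsilon>1)"
proof -
  define l where "l s e = \<epsilon>0 e + s * (\<epsilon>1 e - \<epsilon>0 e)" for s e
  have l0: "l 0 = \<epsilon>0" and l1: "l 1 = \<epsilon>1" by (auto simp: l_def)
  obtain d where "polyfun E d f" using f by (auto simp: generic_poly_def)
  then obtain p where p: "\<And>s. poly p s = f (l s)"
    using polyfun_line[of E d f \<epsilon>0 "\<lambda>e. \<epsilon>1 e - \<epsilon>0 e"] unfolding l_def by blast
  define A where "A = {s. poly p s \<noteq> 0}"
  have "poly p 0 \<noteq> 0" using p[of 0] \<epsilon>0 l0 by simp
  then have "p \<noteq> 0" by auto
  then have "finite {s. poly p s = 0}" by (rule poly_roots_finite)
  moreover have "A = UNIV - {s. poly p s = 0}" by (auto simp: A_def)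
  ultimately have conA: "connected A"
    using connected_open_diff_countable[of "UNIV :: complex set" "{s. poly p s = 0}"]
      convex_connected[OF convex_UNIV] by (simp add: countable_finite)
  have loc: "finite (Sol (l s0))" "eventually (\<lambda>s. card (Sol (l s0)) = card (Sol (l s))) (at s0 within A)"
    if s0: "s0 \<in> A" for s0
  proof -
    have fs0: "f (l s0) \<noteq> 0" using s0 p by (simp add: A_def)
    then have nz: "\<forall>e\<in>E. l s0 e \<noteq> 0" using f by (simp add: generic_poly_def)
    have lim: "\<forall>e\<in>E. (\<lambda>n. l (S n) e) \<longlonglongrightarrow> l s0 e" if "S \<longlonglongrightarrow> s0" for S
      unfolding l_def using that by (intro ballI tendsto_intros)
    have fact1: "\<exists>r h. strict_mono (r :: nat \<Rightarrow> nat) \<and> h \<in> Sol (l s0) \<and> (\<forall>v\<in>V. (\<lambda>n. H (r n) v) \<longlonglongrightarrow> h v)"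
      if "S \<longlonglongrightarrow> s0" "\<And>n. H n \<in> Sol (l (S n))" for S H
      by (rule Sol_proper[OF f fs0 lim[OF that(1)] that(2)])
    have fact2: "\<exists>n. H n = K n"
      if "S \<longlonglongrightarrow> s0" "h \<in> Sol (l s0)" "\<And>n. H n \<in> Sol (l (S n))" "\<And>n. K n \<in> Sol (l (S n))"
        "\<And>v. v \<in> V \<Longrightarrow> (\<lambda>n. H n v) \<longlonglongrightarrow> h v" "\<And>v. v \<in> V \<Longrightarrow> (\<lambda>n. K n v) \<longlonglongrightarrow> h v" for S H K h
      by (rule Sol_locally_unique[OF nz that(2) lim[OF that(1)], of H K]) (use that in blast)+
    have fact3: "\<exists>H. eventually (\<lambda>n. H n \<in> Sol (l (S n))) sequentially \<and> (\<forall>v\<in>V. (\<lambda>n. H n v) \<longlonglongrightarrow> h v)"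
      if "S \<longlonglongrightarrow> s0" "h \<in> Sol (l s0)" for S h
      by (rule Sol_locally_exists[OF nz that(2) lim[OF that(1)]])
    have ext: "Sol (l s) \<subseteq> V \<rightarrow>\<^sub>E UNIV" for s using Sol_ext by blast
    show "finite (Sol (l s0))"
      by (rule card_locally_constant(1)[where Sol = "\<lambda>s. Sol (l s)", OF finV ext fact1 fact2 fact3])
    show "eventually (\<lambda>s. card (Sol (l s0)) = card (Sol (l s))) (at s0 within A)"
      by (rule card_locally_constant(2)[where Sol = "\<lambda>s. Sol (l s)", OF finV ext fact1 fact2 fact3])
  qed
  have A01: "0 \<in> A" "1 \<in> A" using p[of 0] p[of 1] \<epsilon>0 \<epsilon>1 l0 l1 by (auto simp: A_def)
  show "finite (Sol \<epsilon>0)" using loc(1)[OF A01(1)] l0 by simp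
  have "card (Sol (l 0)) = card (Sol (l 1))"
    by (rule connected_local_const[OF conA A01]) (use loc(2) in blast)
  then show "card (Sol \<epsilon>0) = card (Sol \<epsilon>1)" by (simp add: l0 l1)
qed

end

section \<open>Positive weights and the regions\<close>

lemma vertex_weight_eq_1_iff: "vertex_weight D i = 1 \<longleftrightarrow> (\<exists>x. (x, i) \<in> D) \<and> (\<exists>y. (i, y) \<in> D)"
  by (auto simp: vertex_weight_def)

section \<open>Maximum principles, and the maximiser in a region\<close>

context dirichlet_problem
begin

lemma B_nonempty: "B \<noteq> {}"
  using cardB by auto

lemma reachable: "x \<in> V \<Longrightarrow> y \<in> V \<Longrightarrow> (x, y) \<in> {(a, b). {a, b} \<in> E}\<^sup>*"
  using conn by (simp add: connected_graph_def)

lemma nb_nonempty: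
  assumes "i \<in> W"
  shows "nb i \<noteq> {}"
proof -
  obtain b where b: "b \<in> B" using B_nonempty by blast
  then have "(i, b) \<in> {(a, b). {a, b} \<in> E}\<^sup>*" using reachable assms BV by blast
  then show ?thesis
  proof (cases rule: converse_rtranclE)
    case base
    then show ?thesis using assms b by simp
  next
    case (step y)
    then show ?thesis by (auto simp: nb)
  qed
qed

text \<open>Otherwise the maximum of \<open>d\<close> is attained only at interior vertices. There a
  sum of nonnegative terms is 0, so all neighbours attain the maximum too, and it spreads along a
  path to B.\<close>

lemma maximum_principle:
  fixes c :: "'v set \<Rightarrow> real" and d :: "'v \<Rightarrow> real"
  assumes c: "\<forall>e\<in>E. c e > 0" and d: "\<forall>i\<in>W. (\<Sum>j\<in>nb i. c {i, j} * (d i - d j)) = 0" and v: "v \<in> V"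
  shows "\<exists>b\<in>B. d v \<le> d b"
proof (rule ccontr)
  assume no: "\<not> ?thesis"
  define m where "m = Max (d ` V)"
  have le: "d x \<le> m" if "x \<in> V" for x using that finV by (simp add: m_def)
  have "m \<in> d ` V" unfolding m_def using finV v by (intro Max_in) auto
  then obtain x0 where x0: "x0 \<in> V" "d x0 = m" by auto
  have notB: "x \<notin> B" if "d x = m" for x using no le[OF v] that by auto
  obtain b where b: "b \<in> B" using B_nonempty by blast
  have "(x0, b) \<in> {(a, b). {a, b} \<in> E}\<^sup>*" using reachable x0 b BV by blast
  then have "d b = m"
  proof (induction rule: rtrancl_induct)
    case base
    show ?case by (rule x0(2))
  next
    case (step y z)
    then have e: "{y, z} \<in> E" by simp
    then have y: "y \<in> V" using edge by blast
    then have yW: "y \<in> W" using notB step.IH by blast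
    have nn: "0 \<le> c {y, j} * (d y - d j)" if "j \<in> nb y" for j
    proof (intro mult_nonneg_nonneg)
      have "{y, j} \<in> E" using that by (simp add: nb)
      then show "0 \<le> c {y, j}" "0 \<le> d y - d j" using c edge le[of j] step.IH by (auto intro: less_imp_le)
    qed
    have "\<forall>j\<in>nb y. c {y, j} * (d y - d j) = 0"
      using d yW sum_nonneg_eq_0_iff[of "nb y" "\<lambda>j. c {y, j} * (d y - d j)", OF fin_nb nn] by blast
    then have "c {y, z} * (d y - d z) = 0" using e by (simp add: nb)
    then show ?case using c e step.IH by auto
  qed
  then show False using notB b by blast
qed

lemma harmonic_zero_boundary:
  fixes c :: "'v set \<Rightarrow> real" and d :: "'v \<Rightarrow> real"
  assumes c: "\<forall>e\<in>E. c e > 0" and d: "\<forall>i\<in>W. (\<Sum>j\<in>nb i. c {i, j} * (d i - d j)) = 0"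
    and B: "\<forall>b\<in>B. d b = 0" and v: "v \<in> V"
  shows "d v = 0"
proof -
  have "(\<Sum>j\<in>nb i. c {i, j} * (- d i - - d j)) = - (\<Sum>j\<in>nb i. c {i, j} * (d i - d j))" for i
    unfolding sum_negf[symmetric] by (rule sum.cong) (auto simp: algebra_simps)
  then have "\<forall>i\<in>W. (\<Sum>j\<in>nb i. c {i, j} * (- d i - - d j)) = 0" using d by simp
  from maximum_principle[OF c this v] maximum_principle[OF c d v] show ?thesis using B by force
qed

text \<open>Among the points where \<open>k\<close> is maximal, take one where \<open>k0\<close> is
  largest. An outgoing edge would lead to another maximum of \<open>k\<close> with larger
  \<open>k0\<close>, so the point lies in B. On the boundary of a region \<open>k\<close> is only
  weakly monotone along D, and \<open>k0\<close> breaks the ties.\<close>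

lemma boundary_maximum:
  fixes k k0 :: "'v \<Rightarrow> real"
  assumes out: "\<forall>i\<in>W. \<exists>y. (i, y) \<in> D"
    and D: "\<And>x y. (x, y) \<in> D \<Longrightarrow> y \<in> V \<and> k0 x < k0 y \<and> k x \<le> k y" and v: "v \<in> V"
  shows "\<exists>b\<in>B. k v \<le> k b"
proof -
  define X where "X = {x \<in> V. k x = Max (k ` V)}"
  have le: "k x \<le> Max (k ` V)" if "x \<in> V" for x using that finV by simp
  have "Max (k ` V) \<in> k ` V" using finV v by (intro Max_in) auto
  then have X: "X \<noteq> {}" "finite X" using finV by (auto simp: X_def)
  have "Max (k0 ` X) \<in> k0 ` X" using X by (intro Max_in) auto
  then obtain t where t: "t \<in> X" "k0 t = Max (k0 ` X)" by auto
  have "t \<in> B"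
  proof (rule ccontr)
    assume "t \<notin> B"
    then obtain y where y: "(t, y) \<in> D" using out t(1) by (auto simp: X_def)
    then have "y \<in> X" using le[of y] t(1) D[OF y] by (auto simp: X_def)
    then have "k0 y \<le> k0 t" unfolding t(2) using X by simp
    then show False using D[OF y] by simp
  qed
  moreover have "k v \<le> k t" using t(1) le[OF v] by (simp add: X_def)
  ultimately show ?thesis by blast
qed

text \<open>Without interior sources and sinks, \<open>boundary_maximum\<close> and its mirror image
  bound the closed region, so the product of powers attains its maximum. The maximum is positive,
  hence attained off the walls, where the logarithmic derivatives vanish.\<close>

lemma exists_balanced_configuration:
  fixes r :: "'v set \<Rightarrow> real"
  assumes r: "\<forall>e\<in>E. r e > 0" and k0: "k0 \<in> config u B E" and vertex_weight: "\<forall>i\<in>W. vertex_weight (orientation E k0) i = 1"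
  shows "\<exists>k\<in>config u B E. orientation E k = orientation E k0 \<and> (\<forall>i\<in>W. (\<Sum>j\<in>nb i. r {i, j} / (k i - k j)) = 0)"
proof -
  define D where "D = orientation E k0"
  have DE: "{x, y} \<in> E" "k0 x < k0 y" "x \<in> V" "y \<in> V" if "(x, y) \<in> D" for x y
    using that edge[of "{x, y}"] by (auto simp: D_def orientation_iff)
  have finD: "finite D" using DE finV by (intro finite_subset[of D "V \<times> V"]) auto
  \<comment> \<open>The closed region: the inequalities along D are weak. Coordinates outside V are
    fixed at 0.\<close>
  define C where "C = {k. (\<forall>b\<in>B. k b = u b) \<and> (\<forall>v. v \<notin> V \<longrightarrow> k v = 0) \<and> (\<forall>(x, y)\<in>D. k x \<le> k y)}"
  have finB: "finite B" using BV finV finite_subset by blast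
  define Mx where "Mx = Max (u ` B)"
  define Mn where "Mn = Min (u ` B)"
  have up: "k v \<le> Mx" if k: "k \<in> C" and v: "v \<in> V" for k v
  proof -
    have "\<exists>b\<in>B. k v \<le> k b"
    proof (rule boundary_maximum[OF _ _ v])
      show "\<forall>i\<in>W. \<exists>y. (i, y) \<in> D" using vertex_weight by (auto simp: vertex_weight_eq_1_iff D_def)
      show "y \<in> V \<and> k0 x < k0 y \<and> k x \<le> k y" if "(x, y) \<in> D" for x y
        using that DE[OF that] k by (auto simp: C_def)
    qed
    then show ?thesis using k finB by (auto simp: C_def Mx_def intro: order_trans)
  qed
  have lo: "Mn \<le> k v" if k: "k \<in> C" and v: "v \<in> V" for k v
  proof -
    \<comment> \<open>The lower bound is the upper bound for -k and the reversed
      orientation.\<close>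
    have "\<exists>b\<in>B. - k v \<le> - k b"
    proof (rule boundary_maximum[OF _ _ v])
      show "\<forall>i\<in>W. \<exists>y. (i, y) \<in> D\<inverse>" using vertex_weight by (auto simp: vertex_weight_eq_1_iff D_def)
      show "y \<in> V \<and> - k0 x < - k0 y \<and> - k x \<le> - k y" if "(x, y) \<in> D\<inverse>" for x y
        using that DE[of y x] k by (auto simp: C_def)
    qed
    then show ?thesis using k finB by (auto simp: C_def Mn_def intro: order_trans[rotated])
  qed
  \<comment> \<open>A product of powers, unlike a sum of logarithms, is continuous up to the walls,
    where it is 0.\<close>
  define \<Phi> where "\<Phi> k = (\<Prod>p\<in>D. (k (snd p) - k (fst p)) powr r {fst p, snd p})" for k
  have rD: "r {fst p, snd p} > 0" if "p \<in> D" for p using that DE(1)[of "fst p" "snd p"] r by auto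
  have CD: "0 \<le> k (snd p) - k (fst p)" if "k \<in> C" "p \<in> D" for k p using that by (auto simp: C_def)
  have "\<Phi> k \<le> (\<Prod>p\<in>D. (Mx - Mn) powr r {fst p, snd p})" if k: "k \<in> C" for k
    unfolding \<Phi>_def
  proof (rule prod_mono)
    fix p assume p: "p \<in> D"
    then have "fst p \<in> V" "snd p \<in> V" using DE(3,4)[of "fst p" "snd p"] by auto
    then have "k (snd p) - k (fst p) \<le> Mx - Mn" using up[OF k] lo[OF k] by (intro diff_mono)
    then show "0 \<le> (k (snd p) - k (fst p)) powr r {fst p, snd p} \<and>
        (k (snd p) - k (fst p)) powr r {fst p, snd p} \<le> (Mx - Mn) powr r {fst p, snd p}"
      using CD[OF k p] rD[OF p] by (auto intro: powr_mono2)
  qed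
  then have bdd: "bdd_above (\<Phi> ` C)" by (rule bdd_aboveI2)
  define k0' where "k0' v = (if v \<in> V then k0 v else 0)" for v
  have k0'C: "k0' \<in> C"
  proof -
    have "k0' b = u b" if "b \<in> B" for b using that k0 BV by (auto simp: k0'_def config_def)
    moreover have "k0' x \<le> k0' y" if "(x, y) \<in> D" for x y using DE[OF that] by (simp add: k0'_def)
    moreover have "k0' v = 0" if "v \<notin> V" for v using that by (simp add: k0'_def)
    ultimately show ?thesis unfolding C_def by blast
  qed
  have \<Phi>0: "\<Phi> k0' > 0"
  proof -
    have "k0' (snd p) - k0' (fst p) > 0" if "p \<in> D" for p
      using DE[of "fst p" "snd p"] that by (simp add: k0'_def)
    then show ?thesis unfolding \<Phi>_def by (intro prod_pos) (simp add: less_imp_neq[symmetric])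
  qed
  define S where "S = Sup (\<Phi> ` C)"
  have SU: "\<Phi> k \<le> S" if "k \<in> C" for k unfolding S_def using that bdd by (intro cSup_upper) auto
  have "\<exists>k\<in>C. S - inverse (real (Suc n)) < \<Phi> k" for n
  proof -
    have "S - inverse (real (Suc n)) < Sup (\<Phi> ` C)" unfolding S_def[symmetric] by simp
    from less_cSupD[OF _ this] show ?thesis using k0'C by blast
  qed
  then obtain X where X: "\<And>n. X n \<in> C" "\<And>n. S - inverse (real (Suc n)) < \<Phi> (X n)" by metis
  have "bounded (range (\<lambda>n. X n v))" if "v \<in> V" for v
    by (rule bounded_subset[OF bounded_closed_interval[of Mn Mx]]) (use up[OF X(1) that] lo[OF X(1) that] in auto)
  then obtain s l where s: "strict_mono (s :: nat \<Rightarrow> nat)" "\<And>v. v \<in> V \<Longrightarrow> (\<lambda>n. X (s n) v) \<longlonglongrightarrow> l v"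
    using convergent_subsequence_on[OF finV, of X] by blast
  define k where "k v = (if v \<in> V then l v else 0)" for v
  have klim: "(\<lambda>n. X (s n) v) \<longlonglongrightarrow> k v" for v
    using s(2)[of v] X(1) by (cases "v \<in> V") (simp_all add: k_def C_def)
  have kC: "k \<in> C"
  proof -
    have "k b = u b" if "b \<in> B" for b
    proof (rule LIMSEQ_unique[OF klim])
      show "(\<lambda>n. X (s n) b) \<longlonglongrightarrow> u b" using X(1) that by (simp add: C_def)
    qed
    moreover have "k x \<le> k y" if "(x, y) \<in> D" for x y
    proof (rule LIMSEQ_le[OF klim klim])
      have "X (s n) x \<le> X (s n) y" for n using X(1)[of "s n"] that by (auto simp: C_def)
      then show "\<exists>N. \<forall>n\<ge>N. X (s n) x \<le> X (s n) y" by blast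
    qed
    moreover have "k v = 0" if "v \<notin> V" for v using that by (simp add: k_def)
    ultimately show ?thesis unfolding C_def by blast
  qed
  have lim1: "(\<lambda>n. \<Phi> (X (s n))) \<longlonglongrightarrow> \<Phi> k" unfolding \<Phi>_def
  proof (rule tendsto_prod)
    fix p assume p: "p \<in> D"
    show "(\<lambda>n. (X (s n) (snd p) - X (s n) (fst p)) powr r {fst p, snd p}) \<longlonglongrightarrow> (k (snd p) - k (fst p)) powr r {fst p, snd p}"
      by (rule tendsto_powr'[OF tendsto_diff[OF klim klim] tendsto_const])
        (intro disjI2 conjI rD[OF p] always_eventually allI CD[OF X(1) p])
  qed
  have lim2: "(\<lambda>n. S - inverse (real (Suc (s n)))) \<longlonglongrightarrow> S - 0"
    using LIMSEQ_subseq_LIMSEQ[OF LIMSEQ_inverse_real_of_nat s(1)] by (intro tendsto_diff tendsto_const) (simp add: o_def)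
  have "S - 0 \<le> \<Phi> k"
    by (rule LIMSEQ_le[OF lim2 lim1]) (intro exI[of _ 0] allI impI less_imp_le X(2))
  then have kmax: "\<Phi> k' \<le> \<Phi> k" if "k' \<in> C" for k' using SU[OF that] by simp
  have "\<Phi> k > 0" using kmax[OF k0'C] \<Phi>0 by simp
  then have kD: "k x < k y" if "(x, y) \<in> D" for x y
  proof -
    have "(k (snd (x, y)) - k (fst (x, y))) powr r {fst (x, y), snd (x, y)} \<noteq> 0"
    proof
      assume "(k (snd (x, y)) - k (fst (x, y))) powr r {fst (x, y), snd (x, y)} = 0"
      then have "\<Phi> k = 0" unfolding \<Phi>_def by (intro prod_zero[OF finD] bexI[OF _ that])
      then show False using \<open>\<Phi> k > 0\<close> by simp
    qed
    then show ?thesis using CD[OF kC that] by auto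
  qed
  have oriD: "orientation E k' = D" if "\<And>x y. (x, y) \<in> D \<Longrightarrow> k' x < k' y" for k'
  proof -
    have "(x, y) \<in> orientation E k' \<longleftrightarrow> (x, y) \<in> D" for x y
    proof
      assume xy: "(x, y) \<in> orientation E k'"
      then have "{x, y} \<in> E" by (simp add: orientation_iff)
      then have "(x, y) \<in> D \<or> (y, x) \<in> D"
        using config_neq[OF k0] by (auto simp: D_def orientation_iff insert_commute)
      then show "(x, y) \<in> D" using that[of y x] xy by (auto simp: orientation_iff)
    next
      assume "(x, y) \<in> D"
      then show "(x, y) \<in> orientation E k'" using that DE(1) by (simp add: orientation_iff)
    qed
    then show ?thesis by auto
  qed
  have orik: "orientation E k = D" by (rule oriD[OF kD])
  have kconf: "k \<in> config u B E"
    by (rule config_orientation_eq[OF k0]) (use orik kC in \<open>auto simp: D_def C_def\<close>)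
  have "(\<Sum>j\<in>nb i. r {i, j} / (k i - k j)) = 0" if i: "i \<in> W" for i
  proof -
    \<comment> \<open>The logarithm of \<Phi> as a function of the coordinate i; the two are
      compared only near \<open>k i\<close>, where all differences are positive.\<close>
    define \<psi> where "\<psi> t = (\<Sum>p\<in>D. r {fst p, snd p} * ln ((k(i := t)) (snd p) - (k(i := t)) (fst p)))" for t
    define g where "g p = r {fst p, snd p} * ((of_bool (snd p = i) - of_bool (fst p = i)) / (k (snd p) - k (fst p)))" for p
    have coord: "((\<lambda>t. (k(i := t)) x) has_real_derivative of_bool (x = i)) (at t)" for x t
      by (cases "x = i") auto
    have der: "(\<psi> has_real_derivative (\<Sum>p\<in>D. g p)) (at (k i))"
      unfolding \<psi>_def
    proof (rule DERIV_sum)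
      fix p assume p: "p \<in> D"
      have pos: "k (snd p) - k (fst p) > 0" using kD[of "fst p" "snd p"] p by simp
      have "((\<lambda>t. (k(i := t)) (snd p) - (k(i := t)) (fst p)) has_real_derivative
          of_bool (snd p = i) - of_bool (fst p = i)) (at (k i))"
        by (rule DERIV_diff[OF coord coord])
      moreover have "(k(i := k i)) (snd p) - (k(i := k i)) (fst p) > 0" using pos by simp
      ultimately have "((\<lambda>t. ln ((k(i := t)) (snd p) - (k(i := t)) (fst p))) has_real_derivative
          1 / ((k(i := k i)) (snd p) - (k(i := k i)) (fst p)) * (of_bool (snd p = i) - of_bool (fst p = i))) (at (k i))"
        by (intro DERIV_chain2[OF DERIV_ln_divide])
      from DERIV_cmult[OF this, of "r {fst p, snd p}"]
      show "((\<lambda>t. r {fst p, snd p} * ln ((k(i := t)) (snd p) - (k(i := t)) (fst p))) has_real_derivative g p) (at (k i))"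
        by (simp only: g_def fun_upd_triv times_divide_eq_left mult_1_left)
    qed
    have ln\<Phi>: "ln (\<Phi> (k(i := t))) = \<psi> t" "\<Phi> (k(i := t)) > 0" if "orientation E (k(i := t)) = D" for t
    proof -
      have pos: "(k(i := t)) (snd p) - (k(i := t)) (fst p) > 0" if "p \<in> D" for p
        using that \<open>orientation E (k(i := t)) = D\<close> by (cases p) (auto simp: orientation_iff simp del: fun_upd_apply)
      show "\<Phi> (k(i := t)) > 0" unfolding \<Phi>_def using pos by (intro prod_pos) (simp add: less_imp_neq[symmetric])
      have "ln (\<Phi> (k(i := t))) = (\<Sum>p\<in>D. ln (((k(i := t)) (snd p) - (k(i := t)) (fst p)) powr r {fst p, snd p}))"
        unfolding \<Phi>_def using pos by (intro ln_prod finD) (simp add: less_imp_neq[symmetric])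
      also have "\<dots> = \<psi> t" unfolding \<psi>_def
        by (rule sum.cong[OF refl], subst ln_powr) (use pos in \<open>force+\<close>)
      finally show "ln (\<Phi> (k(i := t))) = \<psi> t" .
    qed
    have iB: "i \<notin> B" using i by simp
    obtain \<delta> where \<delta>: "\<delta> > 0" "\<forall>t. \<bar>t - k i\<bar> < \<delta> \<longrightarrow> orientation E (k(i := t)) = orientation E k \<and> k(i := t) \<in> config u B E"
      using orientation_perturb[OF kconf iB finE] edge finV finite_subset by metis
    have "(\<Sum>p\<in>D. g p) = 0"
    proof (rule DERIV_local_max[OF der \<delta>(1)], intro allI impI)
      fix t assume "\<bar>k i - t\<bar> < \<delta>"
      then have t: "orientation E (k(i := t)) = D" using \<delta>(2) orik by (simp add: abs_minus_commute)
      have "k(i := t) \<in> C"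
      proof -
        have "(k(i := t)) x \<le> (k(i := t)) y" if "(x, y) \<in> D" for x y
          using that t by (auto simp: orientation_iff simp del: fun_upd_apply intro: less_imp_le)
        moreover have "(k(i := t)) v = 0" if "v \<notin> V" for v using that i by (auto simp: k_def)
        moreover have "(k(i := t)) b = u b" if "b \<in> B" for b using that i kC by (auto simp: C_def)
        ultimately show ?thesis unfolding C_def by blast
      qed
      then have "\<Phi> (k(i := t)) \<le> \<Phi> k" by (rule kmax)
      then have "ln (\<Phi> (k(i := t))) \<le> ln (\<Phi> (k(i := k i)))" using ln\<Phi>(2)[OF t] by simp
      then show "\<psi> t \<le> \<psi> (k i)" using ln\<Phi>(1)[OF t] ln\<Phi>(1)[of "k i"] orik by simp
    qed
    moreover have "(\<Sum>p\<in>D. g p) = (\<Sum>j\<in>nb i. r {i, j} / (k i - k j))"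
    proof -
      \<comment> \<open>The edge of D between \<open>i\<close> and \<open>j\<close> in its
        direction; all other terms of the derivative are 0, as they do not involve
        \<open>i\<close>.\<close>
      define q where "q j = (if k j < k i then (j, i) else (i, j))" for j
      have inj: "inj_on q (nb i)" by (auto simp: inj_on_def q_def split: if_splits)
      have qD: "q j \<in> D" if "j \<in> nb i" for j
        using that config_neq[OF kconf, of i j] unfolding orik[symmetric]
        by (auto simp: q_def orientation_iff nb insert_commute)
      have "(\<Sum>p\<in>D. g p) = (\<Sum>p\<in>q ` nb i. g p)"
      proof (rule sum.mono_neutral_right[OF finD])
        show "q ` nb i \<subseteq> D" using qD by blast
        show "\<forall>p\<in>D - q ` nb i. g p = 0"
        proof
          fix p assume p: "p \<in> D - q ` nb i"
          obtain x y where xy: "p = (x, y)" by (cases p)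
          have "x \<noteq> i"
          proof
            assume "x = i"
            then have "y \<in> nb i" "p = q y" using p xy DE(1)[of x y] kD[of x y] by (auto simp: nb q_def)
            then show False using p by blast
          qed
          moreover have "y \<noteq> i"
          proof
            assume "y = i"
            then have "x \<in> nb i" "p = q x" using p xy DE(1)[of x y] kD[of x y] by (auto simp: nb q_def insert_commute)
            then show False using p by blast
          qed
          ultimately show "g p = 0" by (simp add: g_def xy)
        qed
      qed
      also have "\<dots> = (\<Sum>j\<in>nb i. g (q j))" using inj by (simp add: sum.reindex)
      also have "\<dots> = (\<Sum>j\<in>nb i. r {i, j} / (k i - k j))"
      proof (rule sum.cong[OF refl])
        fix j assume "j \<in> nb i"
        then have "{i, j} \<in> E" by (simp add: nb)
        then have ij: "i \<noteq> j" by (rule edge_neq)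
        show "g (q j) = r {i, j} / (k i - k j)"
        proof (cases "k j < k i")
          case True
          then show ?thesis using ij by (simp add: g_def q_def insert_commute)
        next
          case False
          have "- a / b = a / - b" for a b :: real by simp
          then show ?thesis using ij False by (simp add: g_def q_def minus_divide_right[symmetric]) (metis minus_diff_eq minus_divide_right)
        qed
      qed
      finally show ?thesis .
    qed
    ultimately show ?thesis by simp
  qed
  then show ?thesis using kconf orik by (auto simp: D_def)
qed

end

section \<open>Solutions for positive \<epsilon> correspond to regions\<close>

context dirichlet_rational
begin

text \<open>The real and imaginary parts of a kernel vector are harmonic for positive weights and
  vanish on B, hence everywhere on V.\<close>

lemma positive_nonsingular:
  fixes r :: "'v set \<Rightarrow> real"
  assumes r: "\<forall>e\<in>E. r e > 0"
  shows "\<Delta> (\<lambda>e. complex_of_real (r e)) \<noteq> 0"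
proof
  assume "\<Delta> (\<lambda>e. complex_of_real (r e)) = 0"
  from kernel[OF this] obtain d where d: "\<exists>i\<in>W. d i \<noteq> 0" "\<forall>b\<in>B. d b = 0"
    "\<forall>i\<in>W. (\<Sum>j\<in>nb i. complex_of_real (r {i, j}) * (d i - d j)) = 0" by (elim exE conjE)
  have "(\<Sum>j\<in>nb i. r {i, j} * (Re (d i) - Re (d j))) = 0" "(\<Sum>j\<in>nb i. r {i, j} * (Im (d i) - Im (d j))) = 0"
    if "i \<in> W" for i
    using arg_cong[OF bspec[OF d(3) that], of Re] arg_cong[OF bspec[OF d(3) that], of Im] by simp_all
  then have "Re (d i) = 0 \<and> Im (d i) = 0" if "i \<in> V" for i
    using harmonic_zero_boundary[OF r, of "\<lambda>v. Re (d v)" i] harmonic_zero_boundary[OF r, of "\<lambda>v. Im (d v)" i] d(2) that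
    by simp
  then show False using d(1) by (auto simp: complex_eq_iff)
qed

context
  fixes r :: "'v set \<Rightarrow> real"
  assumes r: "\<forall>e\<in>E. r e > 0"
begin

abbreviation "S \<equiv> Sol (\<lambda>e. complex_of_real (r e))"

lemma r_nonzero: "\<forall>e\<in>E. complex_of_real (r e) \<noteq> 0"
  using r by auto

lemma Sol_real:
  assumes h: "h \<in> S" and v: "v \<in> V"
  shows "h v = complex_of_real (Re (h v))"
proof -
  define c where "c e = r e / norm (edge_prod h h e)" for e
  have ne: "edge_prod h h e \<noteq> 0" if "e \<in> E" for e by (rule Sol_critical(1)[OF h r_nonzero that])
  have c: "\<forall>e\<in>E. c e > 0" using r ne by (auto simp: c_def)
  have "(\<Sum>j\<in>nb i. c {i, j} * (Im (h i) - Im (h j))) = 0" if i: "i \<in> W" for i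
  proof -
    \<comment> \<open>This is Im (r / z) = - r Im z / |z|^2 for z = h i - h j.\<close>
    have "c {i, j} * (Im (h i) - Im (h j)) = - Im (complex_of_real (r {i, j}) / (h i - h j))" if "j \<in> nb i" for j
    proof -
      have e: "{i, j} \<in> E" using that by (simp add: nb)
      have "norm (edge_prod h h {i, j}) = (Re (h i - h j))\<^sup>2 + (Im (h i - h j))\<^sup>2"
        unfolding edge_prod_edge[OF e] norm_mult unfolding power2_eq_square[symmetric] by (rule cmod_power2)
      then show ?thesis by (simp add: c_def Im_divide)
    qed
    then have "(\<Sum>j\<in>nb i. c {i, j} * (Im (h i) - Im (h j))) = (\<Sum>j\<in>nb i. - Im (complex_of_real (r {i, j}) / (h i - h j)))"
      by (intro sum.cong) auto
    also have "\<dots> = - Im (\<Sum>j\<in>nb i. complex_of_real (r {i, j}) / (h i - h j))"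
      by (simp only: sum_negf Im_sum)
    also have "\<dots> = 0" using Sol_critical(2)[OF h r_nonzero i] by simp
    finally show ?thesis .
  qed
  then have "Im (h v) = 0"
    using harmonic_zero_boundary[OF c, of "\<lambda>v. Im (h v)"] Sol_bd[OF h] v by simp
  then show ?thesis by (simp add: complex_eq_iff)
qed

lemma Sol_configuration:
  assumes h: "h \<in> S"
  shows "(\<lambda>v. Re (h v)) \<in> config u B E"
  unfolding config_def
proof (intro CollectI conjI ballI allI impI)
  show "Re (h b) = u b" if "b \<in> B" for b using Sol_bd[OF h that] by simp
  fix x y assume e: "{x, y} \<in> E"
  have "h x - h y \<noteq> 0" using Sol_critical(1)[OF h r_nonzero e] unfolding edge_prod_edge[OF e] by auto
  moreover have "x \<in> V" "y \<in> V" using edge[OF e] by auto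
  ultimately show "Re (h x) \<noteq> Re (h y)" using Sol_real[OF h] by (metis right_minus_eq)
qed

text \<open>At a source or sink all summands of the equation at \<open>i\<close> have the same sign,
  and \<open>i\<close> has a neighbour, so the sum could not be 0.\<close>

lemma Sol_vertex_weight:
  assumes h: "h \<in> S" and i: "i \<in> W"
  shows "vertex_weight (orientation E (\<lambda>v. Re (h v))) i = 1"
proof -
  let ?k = "\<lambda>v. Re (h v)"
  have iV: "i \<in> V" using i by simp
  have "complex_of_real (\<Sum>j\<in>nb i. r {i, j} / (?k i - ?k j)) = (\<Sum>j\<in>nb i. complex_of_real (r {i, j}) / (h i - h j))"
    unfolding of_real_sum
  proof (rule sum.cong[OF refl])
    fix j assume "j \<in> nb i"
    then have "j \<in> V" by (simp add: neighbours_def)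
    then show "complex_of_real (r {i, j} / (?k i - ?k j)) = complex_of_real (r {i, j}) / (h i - h j)"
      using Sol_real[OF h iV] Sol_real[OF h, of j] by simp
  qed
  then have zero: "(\<Sum>j\<in>nb i. r {i, j} / (?k i - ?k j)) = 0"
    using Sol_critical(2)[OF h r_nonzero i] by (metis of_real_eq_0_iff)
  have e: "{i, j} \<in> E" "r {i, j} > 0" if "j \<in> nb i" for j using that r by (auto simp: nb)
  have "\<exists>j\<in>nb i. ?k j < ?k i"
  proof (rule ccontr)
    assume "\<not> ?thesis"
    then have "?k i < ?k j" if "j \<in> nb i" for j using config_neq[OF Sol_configuration[OF h] e(1)[OF that]] that by blast
    then have "(\<Sum>j\<in>nb i. - (r {i, j} / (?k i - ?k j))) > 0"
      using e(2) by (intro sum_pos fin_nb nb_nonempty i) (simp add: divide_pos_neg)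
    then show False using zero by (simp add: sum_negf)
  qed
  moreover have "\<exists>j\<in>nb i. ?k i < ?k j"
  proof (rule ccontr)
    assume "\<not> ?thesis"
    then have "?k j < ?k i" if "j \<in> nb i" for j using config_neq[OF Sol_configuration[OF h] e(1)[OF that]] that by blast
    then have "(\<Sum>j\<in>nb i. r {i, j} / (?k i - ?k j)) > 0"
      using e(2) by (intro sum_pos fin_nb nb_nonempty i) simp
    then show False using zero by simp
  qed
  ultimately show ?thesis using e(1) by (auto simp: vertex_weight_eq_1_iff orientation_iff insert_commute)
qed

text \<open>In one region the differences of \<open>h\<close> and \<open>k\<close> along each edge
  have equal signs, so the secant weights are positive, hence nonsingular, and h - k
  vanishes.\<close>

lemma Sol_orientation_inj:
  assumes h: "h \<in> S" and k: "k \<in> S" and eq: "orientation E (\<lambda>v. Re (h v)) = orientation E (\<lambda>v. Re (k v))"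
  shows "h = k"
proof -
  let ?h = "\<lambda>v. Re (h v)" and ?k = "\<lambda>v. Re (k v)"
  have pos: "edge_prod ?h ?k e > 0" and real: "edge_prod h k e = complex_of_real (edge_prod ?h ?k e)" if e: "e \<in> E" for e
  proof -
    obtain i j where ij: "e = {i, j}" "i \<noteq> j" "i \<in> V" "j \<in> V" using e by (rule edgeE)
    have E: "{i, j} \<in> E" "{j, i} \<in> E" using e ij by (auto simp: insert_commute)
    have "(i, j) \<in> orientation E ?h \<longleftrightarrow> (i, j) \<in> orientation E ?k" "(j, i) \<in> orientation E ?h \<longleftrightarrow> (j, i) \<in> orientation E ?k" using eq by auto
    then have sign: "?h i < ?h j \<longleftrightarrow> ?k i < ?k j" "?h j < ?h i \<longleftrightarrow> ?k j < ?k i" using E by (simp_all add: orientation_iff)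
    have "?h i < ?h j \<or> ?h j < ?h i" using config_neq[OF Sol_configuration[OF h] E(1)] .
    then show "edge_prod ?h ?k e > 0"
    proof
      assume "?h i < ?h j"
      then show ?thesis using sign(1) ij by (simp add: edge_prod_pair mult_neg_neg)
    next
      assume "?h j < ?h i"
      then show ?thesis using sign(2) ij by (simp add: edge_prod_pair)
    qed
    have "edge_prod h k e = edge_prod (\<lambda>v. complex_of_real (?h v)) (\<lambda>v. complex_of_real (?k v)) e"
      by (rule edge_prod_cong) (use Sol_real[OF h] Sol_real[OF k] ij in auto)
    then show "edge_prod h k e = complex_of_real (edge_prod ?h ?k e)" by (simp add: edge_prod_def)
  qed
  have ne: "\<forall>e\<in>E. edge_prod h k e \<noteq> 0"
  proof
    show "edge_prod h k e \<noteq> 0" if "e \<in> E" for e using pos[OF that] real[OF that] by simp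
  qed
  have "\<Delta> (\<lambda>e. complex_of_real (r e / edge_prod ?h ?k e)) \<noteq> 0"
    by (rule positive_nonsingular) (use r pos in auto)
  moreover have "\<Delta> (\<lambda>e. complex_of_real (r e / edge_prod ?h ?k e)) = \<Delta> (\<lambda>e. complex_of_real (r e) / edge_prod h k e)"
    by (rule \<Delta>_cong) (simp add: real)
  ultimately have \<Delta>: "\<Delta> (\<lambda>e. complex_of_real (r e) / edge_prod h k e) \<noteq> 0" by simp
  have "h v - k v = 0" if v: "v \<in> V" for v
  proof (rule trivial_kernel[OF \<Delta>, of "\<lambda>v. h v - k v"])
    show "h b - k b = 0" if "b \<in> B" for b using Sol_bd[OF h that] Sol_bd[OF k that] by simp
    show "(\<Sum>j\<in>nb i. complex_of_real (r {i, j}) / edge_prod h k {i, j} * (h i - k i - (h j - k j))) = 0"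
      if i: "i \<in> W" for i
      using critical_difference[OF ne, where i = i and \<epsilon> = "\<lambda>e. complex_of_real (r e)"]
        Sol_critical(2)[OF h r_nonzero i] Sol_critical(2)[OF k r_nonzero i] by simp
  qed (rule v)
  then show ?thesis by (intro PiE_ext[OF Sol_ext[OF h] Sol_ext[OF k]]) simp
qed

lemma Sol_orientation_surj:
  assumes k0: "k0 \<in> config u B E" and vertex_weight: "\<forall>i\<in>W. vertex_weight (orientation E k0) i = 1"
  shows "\<exists>h\<in>S. orientation E (\<lambda>v. Re (h v)) = orientation E k0"
proof -
  obtain k where k: "k \<in> config u B E" "orientation E k = orientation E k0" "\<And>i. i \<in> W \<Longrightarrow> (\<Sum>j\<in>nb i. r {i, j} / (k i - k j)) = 0"
    using exists_balanced_configuration[OF r k0 vertex_weight] by blast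
  define h where "h v = (if v \<in> V then complex_of_real (k v) else undefined)" for v
  have hE: "edge_prod h h e = complex_of_real (edge_prod k k e)" and pos: "edge_prod k k e > 0" if e: "e \<in> E" for e
  proof -
    obtain i j where ij: "e = {i, j}" "i \<noteq> j" "i \<in> V" "j \<in> V" using e by (rule edgeE)
    have "k i < k j \<or> k j < k i" using config_neq[OF k(1)] e ij by blast
    then show "edge_prod k k e > 0" using ij by (auto simp: edge_prod_pair mult_neg_neg)
    show "edge_prod h h e = complex_of_real (edge_prod k k e)" using ij by (simp add: edge_prod_pair h_def)
  qed
  have "h \<in> S"
  proof (rule SolI)
    show "h \<in> V \<rightarrow>\<^sub>E UNIV" by (auto simp: h_def)
    show "h b = complex_of_real (u b)" if "b \<in> B" for b using that k(1) BV by (auto simp: h_def config_def)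
    show "edge_prod h h e \<noteq> 0" if "e \<in> E" for e using hE[OF that] pos[OF that] by simp
    show "(\<Sum>j\<in>nb i. complex_of_real (r {i, j}) / (h i - h j)) = 0" if i: "i \<in> W" for i
    proof -
      have "(\<Sum>j\<in>nb i. complex_of_real (r {i, j}) / (h i - h j)) = complex_of_real (\<Sum>j\<in>nb i. r {i, j} / (k i - k j))"
        unfolding of_real_sum
        by (rule sum.cong[OF refl]) (use i in \<open>auto simp: h_def neighbours_def\<close>)
      then show ?thesis using k(3)[OF i] by simp
    qed
    \<comment> \<open>Genericity of the weights is automatic, because r e / (k i - k j)^2 is
      positive.\<close>
    have "\<Delta> (\<lambda>e. complex_of_real (r e / edge_prod k k e)) \<noteq> 0"
      by (rule positive_nonsingular) (use r pos in auto)
    moreover have "\<Delta> (\<lambda>e. complex_of_real (r e / edge_prod k k e)) = \<Delta> (\<lambda>e. complex_of_real (r e) / edge_prod h h e)"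
      by (rule \<Delta>_cong) (simp add: hE)
    ultimately show "\<Delta> (\<lambda>e. complex_of_real (r e) / edge_prod h h e) \<noteq> 0" by simp
  qed
  moreover have "orientation E (\<lambda>v. Re (h v)) = orientation E k"
  proof -
    have "{x, y} \<in> E \<and> Re (h x) < Re (h y) \<longleftrightarrow> {x, y} \<in> E \<and> k x < k y" for x y
      using edge[of "{x, y}"] by (auto simp: h_def)
    then show ?thesis by (simp add: orientation_def)
  qed
  ultimately show ?thesis using k(2) by auto
qed

lemma card_Sol_positive: "int (card S) = region_sum u B W E"
proof -
  define R where "R = orientation E ` config u B E"
  have Ef: "finite e" if "e \<in> E" for e using edge[OF that] finV finite_subset by blast
  have finR: "finite R" unfolding R_def by (rule orientation_finite[OF finE Ef])
  have im: "(\<lambda>h. orientation E (\<lambda>v. Re (h v))) ` S = {D \<in> R. \<forall>i\<in>W. vertex_weight D i = 1}"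
  proof (intro equalityI subsetI)
    fix D assume "D \<in> (\<lambda>h. orientation E (\<lambda>v. Re (h v))) ` S"
    then show "D \<in> {D \<in> R. \<forall>i\<in>W. vertex_weight D i = 1}" using Sol_configuration Sol_vertex_weight unfolding R_def by blast
  next
    fix D assume "D \<in> {D \<in> R. \<forall>i\<in>W. vertex_weight D i = 1}"
    then obtain k0 where "k0 \<in> config u B E" "D = orientation E k0" "\<forall>i\<in>W. vertex_weight (orientation E k0) i = 1" by (auto simp: R_def)
    then show "D \<in> (\<lambda>h. orientation E (\<lambda>v. Re (h v))) ` S" using Sol_orientation_surj[of k0] by blast
  qed
  have inj: "inj_on (\<lambda>h. orientation E (\<lambda>v. Re (h v))) S"
    by (intro inj_onI) (rule Sol_orientation_inj)
  have "card S = card {D \<in> R. \<forall>i\<in>W. vertex_weight D i = 1}"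
    using card_image[OF inj] unfolding im by (rule sym)
  also have "int \<dots> = (\<Sum>D\<in>{D \<in> R. \<forall>i\<in>W. vertex_weight D i = 1}. 1)" by simp
  also have "\<dots> = (\<Sum>D\<in>R. if \<forall>i\<in>W. vertex_weight D i = 1 then 1 else 0)" using finR by (rule sum.inter_filter)
  also have "\<dots> = (\<Sum>D\<in>R. \<Prod>i\<in>W. vertex_weight D i)"
  proof (rule sum.cong[OF refl])
    fix D assume "D \<in> R"
    then obtain k where k: "k \<in> config u B E" "D = orientation E k" by (auto simp: R_def)
    \<comment> \<open>No interior vertex is isolated, since the graph is connected and B is
      nonempty. So the weight -1 does not occur, and the product is the indicator of the regions to
      be counted.\<close>
    have wt01: "vertex_weight D i = 0 \<or> vertex_weight D i = 1" if i: "i \<in> W" for i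
    proof -
      obtain j where "j \<in> nb i" using nb_nonempty[OF i] by blast
      then have e: "{i, j} \<in> E" "{j, i} \<in> E" by (auto simp: nb insert_commute)
      then have "(i, j) \<in> D \<or> (j, i) \<in> D" using config_neq[OF k(1)] k(2) by (auto simp: orientation_iff)
      then have "(\<exists>x. (x, i) \<in> D) \<or> (\<exists>y. (i, y) \<in> D)" by blast
      then show ?thesis by (auto simp: vertex_weight_def)
    qed
    show "(if \<forall>i\<in>W. vertex_weight D i = 1 then 1 else 0) = (\<Prod>i\<in>W. vertex_weight D i)"
    proof (cases "\<forall>i\<in>W. vertex_weight D i = 1")
      case False
      then obtain i where "i \<in> W" "vertex_weight D i = 0" using wt01 by blast
      then have "(\<Prod>i\<in>W. vertex_weight D i) = 0" using finW by (intro prod_zero) auto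
      then show ?thesis using False by simp
    qed simp
  qed
  finally show ?thesis by (simp add: region_sum_def R_def)
qed

end

end

theorem corollary1p5:
  fixes V B :: "'v set" and E :: "'v set set" and u :: "'v \<Rightarrow> real"
  assumes "simple_graph V E" and "connected_graph V E"
    and "B \<subset> V" and "card B \<ge> 2"
    and "\<forall>x\<in>B. \<forall>y\<in>B. {x, y} \<notin> E"
    and "inj_on u B"
  shows "holds_generically E (\<lambda>\<epsilon>.
    finite (eps_harmonic_functions V E B u \<epsilon>) \<and>
    real (card (eps_harmonic_functions V E B u \<epsilon>))
      = real_of_int (beta_invariant V (E \<union> complete_on B)) / fact (card B - 2))"
proof -
  interpret dirichlet_problem V B E u by standard (use assms in auto)
  from ex_rational_solution obtain m \<Delta> N where "polyfun E m \<Delta>" "\<forall>i\<in>V. polyfun E m (N i)"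
    "\<forall>c. nonsingular_on W (L c) \<longleftrightarrow> \<Delta> c \<noteq> 0"
    "\<forall>c. \<Delta> c = 0 \<longrightarrow> (\<exists>d. (\<exists>i\<in>W. d i \<noteq> 0) \<and> (\<forall>b\<in>B. d b = 0) \<and>
      (\<forall>i\<in>W. (\<Sum>j\<in>nb i. c {i, j} * (d i - d j)) = 0))"
    "\<forall>c h. \<Delta> c \<noteq> 0 \<longrightarrow> harmonic V E B u c h \<longrightarrow> (\<forall>i\<in>V. h i = N i c / \<Delta> c)"
    by (elim exE conjE)
  then interpret dirichlet_rational V B E u m \<Delta> N by unfold_locales (simp_all)
  obtain f where f: "generic_poly f" using ex_generic_poly by blast
  then obtain d x where fd: "polyfun E d f" "f x \<noteq> 0" by (auto simp: generic_poly_def)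
  \<comment> \<open>The reference point: positive, so that its fibre can be counted by regions, and
    off the hypersurface f = 0, so that its fibre has the generic size.\<close>
  obtain r :: "'v set \<Rightarrow> real" where r: "\<forall>e. r e > 0" "f (\<lambda>e. complex_of_real (r e)) \<noteq> 0"
    using polyfun_nonzero_positive_point[OF finE fd] by blast
  have pos: "\<forall>e\<in>E. r e > 0" using r(1) by blast
  show ?thesis
  proof (rule holds_genericallyI[OF finE fd])
    fix \<epsilon> assume "f \<epsilon> \<noteq> 0"
    note generic = card_Sol_generic[OF f this r(2)]
    have "int (card (Sol \<epsilon>)) = region_sum u B W E" using generic(2) card_Sol_positive[OF pos] by simp
    then have "beta_invariant V (E \<union> complete_on B) = fact (card B - 2) * int (card (Sol \<epsilon>))"
      using beta_invariant_regions[OF assms(1) _ assms(4,5,6)] assms(3) by simp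
    then show "finite (Sol \<epsilon>) \<and> real (card (Sol \<epsilon>)) =
        real_of_int (beta_invariant V (E \<union> complete_on B)) / fact (card B - 2)"
      using generic(1) by simp
  qed
qed

end
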